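(* Let $\mathcal{C}$ be any category with pullbacks and a terminal object. Then $\mathrm{Span}_2(\mathcal{C})$ is a bicategory. Here $\mathrm{Span}_2(\mathcal{C})$ has as objects the objects of $\mathcal{C}$, as morphisms (1-cells) from $A$ to $B$ the spans in $\mathcal{C}$ from $A$ to $B$, and as 2-morphisms (2-cells) the isomorphism classes of spans of spans in $\mathcal{C}$; its hom-categories are the categories $\mathrm{Span}(A,B)$, and its composition, identities, associator and unitors are those described in the context.
   Context: A span from $A$ to $B$ in $\mathcal{C}$, written $S$ or ${}_AS_B$, is a diagram $A\leftarrow S\to B$ in $\mathcal{C}$. For spans $S,T$ from $A$ to $B$, a span of spans ${}_SX_T$ is a diagram $S\leftarrow X\to T$ in $\mathcal{C}$ such that the two composites $X\to S\to A$ and $X\to T\to A$ are equal and the two composites $X\to S\to B$ and $X\to T\to B$ are equal. Two spans of spans ${}_SX_T$ and ${}_S\tilde X_T$ are isomorphic as spans of spans if there is an isomorphism $X\to\tilde X$ in $\mathcal{C}$ commuting with the arrows to $S$ and to $T$. Hom-categories: $\mathrm{Span}(A,B)$ has as objects the spans from $A$ to $B$ and as morphisms $S\to T$ the isomorphism classes of spans of spans ${}_SX_T$. (Vertical) composition is by pullback: ${}_TY_U\circ{}_SX_T={}_S(X\times_TY)_U$, with legs $X\times_TY\to X\to S$ and $X\times_TY\to Y\to U$. The identity $\mathrm{Id}_S$ on $S$ is the class of $S\xleftarrow{1_S}S\xrightarrow{1_S}S$. Identity 1-cells: the functor $I_A$ from the terminal category to $\mathrm{Span}(A,A)$ picks out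 the span ${}_AA_A$, namely $A\xleftarrow{1_A}A\xrightarrow{1_A}A$, and its identity morphism. Horizontal composition: $;_{A,B,C}:\mathrm{Span}(A,B)\times\mathrm{Span}(B,C)\to\mathrm{Span}(A,C)$ sends a pair of spans $({}_AS_B,{}_BS'_C)$ to $S;S'={}_A(S\times_BS')_C$ (pullback over $B$, any two pullbacks being regarded as representing the same composite), with legs $S\times_BS'\to S\to A$ and $S\times_BS'\to S'\to C$. It sends a pair of morphisms $({}_SX_T,{}_{S'}X'_{T'})$ to $X;X'=X\times_BX'$, the pullback of $X\to B\leftarrow X'$ (where $X\to B$ is $X\to S\to B=X\to T\to B$ and $X'\to B$ is $X'\to S'\to B=X'\to T'\to B$), regarded as a span of spans from $S\times_BS'$ to $T\times_BT'$ via the arrows induced by the universal properties of $S\times_BS'$ and $T\times_BT'$. Associator: for spans ${}_AS_B,{}_BS'_C,{}_CS''_D$, let $L$ be the limit of $S\to B\leftarrow S'\to C\leftarrow S''$. The component of the associator at $(S,S',S'')$ is the morphism $S\times_B(S'\times_CS'')\to(S\times_BS')\times_CS''$ given by the span of spans $S\times_B(S'\times_CS'')\leftarrow L\to(S\times_BS')\times_CS''$ whose legs are the canonical arrows (those commuting with the projections to $S,S',S''$). Unitors: for a span ${}_AS_B$, the right unitor component $r_S:A\times_AS\to S$ is the span of spans $A\times_AS\leftarrow S\to S$ whose left leg is the canonical isomorphism $S\cong A\times_AS$ and whose right leg is $1_S$. The left unitor component $l_S:S\times_BB\to S$ is the span of spans $S\times_BB\leftarrow S\to S$ whose left leg is the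 canonical isomorphism $S\cong S\times_BB$ and whose right leg is $1_S$. *)

theory Defs
  imports Main
begin

record ('o, 'm) cat =
  Ob :: "'o set"
  Ar :: "'m set"
  Dom :: "'m \<Rightarrow> 'o"
  Cod :: "'m \<Rightarrow> 'o"
  Id :: "'o \<Rightarrow> 'm"
  Comp :: "'m \<Rightarrow> 'm \<Rightarrow> 'm" (infixr "\<cdot>\<index>" 70)

text \<open>\<open>Comp C g f\<close> is ``first f, then g''.  As usual in HOL the operations are total functions,
  and only their values on objects, arrows and composable pairs matter.\<close>

definition Hom :: "('o, 'm) cat \<Rightarrow> 'o \<Rightarrow> 'o \<Rightarrow> 'm set" where
  "Hom C a b = {f \<in> Ar C. Dom C f = a \<and> Cod C f = b}"

locale category =
  fixes C :: "('o, 'm) cat" (structure)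
  assumes Dom_in_Ob: "f \<in> Ar C \<Longrightarrow> Dom C f \<in> Ob C"
    and Cod_in_Ob: "f \<in> Ar C \<Longrightarrow> Cod C f \<in> Ob C"
    and Id_in_Hom: "a \<in> Ob C \<Longrightarrow> Id C a \<in> Hom C a a"
    and Comp_in_Hom: "\<lbrakk>f \<in> Hom C a b; g \<in> Hom C b c\<rbrakk> \<Longrightarrow> g \<cdot> f \<in> Hom C a c"
    and Comp_Id_right: "f \<in> Hom C a b \<Longrightarrow> f \<cdot> Id C a = f"
    and Comp_Id_left: "f \<in> Hom C a b \<Longrightarrow> Id C b \<cdot> f = f"
    and Comp_assoc: "\<lbrakk>f \<in> Hom C a b; g \<in> Hom C b c; h \<in> Hom C c d\<rbrakk> \<Longrightarrow>
      h \<cdot> (g \<cdot> f) = (h \<cdot> g) \<cdot> f"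

definition is_iso :: "('o, 'm) cat \<Rightarrow> 'm \<Rightarrow> bool" where
  "is_iso C f \<longleftrightarrow> f \<in> Ar C \<and>
    (\<exists>g \<in> Hom C (Cod C f) (Dom C f).
      g \<cdot>\<^bsub>C\<^esub> f = Id C (Dom C f) \<and> f \<cdot>\<^bsub>C\<^esub> g = Id C (Cod C f))"

definition has_terminal :: "('o, 'm) cat \<Rightarrow> bool" where
  "has_terminal C \<longleftrightarrow> (\<exists>t \<in> Ob C. \<forall>a \<in> Ob C. \<exists>!f. f \<in> Hom C a t)"

definition one_cat :: "(unit, unit) cat" where
  "one_cat = \<lparr>Ob = UNIV, Ar = UNIV, Dom = (\<lambda>_. ()), Cod = (\<lambda>_. ()),
     Id = (\<lambda>_. ()), Comp = (\<lambda>_ _. ())\<rparr>"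

definition prod_cat :: "('o1, 'm1) cat \<Rightarrow> ('o2, 'm2) cat \<Rightarrow> ('o1 \<times> 'o2, 'm1 \<times> 'm2) cat" where
  "prod_cat C D = \<lparr>Ob = Ob C \<times> Ob D, Ar = Ar C \<times> Ar D,
     Dom = map_prod (Dom C) (Dom D), Cod = map_prod (Cod C) (Cod D),
     Id = map_prod (Id C) (Id D),
     Comp = (\<lambda>(g, g') (f, f'). (g \<cdot>\<^bsub>C\<^esub> f, g' \<cdot>\<^bsub>D\<^esub> f'))\<rparr>"

record ('o1, 'm1, 'o2, 'm2) funct =
  FOb :: "'o1 \<Rightarrow> 'o2"
  FAr :: "'m1 \<Rightarrow> 'm2"

definition id_funct :: "('o, 'm, 'o, 'm) funct" where
  "id_funct = \<lparr>FOb = (\<lambda>a. a), FAr = (\<lambda>f. f)\<rparr>"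

locale is_functor =
  C: category C + D: category D
  for C :: "('o1, 'm1) cat" and D :: "('o2, 'm2) cat" +
  fixes F :: "('o1, 'm1, 'o2, 'm2) funct"
  assumes FOb_in_Ob: "a \<in> Ob C \<Longrightarrow> FOb F a \<in> Ob D"
    and FAr_in_Hom: "f \<in> Hom C a b \<Longrightarrow> FAr F f \<in> Hom D (FOb F a) (FOb F b)"
    and FAr_Id: "a \<in> Ob C \<Longrightarrow> FAr F (Id C a) = Id D (FOb F a)"
    and FAr_Comp: "\<lbrakk>f \<in> Hom C a b; g \<in> Hom C b c\<rbrakk> \<Longrightarrow>
      FAr F (g \<cdot>\<^bsub>C\<^esub> f) = FAr F g \<cdot>\<^bsub>D\<^esub> FAr F f"

locale natural_iso =
  F: is_functor C D F + G: is_functor C D G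
  for C :: "('o1, 'm1) cat" and D :: "('o2, 'm2) cat"
    and F G :: "('o1, 'm1, 'o2, 'm2) funct" +
  fixes \<tau> :: "'o1 \<Rightarrow> 'm2"
  assumes component_in_Hom: "a \<in> Ob C \<Longrightarrow> \<tau> a \<in> Hom D (FOb F a) (FOb G a)"
    and component_iso: "a \<in> Ob C \<Longrightarrow> is_iso D (\<tau> a)"
    and naturality: "f \<in> Hom C a b \<Longrightarrow> \<tau> b \<cdot>\<^bsub>D\<^esub> FAr F f = FAr G f \<cdot>\<^bsub>D\<^esub> \<tau> a"

text \<open>Horizontal composition is written in diagrammatic order, the associator goes from
  \<open>f;(g;h)\<close> to \<open>(f;g);h\<close>, the right unitor from \<open>I;f\<close> to \<open>f\<close> and the left unitor from
  \<open>f;I\<close> to \<open>f\<close>.\<close>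

record ('o, 'a, 'c) bicat =
  Obj :: "'o set"
  HomCat :: "'o \<Rightarrow> 'o \<Rightarrow> ('a, 'c) cat"
  IdF :: "'o \<Rightarrow> (unit, unit, 'a, 'c) funct"
  HComp :: "'o \<Rightarrow> 'o \<Rightarrow> 'o \<Rightarrow> ('a \<times> 'a, 'c \<times> 'c, 'a, 'c) funct"
  Assoc :: "'o \<Rightarrow> 'o \<Rightarrow> 'o \<Rightarrow> 'o \<Rightarrow> 'a \<times> 'a \<times> 'a \<Rightarrow> 'c"
  RUnit :: "'o \<Rightarrow> 'o \<Rightarrow> 'a \<Rightarrow> 'c"
  LUnit :: "'o \<Rightarrow> 'o \<Rightarrow> 'a \<Rightarrow> 'c"

definition comp_right_nested ::
  "('o, 'a, 'c) bicat \<Rightarrow> 'o \<Rightarrow> 'o \<Rightarrow> 'o \<Rightarrow> 'o \<Rightarrow>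
   ('a \<times> 'a \<times> 'a, 'c \<times> 'c \<times> 'c, 'a, 'c) funct" where
  "comp_right_nested \<B> A B C D =
    \<lparr>FOb = (\<lambda>(f, g, h). FOb (HComp \<B> A B D) (f, FOb (HComp \<B> B C D) (g, h))),
     FAr = (\<lambda>(\<phi>, \<gamma>, \<eta>). FAr (HComp \<B> A B D) (\<phi>, FAr (HComp \<B> B C D) (\<gamma>, \<eta>)))\<rparr>"

definition comp_left_nested ::
  "('o, 'a, 'c) bicat \<Rightarrow> 'o \<Rightarrow> 'o \<Rightarrow> 'o \<Rightarrow> 'o \<Rightarrow>
   ('a \<times> 'a \<times> 'a, 'c \<times> 'c \<times> 'c, 'a, 'c) funct" where
  "comp_left_nested \<B> A B C D =
    \<lparr>FOb = (\<lambda>(f, g, h). FOb (HComp \<B> A C D) (FOb (HComp \<B> A B C) (f, g), h)),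
     FAr = (\<lambda>(\<phi>, \<gamma>, \<eta>). FAr (HComp \<B> A C D) (FAr (HComp \<B> A B C) (\<phi>, \<gamma>), \<eta>))\<rparr>"

definition unit_before :: "('o, 'a, 'c) bicat \<Rightarrow> 'o \<Rightarrow> 'o \<Rightarrow> ('a, 'c, 'a, 'c) funct" where
  "unit_before \<B> A B =
    \<lparr>FOb = (\<lambda>f. FOb (HComp \<B> A A B) (FOb (IdF \<B> A) (), f)),
     FAr = (\<lambda>\<phi>. FAr (HComp \<B> A A B) (FAr (IdF \<B> A) (), \<phi>))\<rparr>"

definition unit_after :: "('o, 'a, 'c) bicat \<Rightarrow> 'o \<Rightarrow> 'o \<Rightarrow> ('a, 'c, 'a, 'c) funct" where
  "unit_after \<B> A B =
    \<lparr>FOb = (\<lambda>f. FOb (HComp \<B> A B B) (f, FOb (IdF \<B> B) ())),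
     FAr = (\<lambda>\<phi>. FAr (HComp \<B> A B B) (\<phi>, FAr (IdF \<B> B) ()))\<rparr>"

locale bicategory =
  fixes \<B> :: "('o, 'a, 'c) bicat"
  assumes HomCat_category:
      "\<lbrakk>A \<in> Obj \<B>; B \<in> Obj \<B>\<rbrakk> \<Longrightarrow> category (HomCat \<B> A B)"
    and IdF_functor:
      "A \<in> Obj \<B> \<Longrightarrow> is_functor one_cat (HomCat \<B> A A) (IdF \<B> A)"
    and HComp_functor:
      "\<lbrakk>A \<in> Obj \<B>; B \<in> Obj \<B>; C \<in> Obj \<B>\<rbrakk> \<Longrightarrow>
        is_functor (prod_cat (HomCat \<B> A B) (HomCat \<B> B C)) (HomCat \<B> A C) (HComp \<B> A B C)"
    and Assoc_natural_iso:
      "\<lbrakk>A \<in> Obj \<B>; B \<in> Obj \<B>; C \<in> Obj \<B>; D \<in> Obj \<B>\<rbrakk> \<Longrightarrow>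
        natural_iso (prod_cat (HomCat \<B> A B) (prod_cat (HomCat \<B> B C) (HomCat \<B> C D)))
          (HomCat \<B> A D) (comp_right_nested \<B> A B C D) (comp_left_nested \<B> A B C D)
          (Assoc \<B> A B C D)"
    and RUnit_natural_iso:
      "\<lbrakk>A \<in> Obj \<B>; B \<in> Obj \<B>\<rbrakk> \<Longrightarrow>
        natural_iso (HomCat \<B> A B) (HomCat \<B> A B) (unit_before \<B> A B) id_funct (RUnit \<B> A B)"
    and LUnit_natural_iso:
      "\<lbrakk>A \<in> Obj \<B>; B \<in> Obj \<B>\<rbrakk> \<Longrightarrow>
        natural_iso (HomCat \<B> A B) (HomCat \<B> A B) (unit_after \<B> A B) id_funct (LUnit \<B> A B)"
    and pentagon:
      "\<lbrakk>A \<in> Obj \<B>; B \<in> Obj \<B>; C \<in> Obj \<B>; D \<in> Obj \<B>; E \<in> Obj \<B>;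
        f \<in> Ob (HomCat \<B> A B); g \<in> Ob (HomCat \<B> B C);
        h \<in> Ob (HomCat \<B> C D); k \<in> Ob (HomCat \<B> D E)\<rbrakk> \<Longrightarrow>
        Assoc \<B> A C D E (FOb (HComp \<B> A B C) (f, g), h, k)
          \<cdot>\<^bsub>HomCat \<B> A E\<^esub> Assoc \<B> A B C E (f, g, FOb (HComp \<B> C D E) (h, k))
        = FAr (HComp \<B> A D E) (Assoc \<B> A B C D (f, g, h), Id (HomCat \<B> D E) k)
          \<cdot>\<^bsub>HomCat \<B> A E\<^esub> Assoc \<B> A B D E (f, FOb (HComp \<B> B C D) (g, h), k)
          \<cdot>\<^bsub>HomCat \<B> A E\<^esub> FAr (HComp \<B> A B E) (Id (HomCat \<B> A B) f, Assoc \<B> B C D E (g, h, k))"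
    and triangle:
      "\<lbrakk>A \<in> Obj \<B>; B \<in> Obj \<B>; C \<in> Obj \<B>;
        f \<in> Ob (HomCat \<B> A B); g \<in> Ob (HomCat \<B> B C)\<rbrakk> \<Longrightarrow>
        FAr (HComp \<B> A B C) (LUnit \<B> A B f, Id (HomCat \<B> B C) g)
          \<cdot>\<^bsub>HomCat \<B> A C\<^esub> Assoc \<B> A B B C (f, FOb (IdF \<B> B) (), g)
        = FAr (HComp \<B> A B C) (Id (HomCat \<B> A B) f, RUnit \<B> B C g)"

text \<open>A span is given by its two legs; its apex is their common domain.\<close>

record 'm span =
  lleg :: 'm
  rleg :: 'm

definition apex :: "('o, 'm) cat \<Rightarrow> 'm span \<Rightarrow> 'o" where
  "apex C S = Dom C (lleg S)"

definition is_span :: "('o, 'm) cat \<Rightarrow> 'o \<Rightarrow> 'o \<Rightarrow> 'm span \<Rightarrow> bool" where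
  "is_span C A B S \<longleftrightarrow> lleg S \<in> Hom C (apex C S) A \<and> rleg S \<in> Hom C (apex C S) B"

definition is_pullback :: "('o, 'm) cat \<Rightarrow> 'm \<Rightarrow> 'm \<Rightarrow> 'm span \<Rightarrow> bool" where
  "is_pullback C f g P \<longleftrightarrow>
    f \<in> Ar C \<and> g \<in> Ar C \<and> Cod C f = Cod C g \<and>
    is_span C (Dom C f) (Dom C g) P \<and> f \<cdot>\<^bsub>C\<^esub> lleg P = g \<cdot>\<^bsub>C\<^esub> rleg P \<and>
    (\<forall>Q. is_span C (Dom C f) (Dom C g) Q \<and> f \<cdot>\<^bsub>C\<^esub> lleg Q = g \<cdot>\<^bsub>C\<^esub> rleg Q \<longrightarrow>
      (\<exists>!u. u \<in> Hom C (apex C Q) (apex C P) \<and>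
        lleg P \<cdot>\<^bsub>C\<^esub> u = lleg Q \<and> rleg P \<cdot>\<^bsub>C\<^esub> u = rleg Q))"

definition has_pullbacks :: "('o, 'm) cat \<Rightarrow> bool" where
  "has_pullbacks C \<longleftrightarrow>
    (\<forall>f \<in> Ar C. \<forall>g \<in> Ar C. Cod C f = Cod C g \<longrightarrow> (\<exists>P. is_pullback C f g P))"

text \<open>To make the composite of two spans an actual span, one pullback is selected for every
  cospan; nothing is assumed about the selection.\<close>

definition pullback_choice :: "('o, 'm) cat \<Rightarrow> ('m \<Rightarrow> 'm \<Rightarrow> 'm span) \<Rightarrow> bool" where
  "pullback_choice C pb \<longleftrightarrow>
    (\<forall>f \<in> Ar C. \<forall>g \<in> Ar C. Cod C f = Cod C g \<longrightarrow> is_pullback C f g (pb f g))"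

lemma pullback_choice_exists:
  assumes "has_pullbacks C"
  shows "\<exists>pb. pullback_choice C pb"
proof
  show "pullback_choice C (\<lambda>f g. SOME P. is_pullback C f g P)"
    using assms unfolding has_pullbacks_def pullback_choice_def by (meson someI_ex)
qed

text \<open>The arrow into the pullback \<open>P\<close> with components \<open>h\<close> and \<open>k\<close>.\<close>

definition induced :: "('o, 'm) cat \<Rightarrow> 'm span \<Rightarrow> 'm \<Rightarrow> 'm \<Rightarrow> 'm" where
  "induced C P h k = (THE u. u \<in> Hom C (Dom C h) (apex C P) \<and>
     lleg P \<cdot>\<^bsub>C\<^esub> u = h \<and> rleg P \<cdot>\<^bsub>C\<^esub> u = k)"

text \<open>\<open>(p, p', p'')\<close> is a limit cone over the zigzag with arrows \<open>f\<close>, \<open>g\<close>, \<open>f'\<close>, \<open>g'\<close>,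
  where \<open>f, g\<close> and \<open>f', g'\<close> have common codomains and \<open>g, f'\<close> have a common domain.\<close>

definition is_zigzag_cone ::
  "('o, 'm) cat \<Rightarrow> 'm \<Rightarrow> 'm \<Rightarrow> 'm \<Rightarrow> 'm \<Rightarrow> 'm \<times> 'm \<times> 'm \<Rightarrow> bool" where
  "is_zigzag_cone C f g f' g' = (\<lambda>(p, p', p'').
    p \<in> Hom C (Dom C p) (Dom C f) \<and> p' \<in> Hom C (Dom C p) (Dom C g) \<and>
    p'' \<in> Hom C (Dom C p) (Dom C g') \<and>
    f \<cdot>\<^bsub>C\<^esub> p = g \<cdot>\<^bsub>C\<^esub> p' \<and> f' \<cdot>\<^bsub>C\<^esub> p' = g' \<cdot>\<^bsub>C\<^esub> p'')"

definition is_zigzag_limit ::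
  "('o, 'm) cat \<Rightarrow> 'm \<Rightarrow> 'm \<Rightarrow> 'm \<Rightarrow> 'm \<Rightarrow> 'm \<times> 'm \<times> 'm \<Rightarrow> bool" where
  "is_zigzag_limit C f g f' g' = (\<lambda>(p, p', p'').
    is_zigzag_cone C f g f' g' (p, p', p'') \<and>
    (\<forall>q q' q''. is_zigzag_cone C f g f' g' (q, q', q'') \<longrightarrow>
      (\<exists>!u. u \<in> Hom C (Dom C q) (Dom C p) \<and>
        p \<cdot>\<^bsub>C\<^esub> u = q \<and> p' \<cdot>\<^bsub>C\<^esub> u = q' \<and> p'' \<cdot>\<^bsub>C\<^esub> u = q'')))"

text \<open>A span of spans is itself a span between the apexes.\<close>

definition span_of_spans :: "('o, 'm) cat \<Rightarrow> 'm span \<Rightarrow> 'm span \<Rightarrow> 'm span \<Rightarrow> bool" where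
  "span_of_spans C S T X \<longleftrightarrow> is_span C (apex C S) (apex C T) X \<and>
    lleg S \<cdot>\<^bsub>C\<^esub> lleg X = lleg T \<cdot>\<^bsub>C\<^esub> rleg X \<and>
    rleg S \<cdot>\<^bsub>C\<^esub> lleg X = rleg T \<cdot>\<^bsub>C\<^esub> rleg X"

definition span_iso :: "('o, 'm) cat \<Rightarrow> 'm span \<Rightarrow> 'm span \<Rightarrow> bool" where
  "span_iso C X Y \<longleftrightarrow> (\<exists>u \<in> Hom C (apex C X) (apex C Y). is_iso C u \<and>
     lleg Y \<cdot>\<^bsub>C\<^esub> u = lleg X \<and> rleg Y \<cdot>\<^bsub>C\<^esub> u = rleg X)"

definition sos_class :: "('o, 'm) cat \<Rightarrow> 'm span \<Rightarrow> 'm span \<Rightarrow> 'm span \<Rightarrow> 'm span set" where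
  "sos_class C S T X = {Y. span_of_spans C S T Y \<and> span_iso C X Y}"

text \<open>A 2-cell is an isomorphism class together with its source and target spans.\<close>

record 'm cell =
  src :: "'m span"
  tgt :: "'m span"
  cls :: "'m span set"

definition cell_of :: "('o, 'm) cat \<Rightarrow> 'm span \<Rightarrow> 'm span \<Rightarrow> 'm span \<Rightarrow> 'm cell" where
  "cell_of C S T X = \<lparr>src = S, tgt = T, cls = sos_class C S T X\<rparr>"

text \<open>Composites of classes collect the composites of all representatives, formed with all
  possible pullbacks; on classes of composable spans of spans this is again a single
  isomorphism class.\<close>

definition vcomp :: "('o, 'm) cat \<Rightarrow> 'm cell \<Rightarrow> 'm cell \<Rightarrow> 'm cell" where
  "vcomp C \<eta> \<xi> = \<lparr>src = src \<xi>, tgt = tgt \<eta>,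
     cls = {\<lparr>lleg = lleg X \<cdot>\<^bsub>C\<^esub> lleg P, rleg = rleg Y \<cdot>\<^bsub>C\<^esub> rleg P\<rparr> | X Y P.
       X \<in> cls \<xi> \<and> Y \<in> cls \<eta> \<and> is_pullback C (rleg X) (lleg Y) P}\<rparr>"

definition id_span :: "('o, 'm) cat \<Rightarrow> 'o \<Rightarrow> 'm span" where
  "id_span C A = \<lparr>lleg = Id C A, rleg = Id C A\<rparr>"

definition id_cell :: "('o, 'm) cat \<Rightarrow> 'm span \<Rightarrow> 'm cell" where
  "id_cell C S = cell_of C S S (id_span C (apex C S))"

definition Span :: "('o, 'm) cat \<Rightarrow> 'o \<Rightarrow> 'o \<Rightarrow> ('m span, 'm cell) cat" where
  "Span C A B = \<lparr>Ob = {S. is_span C A B S},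
     Ar = {cell_of C S T X | S T X. is_span C A B S \<and> is_span C A B T \<and> span_of_spans C S T X},
     Dom = src, Cod = tgt, Id = id_cell C, Comp = vcomp C\<rparr>"

definition span_comp ::
  "('o, 'm) cat \<Rightarrow> ('m \<Rightarrow> 'm \<Rightarrow> 'm span) \<Rightarrow> 'm span \<Rightarrow> 'm span \<Rightarrow> 'm span" where
  "span_comp C pb S S' = (let P = pb (rleg S) (lleg S') in
     \<lparr>lleg = lleg S \<cdot>\<^bsub>C\<^esub> lleg P, rleg = rleg S' \<cdot>\<^bsub>C\<^esub> rleg P\<rparr>)"

text \<open>The canonical arrow into the apex of \<open>span_comp C pb S S'\<close>.\<close>

definition into_comp ::
  "('o, 'm) cat \<Rightarrow> ('m \<Rightarrow> 'm \<Rightarrow> 'm span) \<Rightarrow> 'm span \<Rightarrow> 'm span \<Rightarrow> 'm \<Rightarrow> 'm \<Rightarrow> 'm" where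
  "into_comp C pb S S' h k = induced C (pb (rleg S) (lleg S')) h k"

definition hcomp ::
  "('o, 'm) cat \<Rightarrow> ('m \<Rightarrow> 'm \<Rightarrow> 'm span) \<Rightarrow> 'm cell \<Rightarrow> 'm cell \<Rightarrow> 'm cell" where
  "hcomp C pb \<xi> \<xi>' =
    \<lparr>src = span_comp C pb (src \<xi>) (src \<xi>'), tgt = span_comp C pb (tgt \<xi>) (tgt \<xi>'),
     cls = {\<lparr>lleg = into_comp C pb (src \<xi>) (src \<xi>') (lleg X \<cdot>\<^bsub>C\<^esub> lleg P) (lleg X' \<cdot>\<^bsub>C\<^esub> rleg P),
             rleg = into_comp C pb (tgt \<xi>) (tgt \<xi>') (rleg X \<cdot>\<^bsub>C\<^esub> lleg P) (rleg X' \<cdot>\<^bsub>C\<^esub> rleg P)\<rparr> | X X' P.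
       X \<in> cls \<xi> \<and> X' \<in> cls \<xi>' \<and>
       is_pullback C (rleg (src \<xi>) \<cdot>\<^bsub>C\<^esub> lleg X) (lleg (src \<xi>') \<cdot>\<^bsub>C\<^esub> lleg X') P}\<rparr>"

text \<open>The legs out of the limit apex are the arrows compatible with the projections
  \<open>p, p', p''\<close> to the apexes of \<open>S, S', S''\<close>.\<close>

definition span_assoc ::
  "('o, 'm) cat \<Rightarrow> ('m \<Rightarrow> 'm \<Rightarrow> 'm span) \<Rightarrow> 'm span \<Rightarrow> 'm span \<Rightarrow> 'm span \<Rightarrow> 'm cell" where
  "span_assoc C pb S S' S'' =
    \<lparr>src = span_comp C pb S (span_comp C pb S' S''),
     tgt = span_comp C pb (span_comp C pb S S') S'',
     cls = {\<lparr>lleg = into_comp C pb S (span_comp C pb S' S'') p (into_comp C pb S' S'' p' p''),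
             rleg = into_comp C pb (span_comp C pb S S') S'' (into_comp C pb S S' p p') p''\<rparr> | p p' p''.
       is_zigzag_limit C (rleg S) (lleg S') (rleg S') (lleg S'') (p, p', p'')}\<rparr>"

definition span_runit ::
  "('o, 'm) cat \<Rightarrow> ('m \<Rightarrow> 'm \<Rightarrow> 'm span) \<Rightarrow> 'o \<Rightarrow> 'm span \<Rightarrow> 'm cell" where
  "span_runit C pb A S = cell_of C (span_comp C pb (id_span C A) S) S
     \<lparr>lleg = into_comp C pb (id_span C A) S (lleg S) (Id C (apex C S)), rleg = Id C (apex C S)\<rparr>"

definition span_lunit ::
  "('o, 'm) cat \<Rightarrow> ('m \<Rightarrow> 'm \<Rightarrow> 'm span) \<Rightarrow> 'o \<Rightarrow> 'm span \<Rightarrow> 'm cell" where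
  "span_lunit C pb B S = cell_of C (span_comp C pb S (id_span C B)) S
     \<lparr>lleg = into_comp C pb S (id_span C B) (Id C (apex C S)) (rleg S), rleg = Id C (apex C S)\<rparr>"

definition Span2 ::
  "('o, 'm) cat \<Rightarrow> ('m \<Rightarrow> 'm \<Rightarrow> 'm span) \<Rightarrow> ('o, 'm span, 'm cell) bicat" where
  "Span2 C pb =
    \<lparr>Obj = Ob C,
     HomCat = Span C,
     IdF = (\<lambda>A. \<lparr>FOb = (\<lambda>_. id_span C A), FAr = (\<lambda>_. id_cell C (id_span C A))\<rparr>),
     HComp = (\<lambda>_ _ _. \<lparr>FOb = (\<lambda>(S, S'). span_comp C pb S S'),
                       FAr = (\<lambda>(\<xi>, \<xi>'). hcomp C pb \<xi> \<xi>')\<rparr>),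
     Assoc = (\<lambda>_ _ _ _ (S, S', S''). span_assoc C pb S S' S''),
     RUnit = (\<lambda>A _. span_runit C pb A),
     LUnit = (\<lambda>_ B. span_lunit C pb B)\<rparr>"

end

theory Submission
  imports Defs
begin

text \<open>Call an arrow of apexes that commutes with the legs a map of spans.  A span of spans
  \<open>S \<leftarrow> X \<rightarrow> T\<close> is the same as a pair of maps of spans out of a common span \<open>M\<close>, where \<open>M\<close> is \<open>X\<close> with
  the composite legs.  So a 2-cell is an isomorphism class of spans in the ordinary category of
  spans and maps.  In this description horizontal composition acts on maps
  functorially and preserves pullbacks, which is the interchange law, while the associator and the
  unitors are graphs of invertible maps.  Composition with graphs and horizontal composition of
  graphs are those of the underlying maps, so the coherence laws become equations between
  arrows into iterated pullbacks, and these are checked on projections.\<close>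

section \<open>Pullbacks and isomorphisms of spans\<close>

text \<open>The obstacle is that a composite cell is defined as a set, collecting what arises from
  all representatives and all pullbacks. Before a law can be checked on representatives, this set
  must be shown to be a single isomorphism class which any one choice computes
  (\<open>vcomp_cell\<close>, \<open>hcomp_cell\<close>). Members of a class are precomposites of
  one representative with isomorphisms, so pullbacks have to be transported along isomorphisms.
  Leaving the pullback in \<open>vcomp_cell\<close> arbitrary pays off later: both bracketings of a
  vertical composite use pastings of the same squares, and interchange uses a horizontal composite
  of two pullback squares, because limits commute with limits. The selection \<open>pb\<close> is
  arbitrary, so differently bracketed composites of spans are related only by comparison arrows, and
  these are controlled by joint monicity of projections. The associator ranges over all limits of a
  zigzag; to recognize it as a graph one needs that such limits are isomorphic to the iterated
  pullback and that anything isomorphic to the latter is a limit.\<close>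

context category
begin

lemma in_Hom: "f \<in> Hom C a b \<longleftrightarrow> f \<in> Ar C \<and> Dom C f = a \<and> Cod C f = b"
  by (simp add: Hom_def)

lemma comp_simps [simp]:
  assumes "f \<in> Ar C" "g \<in> Ar C" "Cod C f = Dom C g"
  shows "g \<cdot> f \<in> Ar C" "Dom C (g \<cdot> f) = Dom C f" "Cod C (g \<cdot> f) = Cod C g"
  using Comp_in_Hom[of f "Dom C f" "Cod C f" g "Cod C g"] assms by (auto simp: in_Hom)

lemma comp_assoc [simp]:
  assumes "f \<in> Ar C" "g \<in> Ar C" "h \<in> Ar C" "Cod C f = Dom C g" "Cod C g = Dom C h"
  shows "(h \<cdot> g) \<cdot> f = h \<cdot> (g \<cdot> f)"
  using Comp_assoc[of f "Dom C f" "Cod C f" g "Cod C g" h "Cod C h"] assms by (auto simp: in_Hom)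

lemma Id_simps [simp]:
  assumes "a \<in> Ob C"
  shows "Id C a \<in> Ar C" "Dom C (Id C a) = a" "Cod C (Id C a) = a"
  using Id_in_Hom[OF assms] by (auto simp: in_Hom)

lemma Id_comp [simp]: "f \<in> Ar C \<Longrightarrow> Cod C f = b \<Longrightarrow> Id C b \<cdot> f = f"
  using Comp_Id_left[of f "Dom C f" b] by (auto simp: in_Hom)

lemma comp_Id [simp]: "f \<in> Ar C \<Longrightarrow> Dom C f = a \<Longrightarrow> f \<cdot> Id C a = f"
  using Comp_Id_right[of f a "Cod C f"] by (auto simp: in_Hom)

declare Dom_in_Ob [simp] Cod_in_Ob [simp]

text \<open>Composites are normalized by \<open>comp_assoc\<close> to nest to the right, so an
  equation for \<open>g \<cdot> f\<close> no longer matches inside a longer chain. Appending an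
  arbitrary \<open>x\<close> restores it; the later \<open>_reassoc\<close> lemmas arise in this
  way.\<close>

lemma comp_reassoc:
  assumes "g \<cdot> f = k" "x \<in> Ar C" "f \<in> Ar C" "g \<in> Ar C" "Cod C x = Dom C f" "Cod C f = Dom C g"
  shows "g \<cdot> (f \<cdot> x) = k \<cdot> x"
  using assms comp_assoc[of x f g] by simp

section \<open>Invertible arrows\<close>

lemma is_isoI:
  assumes "f \<in> Ar C" "g \<in> Ar C" "Dom C g = Cod C f" "Cod C g = Dom C f"
    "g \<cdot> f = Id C (Dom C f)" "f \<cdot> g = Id C (Cod C f)"
  shows "is_iso C f"
  using assms by (auto simp: is_iso_def in_Hom)

lemma is_isoE:
  assumes "is_iso C f"
  obtains g where "f \<in> Ar C" "g \<in> Ar C" "Dom C g = Cod C f" "Cod C g = Dom C f"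
    "g \<cdot> f = Id C (Dom C f)" "f \<cdot> g = Id C (Cod C f)" "is_iso C g"
proof -
  obtain g where "f \<in> Ar C" "g \<in> Ar C" "Dom C g = Cod C f" "Cod C g = Dom C f"
    "g \<cdot> f = Id C (Dom C f)" "f \<cdot> g = Id C (Cod C f)"
    using assms by (auto simp: is_iso_def in_Hom)
  then show thesis
    using that is_isoI[of g f] by simp
qed

lemma is_iso_comp:
  assumes "is_iso C f" "is_iso C g" "Cod C f = Dom C g"
  shows "is_iso C (g \<cdot> f)"
proof -
  obtain f' where f: "f \<in> Ar C" "f' \<in> Ar C" "Dom C f' = Cod C f" "Cod C f' = Dom C f"
    "f' \<cdot> f = Id C (Dom C f)" "f \<cdot> f' = Id C (Cod C f)"
    using assms(1) by (rule is_isoE)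
  obtain g' where g: "g \<in> Ar C" "g' \<in> Ar C" "Dom C g' = Cod C g" "Cod C g' = Dom C g"
    "g' \<cdot> g = Id C (Dom C g)" "g \<cdot> g' = Id C (Cod C g)"
    using assms(2) by (rule is_isoE)
  show ?thesis
    using f g assms(3) comp_reassoc[OF f(6), of g'] comp_reassoc[OF g(5), of f]
    by (intro is_isoI[of _ "f' \<cdot> g'"]) auto
qed

lemma iso_cancel_left:
  assumes "is_iso C f" "f \<cdot> x = f \<cdot> y" "x \<in> Ar C" "y \<in> Ar C" "Cod C x = Dom C f" "Cod C y = Dom C f"
  shows "x = y"
proof -
  obtain f' where f: "f \<in> Ar C" "f' \<in> Ar C" "Dom C f' = Cod C f" "Cod C f' = Dom C f"
    "f' \<cdot> f = Id C (Dom C f)" "f \<cdot> f' = Id C (Cod C f)"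
    using assms(1) by (rule is_isoE)
  have "x = f' \<cdot> (f \<cdot> x)"
    using comp_reassoc[OF f(5), of x] f assms(3,5) by simp
  also have "\<dots> = f' \<cdot> (f \<cdot> y)"
    by (simp only: assms(2))
  also have "\<dots> = y"
    using comp_reassoc[OF f(5), of y] f assms(4,6) by simp
  finally show ?thesis .
qed

lemma Id_iso: "a \<in> Ob C \<Longrightarrow> is_iso C (Id C a)"
  by (rule is_isoI[of _ "Id C a"]) auto

text \<open>This is \<open>is_span\<close> with the two feet forgotten. They are recovered as
  codomains of the legs, so simplification rules need not guess the objects \<open>A\<close> and
  \<open>B\<close>.\<close>

definition wf_span :: "'m span \<Rightarrow> bool" where
  "wf_span S \<longleftrightarrow> lleg S \<in> Ar C \<and> rleg S \<in> Ar C \<and> Dom C (rleg S) = apex C S"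

lemma Dom_lleg [simp]: "Dom C (lleg S) = apex C S"
  by (simp add: apex_def)

lemma wf_span_mk [simp]:
  "wf_span \<lparr>lleg = l, rleg = r\<rparr> \<longleftrightarrow> l \<in> Ar C \<and> r \<in> Ar C \<and> Dom C r = Dom C l"
  by (simp add: wf_span_def apex_def)

lemma is_span_iff: "is_span C A B S \<longleftrightarrow> wf_span S \<and> Cod C (lleg S) = A \<and> Cod C (rleg S) = B"
  by (auto simp: is_span_def wf_span_def in_Hom)

lemma wf_spanD [simp]:
  assumes "wf_span S"
  shows "lleg S \<in> Ar C" "rleg S \<in> Ar C" "Dom C (rleg S) = apex C S"
  using assms by (auto simp: wf_span_def)

lemma apex_in_Ob [simp]: "wf_span S \<Longrightarrow> apex C S \<in> Ob C"
  using Dom_in_Ob[of "lleg S"] by simp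

lemma apex_mk [simp]: "apex C \<lparr>lleg = l, rleg = r\<rparr> = Dom C l"
  by (simp add: apex_def)

section \<open>The universal property of pullbacks\<close>

lemma pullbackD:
  assumes "is_pullback C f g P"
  shows "f \<in> Ar C" "g \<in> Ar C" "Cod C f = Cod C g" "wf_span P"
    "Cod C (lleg P) = Dom C f" "Cod C (rleg P) = Dom C g" "f \<cdot> lleg P = g \<cdot> rleg P"
  using assms by (auto simp: is_pullback_def is_span_iff)

lemma pullback_lift:
  assumes "is_pullback C f g P" "h \<in> Ar C" "k \<in> Ar C" "Dom C h = Dom C k"
    "Cod C h = Dom C f" "Cod C k = Dom C g" "f \<cdot> h = g \<cdot> k"
  obtains u where "u \<in> Ar C" "Dom C u = Dom C h" "Cod C u = apex C P"
    "lleg P \<cdot> u = h" "rleg P \<cdot> u = k"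
proof -
  let ?Q = "\<lparr>lleg = h, rleg = k\<rparr>"
  have "is_span C (Dom C f) (Dom C g) ?Q" "f \<cdot> lleg ?Q = g \<cdot> rleg ?Q"
    using assms by (auto simp: is_span_iff)
  then have "\<exists>!u. u \<in> Hom C (apex C ?Q) (apex C P) \<and> lleg P \<cdot> u = lleg ?Q \<and> rleg P \<cdot> u = rleg ?Q"
    using assms(1) unfolding is_pullback_def by blast
  then show thesis
    using that unfolding in_Hom apex_mk span.select_convs by blast
qed

text \<open>Uniqueness in its most usable form: the projections are jointly monic. The universal
  property is applied to the cone induced by \<open>u\<close>, for which both \<open>u\<close> and
  \<open>v\<close> are mediating arrows.\<close>

lemma pullback_eqI:
  assumes "is_pullback C f g P" "u \<in> Ar C" "v \<in> Ar C" "Dom C u = Dom C v"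
    "Cod C u = apex C P" "Cod C v = apex C P"
    "lleg P \<cdot> u = lleg P \<cdot> v" "rleg P \<cdot> u = rleg P \<cdot> v"
  shows "u = v"
proof -
  note P [simp] = pullbackD[OF assms(1)]
  let ?Q = "\<lparr>lleg = lleg P \<cdot> u, rleg = rleg P \<cdot> u\<rparr>"
  have "is_span C (Dom C f) (Dom C g) ?Q"
    using assms by (auto simp: is_span_iff)
  moreover have "f \<cdot> lleg ?Q = g \<cdot> rleg ?Q"
    using assms comp_reassoc[OF P(7), of u] by simp
  ultimately have "\<exists>!w. w \<in> Hom C (apex C ?Q) (apex C P) \<and>
      lleg P \<cdot> w = lleg ?Q \<and> rleg P \<cdot> w = rleg ?Q"
    using assms(1) unfolding is_pullback_def by blast
  then show ?thesis
    using assms by (auto simp: in_Hom)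
qed

text \<open>Splits unique existence into a lift and joint monicity, which are usually proved by
  different arguments.\<close>

lemma pullbackI:
  assumes "f \<in> Ar C" "g \<in> Ar C" "Cod C f = Cod C g" "wf_span P"
    "Cod C (lleg P) = Dom C f" "Cod C (rleg P) = Dom C g" "f \<cdot> lleg P = g \<cdot> rleg P"
    and lift: "\<And>h k. \<lbrakk>h \<in> Ar C; k \<in> Ar C; Dom C h = Dom C k; Cod C h = Dom C f; Cod C k = Dom C g;
      f \<cdot> h = g \<cdot> k\<rbrakk> \<Longrightarrow> \<exists>u. u \<in> Ar C \<and> Dom C u = Dom C h \<and> Cod C u = apex C P \<and>
      lleg P \<cdot> u = h \<and> rleg P \<cdot> u = k"
    and eq: "\<And>u v. \<lbrakk>u \<in> Ar C; v \<in> Ar C; Dom C u = Dom C v; Cod C u = apex C P; Cod C v = apex C P;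
      lleg P \<cdot> u = lleg P \<cdot> v; rleg P \<cdot> u = rleg P \<cdot> v\<rbrakk> \<Longrightarrow> u = v"
  shows "is_pullback C f g P"
  unfolding is_pullback_def
proof (intro conjI allI impI)
  fix Q assume Q: "is_span C (Dom C f) (Dom C g) Q \<and> f \<cdot> lleg Q = g \<cdot> rleg Q"
  then obtain u where "u \<in> Ar C \<and> Dom C u = apex C Q \<and> Cod C u = apex C P \<and>
      lleg P \<cdot> u = lleg Q \<and> rleg P \<cdot> u = rleg Q"
    using lift[of "lleg Q" "rleg Q"] by (auto simp: is_span_iff)
  then show "\<exists>!u. u \<in> Hom C (apex C Q) (apex C P) \<and> lleg P \<cdot> u = lleg Q \<and> rleg P \<cdot> u = rleg Q"
    using eq by (intro ex1I[of _ u]) (auto simp: in_Hom)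
qed (use assms in \<open>auto simp: is_span_iff\<close>)

text \<open>Uniqueness of the mediating arrow makes the definite description in
  \<open>induced\<close> denote it; afterwards \<open>induced\<close> is handled only through these
  equations.\<close>

lemma induced_simps:
  assumes "is_pullback C f g P" "h \<in> Ar C" "k \<in> Ar C" "Dom C h = Dom C k"
    "Cod C h = Dom C f" "Cod C k = Dom C g" "f \<cdot> h = g \<cdot> k"
  shows "induced C P h k \<in> Ar C" "Dom C (induced C P h k) = Dom C h"
    "Cod C (induced C P h k) = apex C P"
    "lleg P \<cdot> induced C P h k = h" "rleg P \<cdot> induced C P h k = k"
proof -
  obtain u where u: "u \<in> Ar C" "Dom C u = Dom C h" "Cod C u = apex C P"
    "lleg P \<cdot> u = h" "rleg P \<cdot> u = k"
    using pullback_lift[OF assms] .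
  have "induced C P h k = u"
    unfolding induced_def
    by (rule the_equality) (use u pullback_eqI[OF assms(1)] in \<open>auto simp: in_Hom\<close>)
  with u show "induced C P h k \<in> Ar C" "Dom C (induced C P h k) = Dom C h"
    "Cod C (induced C P h k) = apex C P"
    "lleg P \<cdot> induced C P h k = h" "rleg P \<cdot> induced C P h k = k"
    by simp_all
qed

section \<open>Symmetry, pasting and invariance under isomorphism\<close>

lemma pullback_sym:
  assumes "is_pullback C f g P"
  shows "is_pullback C g f \<lparr>lleg = rleg P, rleg = lleg P\<rparr>"
proof -
  note P [simp] = pullbackD[OF assms]
  show ?thesis
  proof (rule pullbackI)
    fix h k assume "h \<in> Ar C" "k \<in> Ar C" "Dom C h = Dom C k" "Cod C h = Dom C g"
      "Cod C k = Dom C f" "g \<cdot> h = f \<cdot> k"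
    then show "\<exists>u. u \<in> Ar C \<and> Dom C u = Dom C h \<and> Cod C u = apex C \<lparr>lleg = rleg P, rleg = lleg P\<rparr> \<and>
      lleg \<lparr>lleg = rleg P, rleg = lleg P\<rparr> \<cdot> u = h \<and> rleg \<lparr>lleg = rleg P, rleg = lleg P\<rparr> \<cdot> u = k"
      using pullback_lift[OF assms, of k h] by (metis P(4) apex_mk span.select_convs wf_spanD(3))
  qed (use pullback_eqI[OF assms] in auto)
qed

lemma pullback_paste:
  assumes P: "is_pullback C f g P" and Q: "is_pullback C h (lleg P) Q"
  shows "is_pullback C (f \<cdot> h) g \<lparr>lleg = lleg Q, rleg = rleg P \<cdot> rleg Q\<rparr>"
proof -
  note p [simp] = pullbackD[OF P] and q [simp] = pullbackD[OF Q]
  note eqs = comp_reassoc[OF p(7)] comp_reassoc[OF q(7)]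
  show ?thesis
  proof (rule pullbackI)
    fix a b assume ab: "a \<in> Ar C" "b \<in> Ar C" "Dom C a = Dom C b" "Cod C a = Dom C (f \<cdot> h)"
      "Cod C b = Dom C g" "(f \<cdot> h) \<cdot> a = g \<cdot> b"
    from ab obtain u where u: "u \<in> Ar C" "Dom C u = Dom C a" "Cod C u = apex C P"
      "lleg P \<cdot> u = h \<cdot> a" "rleg P \<cdot> u = b"
      using pullback_lift[OF P, of "h \<cdot> a" b] by auto
    then obtain v where v: "v \<in> Ar C" "Dom C v = Dom C a" "Cod C v = apex C Q"
      "lleg Q \<cdot> v = a" "rleg Q \<cdot> v = u"
      using ab pullback_lift[OF Q, of a u] by auto
    then show "\<exists>u. u \<in> Ar C \<and> Dom C u = Dom C a \<and>
      Cod C u = apex C \<lparr>lleg = lleg Q, rleg = rleg P \<cdot> rleg Q\<rparr> \<and>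
      lleg \<lparr>lleg = lleg Q, rleg = rleg P \<cdot> rleg Q\<rparr> \<cdot> u = a \<and>
      rleg \<lparr>lleg = lleg Q, rleg = rleg P \<cdot> rleg Q\<rparr> \<cdot> u = b"
      using u by (intro exI[of _ v]) auto
  next
    fix u v assume uv: "u \<in> Ar C" "v \<in> Ar C" "Dom C u = Dom C v"
      "Cod C u = apex C \<lparr>lleg = lleg Q, rleg = rleg P \<cdot> rleg Q\<rparr>"
      "Cod C v = apex C \<lparr>lleg = lleg Q, rleg = rleg P \<cdot> rleg Q\<rparr>"
      "lleg \<lparr>lleg = lleg Q, rleg = rleg P \<cdot> rleg Q\<rparr> \<cdot> u = lleg \<lparr>lleg = lleg Q, rleg = rleg P \<cdot> rleg Q\<rparr> \<cdot> v"
      "rleg \<lparr>lleg = lleg Q, rleg = rleg P \<cdot> rleg Q\<rparr> \<cdot> u = rleg \<lparr>lleg = lleg Q, rleg = rleg P \<cdot> rleg Q\<rparr> \<cdot> v"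
    \<comment> \<open>Of the second component only the composite
      \<open>rleg P \<cdot> rleg Q\<close> is known to agree on \<open>u\<close> and
      \<open>v\<close>. Joint monicity for \<open>P\<close> removes \<open>rleg P\<close>, because
      \<open>lleg P \<cdot> rleg Q\<close> equals \<open>h \<cdot> lleg Q\<close>, on which they
      agree as well.\<close>
    then have "rleg Q \<cdot> u = rleg Q \<cdot> v"
      using eqs(2)[of u] eqs(2)[of v] by - (rule pullback_eqI[OF P], auto)
    with uv show "u = v"
      by - (rule pullback_eqI[OF Q], auto)
  qed (use eqs(1)[of "rleg Q"] in auto)
qed

text \<open>The mirror image, by swapping the legs of the spans. Associativity of vertical
  composition needs one pasting on either side.\<close>

lemma pullback_paste':
  assumes P: "is_pullback C f g P" and Q: "is_pullback C (rleg P) h Q"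
  shows "is_pullback C f (g \<cdot> h) \<lparr>lleg = lleg P \<cdot> lleg Q, rleg = rleg Q\<rparr>"
  using pullback_sym[OF pullback_paste[OF pullback_sym[OF P], of h "\<lparr>lleg = rleg Q, rleg = lleg Q\<rparr>"]]
    pullback_sym[OF Q] by simp

text \<open>A commutative square with one pair of opposite sides invertible is a pullback: the
  mediating arrow is \<open>h' \<cdot> b\<close> with \<open>h'\<close> inverse to \<open>h\<close>,
  and cancelling \<open>f\<close> shows that its first component is right too. Pullbacks along
  identities are special cases.\<close>

lemma pullback_of_isos:
  assumes "is_iso C f" "is_iso C h" "g \<in> Ar C" "k \<in> Ar C" "f \<cdot> k = g \<cdot> h"
    "Cod C k = Dom C f" "Dom C k = Dom C h" "Cod C h = Dom C g" "Cod C f = Cod C g"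
  shows "is_pullback C f g \<lparr>lleg = k, rleg = h\<rparr>"
proof -
  obtain h' where h [simp]: "h \<in> Ar C" "h' \<in> Ar C" "Dom C h' = Cod C h" "Cod C h' = Dom C h"
    "h' \<cdot> h = Id C (Dom C h)" "h \<cdot> h' = Id C (Cod C h)" "is_iso C h'"
    using assms(2) by (rule is_isoE)
  have [simp]: "f \<in> Ar C"
    using assms(1) by (auto simp: is_iso_def)
  show ?thesis
  proof (rule pullbackI)
    fix a b assume ab [simp]: "a \<in> Ar C" "b \<in> Ar C" "Dom C a = Dom C b" "Cod C a = Dom C f"
      "Cod C b = Dom C g" and eq: "f \<cdot> a = g \<cdot> b"
    have hb: "h \<cdot> (h' \<cdot> b) = b"
      using comp_reassoc[OF h(6), of b] assms by simp
    have "f \<cdot> (k \<cdot> (h' \<cdot> b)) = f \<cdot> a"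
      using comp_reassoc[OF assms(5), of "h' \<cdot> b"] assms eq hb by simp
    then have "k \<cdot> (h' \<cdot> b) = a"
      using assms by - (rule iso_cancel_left[OF assms(1)], auto)
    then show "\<exists>u. u \<in> Ar C \<and> Dom C u = Dom C a \<and> Cod C u = apex C \<lparr>lleg = k, rleg = h\<rparr> \<and>
      lleg \<lparr>lleg = k, rleg = h\<rparr> \<cdot> u = a \<and> rleg \<lparr>lleg = k, rleg = h\<rparr> \<cdot> u = b"
      using hb assms by (intro exI[of _ "h' \<cdot> b"]) auto
  next
    fix u v assume "u \<in> Ar C" "v \<in> Ar C" "Dom C u = Dom C v"
      "Cod C u = apex C \<lparr>lleg = k, rleg = h\<rparr>" "Cod C v = apex C \<lparr>lleg = k, rleg = h\<rparr>"
      "rleg \<lparr>lleg = k, rleg = h\<rparr> \<cdot> u = rleg \<lparr>lleg = k, rleg = h\<rparr> \<cdot> v"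
    then show "u = v"
      using assms by - (rule iso_cancel_left[OF assms(2)], auto)
  qed (use assms in auto)
qed

lemma pullback_Id_right:
  assumes "f \<in> Ar C" "Cod C f = a"
  shows "is_pullback C f (Id C a) \<lparr>lleg = Id C (Dom C f), rleg = f\<rparr>"
proof -
  have "is_pullback C (Id C a) f \<lparr>lleg = f, rleg = Id C (Dom C f)\<rparr>"
    using assms by (intro pullback_of_isos) (auto intro: Id_iso)
  from pullback_sym[OF this] show ?thesis by simp
qed

lemma pullback_Id_left:
  assumes "f \<in> Ar C" "Cod C f = a"
  shows "is_pullback C (Id C a) f \<lparr>lleg = f, rleg = Id C (Dom C f)\<rparr>"
  using assms by (intro pullback_of_isos) (auto intro: Id_iso)

lemma pullback_unique:
  assumes P: "is_pullback C f g P" and Q: "is_pullback C f g Q"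
  shows "span_iso C P Q"
proof -
  note p [simp] = pullbackD[OF P] and q [simp] = pullbackD[OF Q]
  obtain u where u: "u \<in> Ar C" "Dom C u = apex C P" "Cod C u = apex C Q"
      "lleg Q \<cdot> u = lleg P" "rleg Q \<cdot> u = rleg P"
    using pullback_lift[OF Q, of "lleg P" "rleg P"] by auto
  obtain v where v: "v \<in> Ar C" "Dom C v = apex C Q" "Cod C v = apex C P"
      "lleg P \<cdot> v = lleg Q" "rleg P \<cdot> v = rleg Q"
    using pullback_lift[OF P, of "lleg Q" "rleg Q"] by auto
  have "v \<cdot> u = Id C (apex C P)"
    using u v comp_reassoc[OF v(4), of u] comp_reassoc[OF v(5), of u]
    by - (rule pullback_eqI[OF P], auto)
  moreover have "u \<cdot> v = Id C (apex C Q)"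
    using u v comp_reassoc[OF u(4), of v] comp_reassoc[OF u(5), of v]
    by - (rule pullback_eqI[OF Q], auto)
  ultimately have "is_iso C u"
    using u v by (intro is_isoI[of u v]) auto
  with u show ?thesis
    by (auto simp: span_iso_def in_Hom)
qed

lemma span_iso_sym:
  assumes "span_iso C X Y" "wf_span Y"
  shows "span_iso C Y X"
proof -
  note [simp] = wf_spanD[OF assms(2)]
  obtain u where u: "is_iso C u" "Dom C u = apex C X" "Cod C u = apex C Y"
    "lleg Y \<cdot> u = lleg X" "rleg Y \<cdot> u = rleg X"
    using assms(1) by (auto simp: span_iso_def in_Hom)
  obtain v where v: "u \<in> Ar C" "v \<in> Ar C" "Dom C v = Cod C u" "Cod C v = Dom C u"
    "v \<cdot> u = Id C (Dom C u)" "u \<cdot> v = Id C (Cod C u)" "is_iso C v"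
    using u(1) by (rule is_isoE)
  show ?thesis
    unfolding span_iso_def
    using u v comp_reassoc[OF u(4), of v] comp_reassoc[OF u(5), of v]
    by (intro bexI[of _ v]) (auto simp: in_Hom)
qed

lemma span_iso_trans:
  assumes "span_iso C X Y" "span_iso C Y Z" "wf_span Z"
  shows "span_iso C X Z"
proof -
  note [simp] = wf_spanD[OF assms(3)]
  obtain u where u: "u \<in> Ar C" "is_iso C u" "Dom C u = apex C X" "Cod C u = apex C Y"
    "lleg Y \<cdot> u = lleg X" "rleg Y \<cdot> u = rleg X"
    using assms(1) by (auto simp: span_iso_def in_Hom)
  obtain v where v: "v \<in> Ar C" "is_iso C v" "Dom C v = apex C Y" "Cod C v = apex C Z"
    "lleg Z \<cdot> v = lleg Y" "rleg Z \<cdot> v = rleg Y"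
    using assms(2) by (auto simp: span_iso_def in_Hom)
  show ?thesis
    unfolding span_iso_def
    using u v comp_reassoc[OF v(5), of u] comp_reassoc[OF v(6), of u]
    by (intro bexI[of _ "v \<cdot> u"]) (auto simp: in_Hom is_iso_comp)
qed

text \<open>\<open>Q\<close> is the pasting of \<open>P\<close> with a square having an identity and
  the isomorphism \<open>v\<close> from \<open>Q\<close> to \<open>P\<close> as opposite sides, so
  closure under isomorphism is a case of \<open>pullback_paste'\<close>.\<close>

lemma pullback_span_iso:
  assumes P: "is_pullback C f g P" and iso: "span_iso C P Q" and Q: "wf_span Q"
  shows "is_pullback C f g Q"
proof -
  note p [simp] = pullbackD[OF P] and q [simp] = wf_spanD[OF Q]
  obtain v where v: "v \<in> Ar C" "is_iso C v" "Dom C v = apex C Q" "Cod C v = apex C P"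
    "lleg P \<cdot> v = lleg Q" "rleg P \<cdot> v = rleg Q"
    using span_iso_sym[OF iso Q] by (auto simp: span_iso_def in_Hom)
  have QP: "Q = \<lparr>lleg = lleg P \<cdot> v, rleg = rleg P \<cdot> v\<rparr>"
    using v by simp
  have "is_pullback C (rleg P) (Id C (Dom C g)) \<lparr>lleg = v, rleg = rleg P \<cdot> v\<rparr>"
  proof -
    have "is_pullback C (Id C (Dom C g)) (rleg P) \<lparr>lleg = rleg P \<cdot> v, rleg = v\<rparr>"
      using v(1-4) by (intro pullback_of_isos) (auto intro: Id_iso)
    from pullback_sym[OF this] show ?thesis by simp
  qed
  from pullback_paste'[OF P this] show ?thesis
    using v unfolding QP by auto
qed

text \<open>Representatives of one class differ by isomorphisms of their apexes, and this compares
  the pullbacks they give: a lift for \<open>f\<close> and \<open>g\<close> is obtained from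
  \<open>P\<close> after composing the cone with the inverses of \<open>u\<close> and
  \<open>v\<close>.\<close>

lemma pullback_comp_isos:
  assumes P: "is_pullback C (f \<cdot> u) (g \<cdot> v) P" and "is_iso C u" "is_iso C v"
    "f \<in> Ar C" "g \<in> Ar C" "Cod C u = Dom C f" "Cod C v = Dom C g"
  shows "is_pullback C f g \<lparr>lleg = u \<cdot> lleg P, rleg = v \<cdot> rleg P\<rparr>"
proof -
  note uv [simp] = assms(2-)
  have [simp]: "u \<in> Ar C" "v \<in> Ar C"
    using uv by (auto simp: is_iso_def)
  have fg [simp]: "Cod C f = Cod C g"
    using pullbackD(3)[OF P] by simp
  note p [simp] = pullbackD(1-6)[OF P]
  obtain u' where u [simp]: "u' \<in> Ar C" "Dom C u' = Cod C u" "Cod C u' = Dom C u"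
    "u' \<cdot> u = Id C (Dom C u)" "u \<cdot> u' = Id C (Cod C u)"
    using uv(1) by (rule is_isoE)
  obtain v' where v [simp]: "v' \<in> Ar C" "Dom C v' = Cod C v" "Cod C v' = Dom C v"
    "v' \<cdot> v = Id C (Dom C v)" "v \<cdot> v' = Id C (Cod C v)"
    using uv(2) by (rule is_isoE)
  let ?Q = "\<lparr>lleg = u \<cdot> lleg P, rleg = v \<cdot> rleg P\<rparr>"
  show ?thesis
  proof (rule pullbackI)
    fix h k assume hk [simp]: "h \<in> Ar C" "k \<in> Ar C" "Dom C h = Dom C k" "Cod C h = Dom C f"
      "Cod C k = Dom C g" and eq: "f \<cdot> h = g \<cdot> k"
    have *: "u \<cdot> (u' \<cdot> h) = h" "v \<cdot> (v' \<cdot> k) = k"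
      using comp_reassoc[OF u(5), of h] comp_reassoc[OF v(5), of k] by simp_all
    obtain w where "w \<in> Ar C" "Dom C w = Dom C k" "Cod C w = apex C P"
        "lleg P \<cdot> w = u' \<cdot> h" "rleg P \<cdot> w = v' \<cdot> k"
      using pullback_lift[OF P, of "u' \<cdot> h" "v' \<cdot> k"] * eq by auto
    then show "\<exists>w. w \<in> Ar C \<and> Dom C w = Dom C h \<and> Cod C w = apex C ?Q \<and>
        lleg ?Q \<cdot> w = h \<and> rleg ?Q \<cdot> w = k"
      using * by (intro exI[of _ w]) auto
  next
    fix a b assume ab: "a \<in> Ar C" "b \<in> Ar C" "Dom C a = Dom C b" "Cod C a = apex C ?Q"
      "Cod C b = apex C ?Q" "lleg ?Q \<cdot> a = lleg ?Q \<cdot> b" "rleg ?Q \<cdot> a = rleg ?Q \<cdot> b"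
    then have "lleg P \<cdot> a = lleg P \<cdot> b" "rleg P \<cdot> a = rleg P \<cdot> b"
      by - (rule iso_cancel_left[OF uv(1)], auto, rule iso_cancel_left[OF uv(2)], auto)
    with ab show "a = b"
      by - (rule pullback_eqI[OF P], auto)
  qed (use pullbackD(7)[OF P] in auto)
qed

end

section \<open>Functors on product categories\<close>

lemma Hom_prod_iff:
  "(f, f') \<in> Hom (prod_cat C D) (a, a') (b, b') \<longleftrightarrow> f \<in> Hom C a b \<and> f' \<in> Hom D a' b'"
  by (auto simp: Hom_def prod_cat_def)

lemma prod_cat_simps [simp]:
  "(a, a') \<in> Ob (prod_cat C D) \<longleftrightarrow> a \<in> Ob C \<and> a' \<in> Ob D"
  "Id (prod_cat C D) (a, a') = (Id C a, Id D a')"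
  "Comp (prod_cat C D) (g, g') (f, f') = (Comp C g f, Comp D g' f')"
  by (simp_all add: prod_cat_def)

lemma one_category: "category one_cat"
  by unfold_locales (simp_all add: one_cat_def Hom_def)

lemma prod_category:
  assumes "category C" "category D"
  shows "category (prod_cat C D)"
proof -
  interpret C: category C by fact
  interpret D: category D by fact
  show ?thesis
  proof
    fix f a b g c h d
    assume "f \<in> Hom (prod_cat C D) a b" "g \<in> Hom (prod_cat C D) b c" "h \<in> Hom (prod_cat C D) c d"
    then show "Comp (prod_cat C D) h (Comp (prod_cat C D) g f) = Comp (prod_cat C D) (Comp (prod_cat C D) h g) f"
      by (cases f; cases g; cases h; cases a; cases b; cases c; cases d)
        (auto simp: Hom_prod_iff C.Comp_assoc D.Comp_assoc)
  next
    fix f a b g c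
    assume "f \<in> Hom (prod_cat C D) a b" "g \<in> Hom (prod_cat C D) b c"
    then show "Comp (prod_cat C D) g f \<in> Hom (prod_cat C D) a c"
      by (cases f; cases g; cases a; cases b; cases c)
        (auto simp: Hom_prod_iff intro: C.Comp_in_Hom D.Comp_in_Hom)
  next
    fix f a b
    assume "f \<in> Hom (prod_cat C D) a b"
    then show "Comp (prod_cat C D) f (Id (prod_cat C D) a) = f" "Comp (prod_cat C D) (Id (prod_cat C D) b) f = f"
      by (cases f; cases a; cases b, auto simp: Hom_prod_iff C.Comp_Id_left D.Comp_Id_left
        C.Comp_Id_right D.Comp_Id_right)+
  next
    fix a assume "a \<in> Ob (prod_cat C D)"
    then show "Id (prod_cat C D) a \<in> Hom (prod_cat C D) a a"
      by (cases a) (simp add: Hom_prod_iff C.Id_in_Hom D.Id_in_Hom)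
  next
    fix f assume "f \<in> Ar (prod_cat C D)"
    then show "Dom (prod_cat C D) f \<in> Ob (prod_cat C D)" "Cod (prod_cat C D) f \<in> Ob (prod_cat C D)"
      by (auto simp: prod_cat_def C.Dom_in_Ob D.Dom_in_Ob C.Cod_in_Ob D.Cod_in_Ob)
  qed
qed

lemma functor_id: "category C \<Longrightarrow> is_functor C C id_funct"
  by (simp add: is_functor_def is_functor_axioms_def id_funct_def)

text \<open>A natural isomorphism needs functors at both ends, and the nested composites on triples
  are written out by hand. Functoriality is derived from that of \<open>H\<close> and
  \<open>K\<close> alone, so nothing about spans has to be unfolded for it.\<close>

lemma functor_right_nested:
  assumes X: "category X" and Y: "category Y" and W: "category W"
    and H: "is_functor (prod_cat X V) Z H" and K: "is_functor (prod_cat Y W) V K"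
  shows "is_functor (prod_cat X (prod_cat Y W)) Z
    \<lparr>FOb = (\<lambda>(f, g, h). FOb H (f, FOb K (g, h))), FAr = (\<lambda>(\<phi>, \<gamma>, \<eta>). FAr H (\<phi>, FAr K (\<gamma>, \<eta>)))\<rparr>"
proof -
  interpret H: is_functor "prod_cat X V" Z H by fact
  interpret K: is_functor "prod_cat Y W" V K by fact
  show ?thesis
  proof (rule is_functor.intro[OF prod_category[OF X prod_category[OF Y W]] H.D.category_axioms],
      unfold_locales, goal_cases)
    case (1 a) then show ?case
      by (cases a) (auto intro!: H.FOb_in_Ob K.FOb_in_Ob)
  next
    case (2 f a b) then show ?case
      by (cases f; cases a; cases b) (auto simp: Hom_prod_iff intro!: H.FAr_in_Hom K.FAr_in_Hom)
  next
    case (3 a)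
    then obtain a1 a2 a3 where "a = (a1, a2, a3)" "a1 \<in> Ob X" "a2 \<in> Ob Y" "a3 \<in> Ob W"
      by (cases a) auto
    then show ?case
      using H.FAr_Id[of "(a1, FOb K (a2, a3))"] K.FAr_Id[of "(a2, a3)"] K.FOb_in_Ob[of "(a2, a3)"] by simp
  next
    case (4 f a b g c)
    obtain f1 f2 f3 a1 a2 a3 b1 b2 b3 g1 g2 g3 c1 c2 c3 where eq: "f = (f1, f2, f3)" "a = (a1, a2, a3)"
      "b = (b1, b2, b3)" "g = (g1, g2, g3)" "c = (c1, c2, c3)"
      by (metis prod_cases3)
    have 1: "FAr K (Comp Y g2 f2, Comp W g3 f3) = Comp V (FAr K (g2, g3)) (FAr K (f2, f3))"
      using K.FAr_Comp[of "(f2, f3)" "(a2, a3)" "(b2, b3)" "(g2, g3)" "(c2, c3)"] 4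
      by (simp add: eq Hom_prod_iff)
    show ?case
      using H.FAr_Comp[of "(f1, FAr K (f2, f3))" "(a1, FOb K (a2, a3))" "(b1, FOb K (b2, b3))"
          "(g1, FAr K (g2, g3))" "(c1, FOb K (c2, c3))"] 4
        K.FAr_in_Hom[of "(f2, f3)" "(a2, a3)" "(b2, b3)"] K.FAr_in_Hom[of "(g2, g3)" "(b2, b3)" "(c2, c3)"]
      by (simp add: eq Hom_prod_iff 1)
  qed
qed

lemma functor_left_nested:
  assumes X: "category X" and Y: "category Y" and W: "category W"
    and H: "is_functor (prod_cat V W) Z H" and K: "is_functor (prod_cat X Y) V K"
  shows "is_functor (prod_cat X (prod_cat Y W)) Z
    \<lparr>FOb = (\<lambda>(f, g, h). FOb H (FOb K (f, g), h)), FAr = (\<lambda>(\<phi>, \<gamma>, \<eta>). FAr H (FAr K (\<phi>, \<gamma>), \<eta>))\<rparr>"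
proof -
  interpret H: is_functor "prod_cat V W" Z H by fact
  interpret K: is_functor "prod_cat X Y" V K by fact
  show ?thesis
  proof (rule is_functor.intro[OF prod_category[OF X prod_category[OF Y W]] H.D.category_axioms],
      unfold_locales, goal_cases)
    case (1 a) then show ?case
      by (cases a) (auto intro!: H.FOb_in_Ob K.FOb_in_Ob)
  next
    case (2 f a b) then show ?case
      by (cases f; cases a; cases b) (auto simp: Hom_prod_iff intro!: H.FAr_in_Hom K.FAr_in_Hom)
  next
    case (3 a)
    then obtain a1 a2 a3 where "a = (a1, a2, a3)" "a1 \<in> Ob X" "a2 \<in> Ob Y" "a3 \<in> Ob W"
      by (cases a) auto
    then show ?case
      using H.FAr_Id[of "(FOb K (a1, a2), a3)"] K.FAr_Id[of "(a1, a2)"] K.FOb_in_Ob[of "(a1, a2)"] by simp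
  next
    case (4 f a b g c)
    obtain f1 f2 f3 a1 a2 a3 b1 b2 b3 g1 g2 g3 c1 c2 c3 where eq: "f = (f1, f2, f3)" "a = (a1, a2, a3)"
      "b = (b1, b2, b3)" "g = (g1, g2, g3)" "c = (c1, c2, c3)"
      by (metis prod_cases3)
    have 1: "FAr K (Comp X g1 f1, Comp Y g2 f2) = Comp V (FAr K (g1, g2)) (FAr K (f1, f2))"
      using K.FAr_Comp[of "(f1, f2)" "(a1, a2)" "(b1, b2)" "(g1, g2)" "(c1, c2)"] 4
      by (simp add: eq Hom_prod_iff)
    show ?case
      using H.FAr_Comp[of "(FAr K (f1, f2), f3)" "(FOb K (a1, a2), a3)" "(FOb K (b1, b2), b3)"
          "(FAr K (g1, g2), g3)" "(FOb K (c1, c2), c3)"] 4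
        K.FAr_in_Hom[of "(f1, f2)" "(a1, a2)" "(b1, b2)"] K.FAr_in_Hom[of "(g1, g2)" "(b1, b2)" "(c1, c2)"]
      by (simp add: eq Hom_prod_iff 1)
  qed
qed

lemma one_cat_simps [simp]:
  "u \<in> Ob one_cat" "\<iota> \<in> Hom one_cat u v" "Id one_cat u = ()" "Comp one_cat \<iota> \<kappa> = ()"
  by (simp_all add: one_cat_def Hom_def)

lemma functor_unit_before:
  assumes I: "is_functor one_cat V I" and W: "category W" and H: "is_functor (prod_cat V W) Z H"
  shows "is_functor W Z \<lparr>FOb = (\<lambda>f. FOb H (FOb I (), f)), FAr = (\<lambda>\<phi>. FAr H (FAr I (), \<phi>))\<rparr>"
proof -
  interpret I: is_functor one_cat V I by fact
  interpret H: is_functor "prod_cat V W" Z H by fact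
  \<comment> \<open>Fixing one argument of \<open>H\<close> preserves composition only because the
    arrow put there, the image of the single arrow of \<open>one_cat\<close>, is an identity and
    hence idempotent.\<close>
  have I: "FAr I () \<in> Hom V (FOb I ()) (FOb I ())" "FAr I () = Id V (FOb I ())"
    "Comp V (FAr I ()) (FAr I ()) = FAr I ()"
    using I.FAr_in_Hom[of "()" "()" "()"] I.FAr_Id[of "()"] I.FAr_Comp[of "()" "()" "()" "()" "()"] by simp_all
  show ?thesis
  proof (rule is_functor.intro[OF W H.D.category_axioms], unfold_locales, goal_cases)
    case (1 a) then show ?case
      by (auto intro!: H.FOb_in_Ob I.FOb_in_Ob)
  next
    case (2 f a b) then show ?case
      by (auto simp: Hom_prod_iff I(1) intro!: H.FAr_in_Hom)
  next
    case (3 a) then show ?case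
      using H.FAr_Id[of "(FOb I (), a)"] I.FOb_in_Ob by (simp add: I(2))
  next
    case (4 f a b g c) then show ?case
      using H.FAr_Comp[of "(FAr I (), f)" "(FOb I (), a)" "(FOb I (), b)" "(FAr I (), g)" "(FOb I (), c)"]
      by (simp add: Hom_prod_iff I(1,3))
  qed
qed

lemma functor_unit_after:
  assumes I: "is_functor one_cat V I" and W: "category W" and H: "is_functor (prod_cat W V) Z H"
  shows "is_functor W Z \<lparr>FOb = (\<lambda>f. FOb H (f, FOb I ())), FAr = (\<lambda>\<phi>. FAr H (\<phi>, FAr I ()))\<rparr>"
proof -
  interpret I: is_functor one_cat V I by fact
  interpret H: is_functor "prod_cat W V" Z H by fact
  have I: "FAr I () \<in> Hom V (FOb I ()) (FOb I ())" "FAr I () = Id V (FOb I ())"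
    "Comp V (FAr I ()) (FAr I ()) = FAr I ()"
    using I.FAr_in_Hom[of "()" "()" "()"] I.FAr_Id[of "()"] I.FAr_Comp[of "()" "()" "()" "()" "()"] by simp_all
  show ?thesis
  proof (rule is_functor.intro[OF W H.D.category_axioms], unfold_locales, goal_cases)
    case (1 a) then show ?case
      by (auto intro!: H.FOb_in_Ob I.FOb_in_Ob)
  next
    case (2 f a b) then show ?case
      by (auto simp: Hom_prod_iff I(1) intro!: H.FAr_in_Hom)
  next
    case (3 a) then show ?case
      using H.FAr_Id[of "(a, FOb I ())"] I.FOb_in_Ob by (simp add: I(2))
  next
    case (4 f a b g c) then show ?case
      using H.FAr_Comp[of "(f, FAr I ())" "(a, FOb I ())" "(b, FOb I ())" "(g, FAr I ())" "(c, FOb I ())"]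
      by (simp add: Hom_prod_iff I(1,3))
  qed
qed

section \<open>Maps of spans\<close>

locale pullback_category = category C
  for C :: "('o, 'm) cat" (structure) +
  fixes pb :: "'m \<Rightarrow> 'm \<Rightarrow> 'm span"
  assumes pullback_choice: "pullback_choice C pb"
begin

abbreviation hspan :: "'m span \<Rightarrow> 'm span \<Rightarrow> 'm span" (infixr "\<odot>" 75) where
  "S \<odot> S' \<equiv> span_comp C pb S S'"

abbreviation into :: "'m span \<Rightarrow> 'm span \<Rightarrow> 'm \<Rightarrow> 'm \<Rightarrow> 'm" where
  "into \<equiv> into_comp C pb"

text \<open>Projections of the selected pullback, indexed by the two spans so that later equations
  mention the spans and not the selection \<open>pb\<close>.\<close>

definition pr1 :: "'m span \<Rightarrow> 'm span \<Rightarrow> 'm" where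
  "pr1 S S' = lleg (pb (rleg S) (lleg S'))"

definition pr2 :: "'m span \<Rightarrow> 'm span \<Rightarrow> 'm" where
  "pr2 S S' = rleg (pb (rleg S) (lleg S'))"

lemma legs_hspan [simp]:
  "lleg (S \<odot> S') = lleg S \<cdot> pr1 S S'" "rleg (S \<odot> S') = rleg S' \<cdot> pr2 S S'"
  by (simp_all add: span_comp_def pr1_def pr2_def Let_def)

lemma pb_is_pullback:
  assumes "wf_span S" "wf_span S'" "Cod C (rleg S) = Cod C (lleg S')"
  shows "is_pullback C (rleg S) (lleg S') (pb (rleg S) (lleg S'))"
  using pullback_choice assms by (simp add: pullback_choice_def)

lemma apex_hspan:
  assumes "wf_span S" "wf_span S'" "Cod C (rleg S) = Cod C (lleg S')"
  shows "apex C (S \<odot> S') = apex C (pb (rleg S) (lleg S'))"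
  using pullbackD[OF pb_is_pullback[OF assms]] assms by (simp add: span_comp_def Let_def)

lemma pr_simps [simp]:
  assumes "wf_span S" "wf_span S'" "Cod C (rleg S) = Cod C (lleg S')"
  shows "pr1 S S' \<in> Ar C" "Dom C (pr1 S S') = apex C (S \<odot> S')" "Cod C (pr1 S S') = apex C S"
    "pr2 S S' \<in> Ar C" "Dom C (pr2 S S') = apex C (S \<odot> S')" "Cod C (pr2 S S') = apex C S'"
    "rleg S \<cdot> pr1 S S' = lleg S' \<cdot> pr2 S S'"
  using pullbackD[OF pb_is_pullback[OF assms]] assms
  by (simp_all add: apex_hspan pr1_def pr2_def)

text \<open>At the middle foot, chains are always rewritten from the \<open>pr1\<close> side to the
  \<open>pr2\<close> side; the two equal routes thereby get one normal form.\<close>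

lemma pr_reassoc [simp]:
  assumes "wf_span S" "wf_span S'" "Cod C (rleg S) = Cod C (lleg S')"
    "x \<in> Ar C" "Cod C x = apex C (S \<odot> S')"
  shows "rleg S \<cdot> (pr1 S S' \<cdot> x) = lleg S' \<cdot> (pr2 S S' \<cdot> x)"
  using assms comp_reassoc[OF pr_simps(7)[OF assms(1-3)], of x] by simp

lemma wf_hspan [simp]:
  assumes "wf_span S" "wf_span S'" "Cod C (rleg S) = Cod C (lleg S')"
  shows "wf_span (S \<odot> S')"
  using assms by (simp add: wf_span_def [of "S \<odot> S'"])

lemma into_simps [simp]:
  assumes "wf_span S" "wf_span S'" "Cod C (rleg S) = Cod C (lleg S')"
    "h \<in> Ar C" "k \<in> Ar C" "Dom C h = Dom C k" "Cod C h = apex C S" "Cod C k = apex C S'"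
    "rleg S \<cdot> h = lleg S' \<cdot> k"
  shows "into S S' h k \<in> Ar C" "Dom C (into S S' h k) = Dom C h"
    "Cod C (into S S' h k) = apex C (S \<odot> S')"
    "pr1 S S' \<cdot> into S S' h k = h" "pr2 S S' \<cdot> into S S' h k = k"
  using induced_simps[OF pb_is_pullback[OF assms(1-3)], of h k] assms
  by (simp_all add: into_comp_def apex_hspan pr1_def pr2_def)

lemma into_reassoc [simp]:
  assumes "wf_span S" "wf_span S'" "Cod C (rleg S) = Cod C (lleg S')"
    "h \<in> Ar C" "k \<in> Ar C" "Dom C h = Dom C k" "Cod C h = apex C S" "Cod C k = apex C S'"
    "rleg S \<cdot> h = lleg S' \<cdot> k" "x \<in> Ar C" "Cod C x = Dom C h"
  shows "pr1 S S' \<cdot> (into S S' h k \<cdot> x) = h \<cdot> x" "pr2 S S' \<cdot> (into S S' h k \<cdot> x) = k \<cdot> x"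
  using assms(1-3,10,11) into_simps[OF assms(1-9)]
    comp_reassoc[OF into_simps(4)[OF assms(1-9)], of x]
    comp_reassoc[OF into_simps(5)[OF assms(1-9)], of x] by simp_all

lemma hspan_eqI:
  assumes "wf_span S" "wf_span S'" "Cod C (rleg S) = Cod C (lleg S')"
    "u \<in> Ar C" "v \<in> Ar C" "Dom C u = Dom C v" "Cod C u = apex C (S \<odot> S')" "Cod C v = apex C (S \<odot> S')"
    "pr1 S S' \<cdot> u = pr1 S S' \<cdot> v" "pr2 S S' \<cdot> u = pr2 S S' \<cdot> v"
  shows "u = v"
  using assms by (auto simp: apex_hspan pr1_def pr2_def intro: pullback_eqI[OF pb_is_pullback])

text \<open>Well-formedness of both spans is included, so that one premise settles all domain and
  codomain conditions. The feet need no mention: \<open>span_mapD\<close> shows that they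
  agree.\<close>

definition span_map :: "'m span \<Rightarrow> 'm span \<Rightarrow> 'm \<Rightarrow> bool" where
  "span_map S T f \<longleftrightarrow> wf_span S \<and> wf_span T \<and> f \<in> Ar C \<and> Dom C f = apex C S \<and> Cod C f = apex C T \<and>
    lleg T \<cdot> f = lleg S \<and> rleg T \<cdot> f = rleg S"

lemma span_mapD:
  assumes "span_map S T f"
  shows "wf_span S" "wf_span T" "f \<in> Ar C" "Dom C f = apex C S" "Cod C f = apex C T"
    "Cod C (lleg S) = Cod C (lleg T)" "Cod C (rleg S) = Cod C (rleg T)"
    "lleg T \<cdot> f = lleg S" "rleg T \<cdot> f = rleg S"
proof -
  show *: "wf_span S" "wf_span T" "f \<in> Ar C" "Dom C f = apex C S" "Cod C f = apex C T"
    "lleg T \<cdot> f = lleg S" "rleg T \<cdot> f = rleg S"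
    using assms by (auto simp: span_map_def)
  show "Cod C (lleg S) = Cod C (lleg T)" "Cod C (rleg S) = Cod C (rleg T)"
    using *(1-5) comp_simps(3)[of f "lleg T"] comp_simps(3)[of f "rleg T"] by (simp_all add: *(6,7))
qed

lemma span_map_reassoc:
  assumes "span_map S T f" "x \<in> Ar C" "Cod C x = apex C S"
  shows "lleg T \<cdot> (f \<cdot> x) = lleg S \<cdot> x" "rleg T \<cdot> (f \<cdot> x) = rleg S \<cdot> x"
  using assms span_mapD[OF assms(1)] comp_reassoc[of "lleg T" f _ x] comp_reassoc[of "rleg T" f _ x]
  by simp_all

lemma span_map_comp:
  assumes "span_map S T f" "span_map T U g"
  shows "span_map S U (g \<cdot> f)"
  using span_mapD(1-5,8,9)[OF assms(1)] span_mapD(1-5)[OF assms(2)] span_map_reassoc[OF assms(2), of f]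
  by (simp add: span_map_def)

lemma span_map_Id: "wf_span S \<Longrightarrow> span_map S S (Id C (apex C S))"
  by (simp add: span_map_def)

section \<open>Horizontal composition of maps\<close>

definition hcomp_map ::
  "'m span \<Rightarrow> 'm span \<Rightarrow> 'm span \<Rightarrow> 'm span \<Rightarrow> 'm \<Rightarrow> 'm \<Rightarrow> 'm" where
  "hcomp_map S S' T T' f f' = into T T' (f \<cdot> pr1 S S') (f' \<cdot> pr2 S S')"

lemma hcomp_map_simps [simp]:
  assumes f: "span_map S T f" and f': "span_map S' T' f'" and TT': "Cod C (rleg T) = Cod C (lleg T')"
  shows "hcomp_map S S' T T' f f' \<in> Ar C" "Dom C (hcomp_map S S' T T' f f') = apex C (S \<odot> S')"
    "Cod C (hcomp_map S S' T T' f f') = apex C (T \<odot> T')"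
    "pr1 T T' \<cdot> hcomp_map S S' T T' f f' = f \<cdot> pr1 S S'"
    "pr2 T T' \<cdot> hcomp_map S S' T T' f f' = f' \<cdot> pr2 S S'"
proof -
  note [simp] = span_mapD(1-7)[OF f] span_mapD(1-7)[OF f'] TT'
  \<comment> \<open>Since maps commute with the legs at the middle foot, this reduces to
    commutativity of the pullback square of \<open>S\<close> and \<open>S'\<close>.\<close>
  have "rleg T \<cdot> (f \<cdot> pr1 S S') = lleg T' \<cdot> (f' \<cdot> pr2 S S')"
    using span_map_reassoc(2)[OF f, of "pr1 S S'"] span_map_reassoc(1)[OF f', of "pr2 S S'"] by simp
  then show "hcomp_map S S' T T' f f' \<in> Ar C" "Dom C (hcomp_map S S' T T' f f') = apex C (S \<odot> S')"
    "Cod C (hcomp_map S S' T T' f f') = apex C (T \<odot> T')"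
    "pr1 T T' \<cdot> hcomp_map S S' T T' f f' = f \<cdot> pr1 S S'"
    "pr2 T T' \<cdot> hcomp_map S S' T T' f f' = f' \<cdot> pr2 S S'"
    by (simp_all add: hcomp_map_def)
qed

lemma hcomp_map_reassoc [simp]:
  assumes f: "span_map S T f" and f': "span_map S' T' f'" and TT': "Cod C (rleg T) = Cod C (lleg T')"
    and x: "x \<in> Ar C" "Cod C x = apex C (S \<odot> S')"
  shows "pr1 T T' \<cdot> (hcomp_map S S' T T' f f' \<cdot> x) = f \<cdot> (pr1 S S' \<cdot> x)"
    "pr2 T T' \<cdot> (hcomp_map S S' T T' f f' \<cdot> x) = f' \<cdot> (pr2 S S' \<cdot> x)"
  using x span_mapD(1-7)[OF f] span_mapD(1-7)[OF f'] TT' hcomp_map_simps(1-3)[OF f f' TT']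
    comp_reassoc[OF hcomp_map_simps(4)[OF f f' TT'], of x]
    comp_reassoc[OF hcomp_map_simps(5)[OF f f' TT'], of x] by simp_all

lemma hcomp_map_span_map:
  assumes f: "span_map S T f" and f': "span_map S' T' f'" and TT': "Cod C (rleg T) = Cod C (lleg T')"
  shows "span_map (S \<odot> S') (T \<odot> T') (hcomp_map S S' T T' f f')"
  using f f' TT' span_mapD(1-7)[OF f] span_mapD(1-7)[OF f']
    span_map_reassoc(1)[OF f, of "pr1 S S'"] span_map_reassoc(2)[OF f', of "pr2 S S'"]
  by (simp add: span_map_def [of "S \<odot> S'"])

lemma hcomp_map_comp:
  assumes f: "span_map S T f" "span_map T U g" and f': "span_map S' T' f'" "span_map T' U' g'"
    and UU': "Cod C (rleg U) = Cod C (lleg U')"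
  shows "hcomp_map T T' U U' g g' \<cdot> hcomp_map S S' T T' f f' = hcomp_map S S' U U' (g \<cdot> f) (g' \<cdot> f')"
proof -
  note [simp] = f f' span_mapD(1-7)[OF f(1)] span_mapD(1-7)[OF f'(1)]
    span_mapD(1-7)[OF f(2)] span_mapD(1-7)[OF f'(2)] UU' span_map_comp[OF f] span_map_comp[OF f']
  show ?thesis
    by (rule hspan_eqI[of U U']) simp_all
qed

lemma hcomp_map_Id:
  assumes "wf_span S" "wf_span S'" "Cod C (rleg S) = Cod C (lleg S')"
  shows "hcomp_map S S' S S' (Id C (apex C S)) (Id C (apex C S')) = Id C (apex C (S \<odot> S'))"
  by (rule hspan_eqI[of S S']) (use assms in \<open>simp_all add: span_map_Id\<close>)

text \<open>Pullbacks of span maps are computed on apexes. The legs of the new span are routed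
  through \<open>X\<close>; routing them through \<open>Y\<close> gives the same, because
  \<open>f\<close> and \<open>g\<close> commute with the legs of \<open>T\<close>.\<close>

lemma pullback_apex_span_map:
  assumes f: "span_map X T f" and g: "span_map Y T g" and P: "is_pullback C f g P"
  defines "Q \<equiv> \<lparr>lleg = lleg X \<cdot> lleg P, rleg = rleg X \<cdot> lleg P\<rparr>"
  shows "span_map Q X (lleg P)" "span_map Q Y (rleg P)" "apex C Q = apex C P"
proof -
  note [simp] = span_mapD(1-7)[OF f] span_mapD(1-7)[OF g] pullbackD(1-6)[OF P]
  have "lleg X \<cdot> lleg P = lleg Y \<cdot> rleg P" "rleg X \<cdot> lleg P = rleg Y \<cdot> rleg P"
    using span_map_reassoc[OF f, of "lleg P"] span_map_reassoc[OF g, of "rleg P"] pullbackD(7)[OF P]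
    by simp_all
  then show "span_map Q X (lleg P)" "span_map Q Y (rleg P)" "apex C Q = apex C P"
    by (auto simp: span_map_def Q_def)
qed

text \<open>Limits commute with limits: two pullback squares composed horizontally form a pullback
  square. The interchange law rests on this, applied to the squares that define the two vertical
  composites.\<close>

lemma hcomp_map_pullback:
  assumes f: "span_map X T f" and g: "span_map Y T g" and P: "is_pullback C f g P"
    and f': "span_map X' T' f'" and g': "span_map Y' T' g'" and P': "is_pullback C f' g' P'"
    and p: "span_map Q X (lleg P)" "span_map Q Y (rleg P)"
    and p': "span_map Q' X' (lleg P')" "span_map Q' Y' (rleg P')"
    and TT': "Cod C (rleg T) = Cod C (lleg T')"
  shows "is_pullback C (hcomp_map X X' T T' f f') (hcomp_map Y Y' T T' g g')
    \<lparr>lleg = hcomp_map Q Q' X X' (lleg P) (lleg P'), rleg = hcomp_map Q Q' Y Y' (rleg P) (rleg P')\<rparr>"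
    (is "is_pullback C ?h ?k ?R")
proof -
  note [simp] = f g f' g' p p' span_mapD(1-7)[OF f] span_mapD(1-7)[OF g] span_mapD(1-7)[OF f'] span_mapD(1-7)[OF g']
     span_mapD(1)[OF p(1)] span_mapD(6-7)[OF p(1)] span_mapD(1)[OF p'(1)] span_mapD(6-7)[OF p'(1)] TT'
     pullbackD(1-6)[OF P] pullbackD(1-6)[OF P']
  have [simp]: "apex C P = apex C Q" "apex C P' = apex C Q'"
    using span_mapD(4)[OF p(1)] span_mapD(4)[OF p'(1)] by simp_all
  show ?thesis
  proof (rule pullbackI)
    show "?h \<cdot> lleg ?R = ?k \<cdot> rleg ?R"
      using hcomp_map_comp[OF p(1) f p'(1) f' TT'] hcomp_map_comp[OF p(2) g p'(2) g' TT']
        pullbackD(7)[OF P] pullbackD(7)[OF P'] by simp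
  next
    fix a b assume ab [simp]: "a \<in> Ar C" "b \<in> Ar C" "Dom C a = Dom C b" "Cod C a = Dom C ?h"
      "Cod C b = Dom C ?k" and eq: "?h \<cdot> a = ?k \<cdot> b"
    have ab' [simp]: "Cod C a = apex C (X \<odot> X')" "Cod C b = apex C (Y \<odot> Y')"
      using ab by simp_all
    \<comment> \<open>Projecting the equation to the two factors of \<open>T \<odot> T'\<close>
      gives a cone over each of the original cospans.\<close>
    have eqs: "f \<cdot> (pr1 X X' \<cdot> a) = g \<cdot> (pr1 Y Y' \<cdot> b)" "f' \<cdot> (pr2 X X' \<cdot> a) = g' \<cdot> (pr2 Y Y' \<cdot> b)"
      using arg_cong[OF eq, of "\<lambda>x. pr1 T T' \<cdot> x"] arg_cong[OF eq, of "\<lambda>x. pr2 T T' \<cdot> x"]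
      by simp_all
    obtain w where "w \<in> Ar C" "Dom C w = Dom C (pr1 X X' \<cdot> a)" "Cod C w = apex C P"
        "lleg P \<cdot> w = pr1 X X' \<cdot> a" "rleg P \<cdot> w = pr1 Y Y' \<cdot> b"
      by (rule pullback_lift[OF P _ _ _ _ _ eqs(1)]) simp_all
    then have w [simp]: "w \<in> Ar C" "Dom C w = Dom C b" "Cod C w = apex C Q"
        "lleg P \<cdot> w = pr1 X X' \<cdot> a" "rleg P \<cdot> w = pr1 Y Y' \<cdot> b"
      by simp_all
    obtain w' where "w' \<in> Ar C" "Dom C w' = Dom C (pr2 X X' \<cdot> a)" "Cod C w' = apex C P'"
        "lleg P' \<cdot> w' = pr2 X X' \<cdot> a" "rleg P' \<cdot> w' = pr2 Y Y' \<cdot> b"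
      by (rule pullback_lift[OF P' _ _ _ _ _ eqs(2)]) simp_all
    then have w' [simp]: "w' \<in> Ar C" "Dom C w' = Dom C b" "Cod C w' = apex C Q'"
        "lleg P' \<cdot> w' = pr2 X X' \<cdot> a" "rleg P' \<cdot> w' = pr2 Y Y' \<cdot> b"
      by simp_all
    \<comment> \<open>The partial lifts glue to an arrow into \<open>Q \<odot> Q'\<close>: the legs
      of \<open>Q\<close> and \<open>Q'\<close> at the middle foot factor through \<open>X\<close>
      and \<open>X'\<close>, where the two projections of \<open>a\<close> already agree.\<close>
    have "rleg Q \<cdot> w = lleg Q' \<cdot> w'"
      using span_map_reassoc(2)[OF p(1), of w] span_map_reassoc(1)[OF p'(1), of w'] by simp
    then have u [simp]: "into Q Q' w w' \<in> Ar C" "Dom C (into Q Q' w w') = Dom C b"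
      "Cod C (into Q Q' w w') = apex C (Q \<odot> Q')" "pr1 Q Q' \<cdot> into Q Q' w w' = w"
      "pr2 Q Q' \<cdot> into Q Q' w w' = w'"
      by simp_all
    show "\<exists>u. u \<in> Ar C \<and> Dom C u = Dom C a \<and> Cod C u = apex C ?R \<and> lleg ?R \<cdot> u = a \<and> rleg ?R \<cdot> u = b"
    proof (intro exI conjI)
      show "lleg ?R \<cdot> into Q Q' w w' = a"
        by (rule hspan_eqI[of X X']) (simp_all del: ab(4))
      show "rleg ?R \<cdot> into Q Q' w w' = b"
        by (rule hspan_eqI[of Y Y']) (simp_all del: ab(5))
    qed simp_all
  next
    fix u v assume "u \<in> Ar C" "v \<in> Ar C" "Dom C u = Dom C v" "Cod C u = apex C ?R" "Cod C v = apex C ?R"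
      and eq: "lleg ?R \<cdot> u = lleg ?R \<cdot> v" "rleg ?R \<cdot> u = rleg ?R \<cdot> v"
    then have [simp]: "u \<in> Ar C" "v \<in> Ar C" "Dom C u = Dom C v"
      "Cod C u = apex C (Q \<odot> Q')" "Cod C v = apex C (Q \<odot> Q')"
      by simp_all
    have 1: "lleg P \<cdot> (pr1 Q Q' \<cdot> u) = lleg P \<cdot> (pr1 Q Q' \<cdot> v)"
      "lleg P' \<cdot> (pr2 Q Q' \<cdot> u) = lleg P' \<cdot> (pr2 Q Q' \<cdot> v)"
      using arg_cong[OF eq(1), of "\<lambda>x. pr1 X X' \<cdot> x"] arg_cong[OF eq(1), of "\<lambda>x. pr2 X X' \<cdot> x"]
      by simp_all
    have 2: "rleg P \<cdot> (pr1 Q Q' \<cdot> u) = rleg P \<cdot> (pr1 Q Q' \<cdot> v)"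
      "rleg P' \<cdot> (pr2 Q Q' \<cdot> u) = rleg P' \<cdot> (pr2 Q Q' \<cdot> v)"
      using arg_cong[OF eq(2), of "\<lambda>x. pr1 Y Y' \<cdot> x"] arg_cong[OF eq(2), of "\<lambda>x. pr2 Y Y' \<cdot> x"]
      by simp_all
    have 3: "pr1 Q Q' \<cdot> u = pr1 Q Q' \<cdot> v"
      by (rule pullback_eqI[OF P]) (simp_all add: 1 2)
    have 4: "pr2 Q Q' \<cdot> u = pr2 Q Q' \<cdot> v"
      by (rule pullback_eqI[OF P']) (simp_all add: 1 2)
    show "u = v"
      by (rule hspan_eqI[of Q Q']) (simp_all add: 3 4)
  qed simp_all
qed

section \<open>Rebracketing of iterated pullbacks\<close>

definition assoc_map :: "'m span \<Rightarrow> 'm span \<Rightarrow> 'm span \<Rightarrow> 'm" where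
  "assoc_map S S' S'' = into (S \<odot> S') S''
     (into S S' (pr1 S (S' \<odot> S'')) (pr1 S' S'' \<cdot> pr2 S (S' \<odot> S'')))
     (pr2 S' S'' \<cdot> pr2 S (S' \<odot> S''))"

definition assoc_map_inv :: "'m span \<Rightarrow> 'm span \<Rightarrow> 'm span \<Rightarrow> 'm" where
  "assoc_map_inv S S' S'' = into S (S' \<odot> S'') (pr1 S S' \<cdot> pr1 (S \<odot> S') S'')
     (into S' S'' (pr2 S S' \<cdot> pr1 (S \<odot> S') S'') (pr2 (S \<odot> S') S''))"

context
  fixes S S' S'' :: "'m span"
  assumes wf: "wf_span S" "wf_span S'" "wf_span S''"
    "Cod C (rleg S) = Cod C (lleg S')" "Cod C (rleg S') = Cod C (lleg S'')"
begin

text \<open>Compatibility at the middle feet, restated with the legs of composites unfolded. The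
  left side of the second equation no longer matches \<open>pr_simps\<close> once
  \<open>legs_hspan\<close> has been applied.\<close>

lemma pr_eqs [simp]:
  "rleg S \<cdot> pr1 S (S' \<odot> S'') = lleg S' \<cdot> (pr1 S' S'' \<cdot> pr2 S (S' \<odot> S''))"
  "rleg S' \<cdot> (pr2 S S' \<cdot> pr1 (S \<odot> S') S'') = lleg S'' \<cdot> pr2 (S \<odot> S') S''"
  using wf pr_simps(7)[of S "S' \<odot> S''"] pr_simps(7)[of "S \<odot> S'" "S''"] by simp_all

lemma assoc_map_simps [simp]:
  "assoc_map S S' S'' \<in> Ar C" "Dom C (assoc_map S S' S'') = apex C (S \<odot> S' \<odot> S'')"
  "Cod C (assoc_map S S' S'') = apex C ((S \<odot> S') \<odot> S'')"
  "pr1 S S' \<cdot> (pr1 (S \<odot> S') S'' \<cdot> assoc_map S S' S'') = pr1 S (S' \<odot> S'')"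
  "pr2 S S' \<cdot> (pr1 (S \<odot> S') S'' \<cdot> assoc_map S S' S'') = pr1 S' S'' \<cdot> pr2 S (S' \<odot> S'')"
  "pr2 (S \<odot> S') S'' \<cdot> assoc_map S S' S'' = pr2 S' S'' \<cdot> pr2 S (S' \<odot> S'')"
  using wf by (simp_all add: assoc_map_def)

lemma assoc_map_inv_simps [simp]:
  "assoc_map_inv S S' S'' \<in> Ar C" "Dom C (assoc_map_inv S S' S'') = apex C ((S \<odot> S') \<odot> S'')"
  "Cod C (assoc_map_inv S S' S'') = apex C (S \<odot> S' \<odot> S'')"
  "pr1 S (S' \<odot> S'') \<cdot> assoc_map_inv S S' S'' = pr1 S S' \<cdot> pr1 (S \<odot> S') S''"
  "pr1 S' S'' \<cdot> (pr2 S (S' \<odot> S'') \<cdot> assoc_map_inv S S' S'') = pr2 S S' \<cdot> pr1 (S \<odot> S') S''"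
  "pr2 S' S'' \<cdot> (pr2 S (S' \<odot> S'') \<cdot> assoc_map_inv S S' S'') = pr2 (S \<odot> S') S''"
  using wf by (simp_all add: assoc_map_inv_def)

lemma assoc_map_reassoc [simp]:
  assumes x: "x \<in> Ar C" "Cod C x = apex C (S \<odot> S' \<odot> S'')"
  shows "pr1 S S' \<cdot> (pr1 (S \<odot> S') S'' \<cdot> (assoc_map S S' S'' \<cdot> x)) = pr1 S (S' \<odot> S'') \<cdot> x"
    "pr2 S S' \<cdot> (pr1 (S \<odot> S') S'' \<cdot> (assoc_map S S' S'' \<cdot> x)) = pr1 S' S'' \<cdot> (pr2 S (S' \<odot> S'') \<cdot> x)"
    "pr2 (S \<odot> S') S'' \<cdot> (assoc_map S S' S'' \<cdot> x) = pr2 S' S'' \<cdot> (pr2 S (S' \<odot> S'') \<cdot> x)"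
  using wf x assoc_map_simps(1-3) comp_reassoc[OF assoc_map_simps(4), of x]
    comp_reassoc[OF assoc_map_simps(5), of x] comp_reassoc[OF assoc_map_simps(6), of x]
  by simp_all

lemma assoc_map_inv_reassoc [simp]:
  assumes x: "x \<in> Ar C" "Cod C x = apex C ((S \<odot> S') \<odot> S'')"
  shows "pr1 S (S' \<odot> S'') \<cdot> (assoc_map_inv S S' S'' \<cdot> x) = pr1 S S' \<cdot> (pr1 (S \<odot> S') S'' \<cdot> x)"
    "pr1 S' S'' \<cdot> (pr2 S (S' \<odot> S'') \<cdot> (assoc_map_inv S S' S'' \<cdot> x)) = pr2 S S' \<cdot> (pr1 (S \<odot> S') S'' \<cdot> x)"
    "pr2 S' S'' \<cdot> (pr2 S (S' \<odot> S'') \<cdot> (assoc_map_inv S S' S'' \<cdot> x)) = pr2 (S \<odot> S') S'' \<cdot> x"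
  using wf x assoc_map_inv_simps(1-3) comp_reassoc[OF assoc_map_inv_simps(4), of x]
    comp_reassoc[OF assoc_map_inv_simps(5), of x] comp_reassoc[OF assoc_map_inv_simps(6), of x]
  by simp_all

text \<open>An arrow into an iterated pullback is determined by its components in \<open>S\<close>,
  \<open>S'\<close> and \<open>S''\<close>: joint monicity is used once for each level of
  nesting.\<close>

lemma hspan3_eqI_left:
  assumes "u \<in> Ar C" "v \<in> Ar C" "Dom C u = Dom C v" "Cod C u = apex C ((S \<odot> S') \<odot> S'')"
    "Cod C v = apex C ((S \<odot> S') \<odot> S'')"
    "pr1 S S' \<cdot> (pr1 (S \<odot> S') S'' \<cdot> u) = pr1 S S' \<cdot> (pr1 (S \<odot> S') S'' \<cdot> v)"
    "pr2 S S' \<cdot> (pr1 (S \<odot> S') S'' \<cdot> u) = pr2 S S' \<cdot> (pr1 (S \<odot> S') S'' \<cdot> v)"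
    "pr2 (S \<odot> S') S'' \<cdot> u = pr2 (S \<odot> S') S'' \<cdot> v"
  shows "u = v"
proof (rule hspan_eqI[of "S \<odot> S'" S''])
  show "pr1 (S \<odot> S') S'' \<cdot> u = pr1 (S \<odot> S') S'' \<cdot> v"
    by (rule hspan_eqI[of S S']) (use wf assms in simp_all)
qed (use wf assms in simp_all)

lemma hspan3_eqI_right:
  assumes "u \<in> Ar C" "v \<in> Ar C" "Dom C u = Dom C v" "Cod C u = apex C (S \<odot> S' \<odot> S'')"
    "Cod C v = apex C (S \<odot> S' \<odot> S'')"
    "pr1 S (S' \<odot> S'') \<cdot> u = pr1 S (S' \<odot> S'') \<cdot> v"
    "pr1 S' S'' \<cdot> (pr2 S (S' \<odot> S'') \<cdot> u) = pr1 S' S'' \<cdot> (pr2 S (S' \<odot> S'') \<cdot> v)"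
    "pr2 S' S'' \<cdot> (pr2 S (S' \<odot> S'') \<cdot> u) = pr2 S' S'' \<cdot> (pr2 S (S' \<odot> S'') \<cdot> v)"
  shows "u = v"
proof (rule hspan_eqI[of S "S' \<odot> S''"])
  show "pr2 S (S' \<odot> S'') \<cdot> u = pr2 S (S' \<odot> S'') \<cdot> v"
    by (rule hspan_eqI[of S' S'']) (use wf assms in simp_all)
qed (use wf assms in simp_all)

lemma assoc_map_iso: "is_iso C (assoc_map S S' S'')"
proof (rule is_isoI[of _ "assoc_map_inv S S' S''"])
  show "assoc_map_inv S S' S'' \<cdot> assoc_map S S' S'' = Id C (Dom C (assoc_map S S' S''))"
    by (rule hspan3_eqI_right) (use wf in simp_all)
  show "assoc_map S S' S'' \<cdot> assoc_map_inv S S' S'' = Id C (Cod C (assoc_map S S' S''))"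
    by (rule hspan3_eqI_left) (use wf in simp_all)
qed (use wf in simp_all)

lemma assoc_map_span_map: "span_map (S \<odot> S' \<odot> S'') ((S \<odot> S') \<odot> S'') (assoc_map S S' S'')"
  using wf by (simp add: span_map_def)

end

text \<open>On either side the three components are \<open>f\<close>, \<open>f'\<close> and
  \<open>f''\<close> after the corresponding projection.\<close>

lemma assoc_map_natural:
  assumes f: "span_map S T f" and f': "span_map S' T' f'" and f'': "span_map S'' T'' f''"
    and TT': "Cod C (rleg T) = Cod C (lleg T')" "Cod C (rleg T') = Cod C (lleg T'')"
  shows "assoc_map T T' T'' \<cdot> hcomp_map S (S' \<odot> S'') T (T' \<odot> T'') f (hcomp_map S' S'' T' T'' f' f'') =
    hcomp_map (S \<odot> S') S'' (T \<odot> T') T'' (hcomp_map S S' T T' f f') f'' \<cdot> assoc_map S S' S''"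
proof -
  note [simp] = f f' f'' TT' span_mapD(1-7)[OF f] span_mapD(1-7)[OF f'] span_mapD(1-7)[OF f'']
    hcomp_map_span_map[OF f f'] hcomp_map_span_map[OF f' f'']
  show ?thesis
    by (rule hspan3_eqI_left[of T T' T'']) simp_all
qed

text \<open>Rebracketing leaves the components in \<open>S\<close>, \<open>S'\<close>,
  \<open>S''\<close> and \<open>R\<close> unchanged, so both routes agree on all four
  projections.\<close>

lemma assoc_map_pentagon:
  assumes wf: "wf_span S" "wf_span S'" "wf_span S''" "wf_span R"
    "Cod C (rleg S) = Cod C (lleg S')" "Cod C (rleg S') = Cod C (lleg S'')"
    "Cod C (rleg S'') = Cod C (lleg R)"
  shows "assoc_map (S \<odot> S') S'' R \<cdot> assoc_map S S' (S'' \<odot> R) =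
    hcomp_map (S \<odot> S' \<odot> S'') R ((S \<odot> S') \<odot> S'') R (assoc_map S S' S'') (Id C (apex C R)) \<cdot>
    (assoc_map S (S' \<odot> S'') R \<cdot>
    hcomp_map S (S' \<odot> S'' \<odot> R) S ((S' \<odot> S'') \<odot> R) (Id C (apex C S)) (assoc_map S' S'' R))"
proof -
  note [simp] = wf assoc_map_span_map span_map_Id
  \<comment> \<open>\<open>hspan3_eqI_left\<close> separates only three factors and leaves
    \<open>S \<odot> S'\<close> in one piece; this splits it. It is stated for arbitrary
    \<open>u\<close> and \<open>v\<close> to keep the long composites out of the argument.\<close>
  have 1: "pr1 (S \<odot> S') S'' \<cdot> (pr1 ((S \<odot> S') \<odot> S'') R \<cdot> u) = pr1 (S \<odot> S') S'' \<cdot> (pr1 ((S \<odot> S') \<odot> S'') R \<cdot> v)"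
    if "u \<in> Ar C" "v \<in> Ar C" "Dom C u = Dom C v" "Cod C u = apex C (((S \<odot> S') \<odot> S'') \<odot> R)"
    "Cod C v = apex C (((S \<odot> S') \<odot> S'') \<odot> R)"
    "pr1 S S' \<cdot> (pr1 (S \<odot> S') S'' \<cdot> (pr1 ((S \<odot> S') \<odot> S'') R \<cdot> u)) =
     pr1 S S' \<cdot> (pr1 (S \<odot> S') S'' \<cdot> (pr1 ((S \<odot> S') \<odot> S'') R \<cdot> v))"
    "pr2 S S' \<cdot> (pr1 (S \<odot> S') S'' \<cdot> (pr1 ((S \<odot> S') \<odot> S'') R \<cdot> u)) =
     pr2 S S' \<cdot> (pr1 (S \<odot> S') S'' \<cdot> (pr1 ((S \<odot> S') \<odot> S'') R \<cdot> v))" for u v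
    by (rule hspan_eqI[of S S']) (use that in simp_all)
  show ?thesis
  proof (rule hspan3_eqI_left[of "S \<odot> S'" S'' R])
    show "pr1 (S \<odot> S') S'' \<cdot> (pr1 ((S \<odot> S') \<odot> S'') R \<cdot> (assoc_map (S \<odot> S') S'' R \<cdot> assoc_map S S' (S'' \<odot> R))) =
      pr1 (S \<odot> S') S'' \<cdot> (pr1 ((S \<odot> S') \<odot> S'') R \<cdot>
    (hcomp_map (S \<odot> S' \<odot> S'') R ((S \<odot> S') \<odot> S'') R (assoc_map S S' S'') (Id C (apex C R)) \<cdot>
    (assoc_map S (S' \<odot> S'') R \<cdot>
    hcomp_map S (S' \<odot> S'' \<odot> R) S ((S' \<odot> S'') \<odot> R) (Id C (apex C S)) (assoc_map S' S'' R))))"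
      by (rule 1) simp_all
  qed simp_all
qed

section \<open>Composition of cells\<close>

abbreviation cell :: "'m span \<Rightarrow> 'm span \<Rightarrow> 'm \<Rightarrow> 'm \<Rightarrow> 'm cell" where
  "cell S T x y \<equiv> cell_of C S T \<lparr>lleg = x, rleg = y\<rparr>"

lemma cell_sel [simp]:
  "src (cell S T x y) = S" "tgt (cell S T x y) = T"
  "cls (cell S T x y) = sos_class C S T \<lparr>lleg = x, rleg = y\<rparr>"
  by (simp_all add: cell_of_def)

lemma span_map_span_of_spans:
  assumes x: "span_map M S x" and y: "span_map M T y"
  shows "span_of_spans C S T \<lparr>lleg = x, rleg = y\<rparr>"
  using span_mapD[OF x] span_mapD[OF y] by (simp add: span_of_spans_def is_span_iff)

lemma span_of_spansE:
  assumes X: "span_of_spans C S T X" and [simp]: "wf_span S" "wf_span T"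
  obtains M where "span_map M S (lleg X)" "span_map M T (rleg X)"
proof
  let ?M = "\<lparr>lleg = lleg S \<cdot> lleg X, rleg = rleg S \<cdot> lleg X\<rparr>"
  have [simp]: "wf_span X" "Cod C (lleg X) = apex C S" "Cod C (rleg X) = apex C T"
    and eqs: "lleg S \<cdot> lleg X = lleg T \<cdot> rleg X" "rleg S \<cdot> lleg X = rleg T \<cdot> rleg X"
    using X by (auto simp: span_of_spans_def is_span_iff)
  show "span_map ?M S (lleg X)" "span_map ?M T (rleg X)"
    using eqs by (simp_all add: span_map_def)
qed

text \<open>Turns membership in a class into a parameter, an isomorphism \<open>v\<close> into the
  apex of a fixed representative. It points against the arrow in the definition of the class, whence
  the use of \<open>span_iso_sym\<close>.\<close>

lemma mem_sos_class:
  assumes x: "span_map M S x" and y: "span_map M T y"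
  shows "Z \<in> sos_class C S T \<lparr>lleg = x, rleg = y\<rparr> \<longleftrightarrow>
    (\<exists>v. v \<in> Ar C \<and> is_iso C v \<and> Cod C v = apex C M \<and> Z = \<lparr>lleg = x \<cdot> v, rleg = y \<cdot> v\<rparr>)"
proof
  note [simp] = span_mapD(1-7)[OF x] span_mapD(1-7)[OF y]
  assume "Z \<in> sos_class C S T \<lparr>lleg = x, rleg = y\<rparr>"
  then have "wf_span Z" "span_iso C \<lparr>lleg = x, rleg = y\<rparr> Z"
    by (auto simp: sos_class_def span_of_spans_def is_span_iff)
  from span_iso_sym[OF this(2,1)] obtain v where "v \<in> Ar C" "is_iso C v" "Cod C v = apex C M"
      "x \<cdot> v = lleg Z" "y \<cdot> v = rleg Z"
    by (auto simp: span_iso_def in_Hom)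
  then show "\<exists>v. v \<in> Ar C \<and> is_iso C v \<and> Cod C v = apex C M \<and> Z = \<lparr>lleg = x \<cdot> v, rleg = y \<cdot> v\<rparr>"
    by (intro exI[of _ v]) simp
next
  note [simp] = span_mapD(1-7)[OF x] span_mapD(1-7)[OF y]
  assume "\<exists>v. v \<in> Ar C \<and> is_iso C v \<and> Cod C v = apex C M \<and> Z = \<lparr>lleg = x \<cdot> v, rleg = y \<cdot> v\<rparr>"
  then obtain v where v [simp]: "v \<in> Ar C" "is_iso C v" "Cod C v = apex C M"
    and Z: "Z = \<lparr>lleg = x \<cdot> v, rleg = y \<cdot> v\<rparr>" by blast
  have "span_iso C Z \<lparr>lleg = x, rleg = y\<rparr>"
    unfolding span_iso_def by (rule bexI[of _ v]) (simp_all add: Z in_Hom)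
  then have "span_iso C \<lparr>lleg = x, rleg = y\<rparr> Z"
    by (rule span_iso_sym) simp
  moreover have "span_of_spans C S T Z"
    using span_map_reassoc[OF x, of v] span_map_reassoc[OF y, of v]
    by (simp add: Z span_of_spans_def is_span_iff)
  ultimately show "Z \<in> sos_class C S T \<lparr>lleg = x, rleg = y\<rparr>"
    by (simp add: sos_class_def)
qed

lemma cell_eqI:
  assumes x: "span_map M S x" and y: "span_map M T y"
    and u: "is_iso C u" "Cod C u = apex C M" "x' = x \<cdot> u" "y' = y \<cdot> u"
  shows "cell S T x' y' = cell S T x y"
proof -
  note [simp] = span_mapD(1-7)[OF x] span_mapD(1-7)[OF y] u
  have [simp]: "u \<in> Ar C"
    using u(1) by (simp add: is_iso_def)
  have 1: "span_iso C \<lparr>lleg = x', rleg = y'\<rparr> \<lparr>lleg = x, rleg = y\<rparr>"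
    unfolding span_iso_def by (rule bexI[of _ u]) (simp_all add: in_Hom)
  have 2: "span_iso C \<lparr>lleg = x, rleg = y\<rparr> \<lparr>lleg = x', rleg = y'\<rparr>"
    using 1 by (rule span_iso_sym) simp
  have "span_iso C \<lparr>lleg = x', rleg = y'\<rparr> Z \<longleftrightarrow> span_iso C \<lparr>lleg = x, rleg = y\<rparr> Z"
    if "span_of_spans C S T Z" for Z
  proof -
    have "wf_span Z"
      using that by (simp add: span_of_spans_def is_span_iff)
    then show ?thesis
      using span_iso_trans[OF 1, of Z] span_iso_trans[OF 2, of Z] by blast
  qed
  then show ?thesis
    by (auto simp: cell_of_def sos_class_def)
qed

text \<open>Compares the pullback of modified representatives with that of the original pair:
  composed with \<open>a\<close> and \<open>b\<close>, the former becomes a pullback of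
  \<open>y\<close> and \<open>z\<close>, and uniqueness of pullbacks yields
  \<open>v\<close>.\<close>

lemma pullback_twist:
  assumes P: "is_pullback C y z P" and P': "is_pullback C (y \<cdot> a) (z \<cdot> b) P'"
    and ab: "is_iso C a" "is_iso C b" "Cod C a = Dom C y" "Cod C b = Dom C z"
  obtains v where "v \<in> Ar C" "is_iso C v" "Cod C v = apex C P" "Dom C v = apex C P'"
    "lleg P \<cdot> v = a \<cdot> lleg P'" "rleg P \<cdot> v = b \<cdot> rleg P'"
proof -
  have [simp]: "a \<in> Ar C" "b \<in> Ar C"
    using ab by (simp_all add: is_iso_def)
  note [simp] = pullbackD(1-6)[OF P] ab
  note [simp] = pullbackD(1-6)[OF P']
  have "is_pullback C y z \<lparr>lleg = a \<cdot> lleg P', rleg = b \<cdot> rleg P'\<rparr>"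
    by (rule pullback_comp_isos[OF P']) simp_all
  from pullback_unique[OF this P] show thesis
    using that by (auto simp: span_iso_def in_Hom)
qed

text \<open>Lets the pullback absorb an isomorphism, so that representatives can stay fixed.\<close>

lemma pullback_shift:
  assumes P: "is_pullback C y z P" and v: "is_iso C v" "Cod C v = apex C P"
  shows "is_pullback C y z \<lparr>lleg = lleg P \<cdot> v, rleg = rleg P \<cdot> v\<rparr>"
proof -
  note [simp] = pullbackD(1-6)[OF P] v
  have [simp]: "v \<in> Ar C"
    using v(1) by (simp add: is_iso_def)
  have "span_iso C \<lparr>lleg = lleg P \<cdot> v, rleg = rleg P \<cdot> v\<rparr> P"
    unfolding span_iso_def by (rule bexI[of _ v]) (simp_all add: in_Hom)
  from span_iso_sym[OF this] show ?thesis
    by (intro pullback_span_iso[OF P]) simp_all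
qed

text \<open>Well-definedness of vertical composition: one pair of representatives and one pullback,
  however chosen, compute the whole class. Other choices differ by the isomorphism of
  \<open>pullback_twist\<close>; conversely, each member of the class arises from the same
  representatives with \<open>P\<close> moved along an isomorphism.\<close>

lemma vcomp_cell:
  assumes x: "span_map M S x" and y: "span_map M T y" and z: "span_map N T z" and w: "span_map N U w"
    and P: "is_pullback C y z P"
  shows "vcomp C (cell T U z w) (cell S T x y) = cell S U (x \<cdot> lleg P) (w \<cdot> rleg P)"
proof -
  note [simp] = span_mapD(1-7)[OF x] span_mapD(1-7)[OF y] span_mapD(1-7)[OF z] span_mapD(1-7)[OF w]
    pullbackD(1-6)[OF P]
  \<comment> \<open>With \<open>Q\<close> the apex of \<open>P\<close> becomes a span and the
    composite legs become span maps out of it, so that \<open>mem_sos_class\<close> describes the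
    right-hand side.\<close>
  obtain Q where Q: "span_map Q M (lleg P)" "span_map Q N (rleg P)" "apex C Q = apex C P"
    using pullback_apex_span_map[OF y z P] by blast
  have "{\<lparr>lleg = lleg X \<cdot> lleg P', rleg = rleg Y \<cdot> rleg P'\<rparr> | X Y P'.
       X \<in> sos_class C S T \<lparr>lleg = x, rleg = y\<rparr> \<and> Y \<in> sos_class C T U \<lparr>lleg = z, rleg = w\<rparr> \<and>
       is_pullback C (rleg X) (lleg Y) P'} =
     sos_class C S U \<lparr>lleg = x \<cdot> lleg P, rleg = w \<cdot> rleg P\<rparr>" (is "?L = ?R")
  proof (intro subset_antisym subsetI)
    fix Z assume "Z \<in> ?L"
    then obtain X Y P' where Z: "Z = \<lparr>lleg = lleg X \<cdot> lleg P', rleg = rleg Y \<cdot> rleg P'\<rparr>"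
      and X: "X \<in> sos_class C S T \<lparr>lleg = x, rleg = y\<rparr>"
      and Y: "Y \<in> sos_class C T U \<lparr>lleg = z, rleg = w\<rparr>"
      and P': "is_pullback C (rleg X) (lleg Y) P'" by blast
    obtain a where a [simp]: "a \<in> Ar C" "is_iso C a" "Cod C a = apex C M"
      and Xa: "X = \<lparr>lleg = x \<cdot> a, rleg = y \<cdot> a\<rparr>"
      using X unfolding mem_sos_class[OF x y] by blast
    obtain b where b [simp]: "b \<in> Ar C" "is_iso C b" "Cod C b = apex C N"
      and Yb: "Y = \<lparr>lleg = z \<cdot> b, rleg = w \<cdot> b\<rparr>"
      using Y unfolding mem_sos_class[OF z w] by blast
    have P'ab: "is_pullback C (y \<cdot> a) (z \<cdot> b) P'"
      using P' by (simp add: Xa Yb)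
    note [simp] = pullbackD(1-6)[OF P'ab]
    obtain v where v: "v \<in> Ar C" "is_iso C v" "Cod C v = apex C P" "Dom C v = apex C P'"
      "lleg P \<cdot> v = a \<cdot> lleg P'" "rleg P \<cdot> v = b \<cdot> rleg P'"
      by (rule pullback_twist[OF P P'ab]) simp_all
    show "Z \<in> ?R"
      unfolding mem_sos_class[OF span_map_comp[OF Q(1) x] span_map_comp[OF Q(2) w]]
      using v by (intro exI[of _ v]) (simp add: Z Xa Yb Q(3))
  next
    fix Z assume "Z \<in> ?R"
    then obtain v where [simp]: "v \<in> Ar C" "is_iso C v" "Cod C v = apex C P"
      and Z: "Z = \<lparr>lleg = (x \<cdot> lleg P) \<cdot> v, rleg = (w \<cdot> rleg P) \<cdot> v\<rparr>"
      unfolding mem_sos_class[OF span_map_comp[OF Q(1) x] span_map_comp[OF Q(2) w]] Q(3) by blast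
    have "\<lparr>lleg = x, rleg = y\<rparr> \<in> sos_class C S T \<lparr>lleg = x, rleg = y\<rparr>"
      unfolding mem_sos_class[OF x y] by (intro exI[of _ "Id C (apex C M)"]) (simp add: Id_iso)
    moreover have "\<lparr>lleg = z, rleg = w\<rparr> \<in> sos_class C T U \<lparr>lleg = z, rleg = w\<rparr>"
      unfolding mem_sos_class[OF z w] by (intro exI[of _ "Id C (apex C N)"]) (simp add: Id_iso)
    moreover have "is_pullback C y z \<lparr>lleg = lleg P \<cdot> v, rleg = rleg P \<cdot> v\<rparr>"
      by (rule pullback_shift[OF P]) simp_all
    ultimately show "Z \<in> ?L"
      by (intro CollectI exI[of _ "\<lparr>lleg = x, rleg = y\<rparr>"] exI[of _ "\<lparr>lleg = z, rleg = w\<rparr>"]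
        exI[of _ "\<lparr>lleg = lleg P \<cdot> v, rleg = rleg P \<cdot> v\<rparr>"]) (simp add: Z)
  qed
  then show ?thesis
    by (simp add: vcomp_def)
qed

text \<open>\<open>hcomp\<close> takes pullbacks over \<open>rleg S \<cdot> x\<close> and
  \<open>lleg S' \<cdot> x'\<close>, which are the legs of \<open>M\<close> and \<open>M'\<close> at
  the middle foot. So the selected pullback behind \<open>M \<odot> M'\<close> is admissible, and it
  induces exactly the maps \<open>hcomp_map\<close>.\<close>

lemma hcomp_cell:
  assumes x: "span_map M S x" and y: "span_map M T y" and x': "span_map M' S' x'" and y': "span_map M' T' y'"
    and TT': "Cod C (rleg T) = Cod C (lleg T')"
  shows "hcomp C pb (cell S T x y) (cell S' T' x' y') =
    cell (S \<odot> S') (T \<odot> T') (hcomp_map M M' S S' x x') (hcomp_map M M' T T' y y')"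
proof -
  note [simp] = x y x' y' span_mapD(1-5)[OF x] span_mapD(1-5)[OF y] span_mapD(1-5)[OF x'] span_mapD(1-5)[OF y']
  have [simp]: "Cod C (lleg M) = Cod C (lleg S)" "Cod C (lleg T) = Cod C (lleg S)"
    "Cod C (lleg M') = Cod C (rleg S)" "Cod C (lleg T') = Cod C (rleg S)"
    "Cod C (rleg M) = Cod C (rleg S)" "Cod C (rleg T) = Cod C (rleg S)" "Cod C (lleg S') = Cod C (rleg S)"
    using span_mapD(6-7)[OF x] span_mapD(6-7)[OF y] span_mapD(6-7)[OF x'] span_mapD(6-7)[OF y'] TT' by simp_all
  have hx: "span_map (M \<odot> M') (S \<odot> S') (hcomp_map M M' S S' x x')"
    by (rule hcomp_map_span_map) simp_all
  have hy: "span_map (M \<odot> M') (T \<odot> T') (hcomp_map M M' T T' y y')"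
    by (rule hcomp_map_span_map) simp_all
  let ?P = "pb (rleg M) (lleg M')"
  have P: "is_pullback C (rleg M) (lleg M') ?P"
    by (rule pb_is_pullback) simp_all
  have [simp]: "lleg ?P = pr1 M M'" "rleg ?P = pr2 M M'" "apex C ?P = apex C (M \<odot> M')"
    by (simp_all add: pr1_def pr2_def apex_hspan)
  \<comment> \<open>Needed at the source and at the target of the cells, hence the spans and maps
    are bound afresh here.\<close>
  have into_hcomp_map: "into S S' (x \<cdot> (pr1 M M' \<cdot> v)) (x' \<cdot> (pr2 M M' \<cdot> v)) = hcomp_map M M' S S' x x' \<cdot> v"
    if x: "span_map M S x" and x': "span_map M' S' x'" and v: "v \<in> Ar C" "Cod C v = apex C (M \<odot> M')"
      and c: "Cod C (rleg S) = Cod C (lleg S')"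
    for S S' x x' v
  proof -
    note [simp] = x x' v c span_mapD(1-7)[OF x] span_mapD(1-7)[OF x']
    have [simp]: "rleg S \<cdot> (x \<cdot> (pr1 M M' \<cdot> v)) = lleg S' \<cdot> (x' \<cdot> (pr2 M M' \<cdot> v))"
      using span_map_reassoc(2)[OF x, of "pr1 M M' \<cdot> v"] span_map_reassoc(1)[OF x', of "pr2 M M' \<cdot> v"] by simp
    show ?thesis
      by (rule hspan_eqI[of S S']) simp_all
  qed
  have "{\<lparr>lleg = into S S' (lleg X \<cdot> lleg P') (lleg X' \<cdot> rleg P'),
          rleg = into T T' (rleg X \<cdot> lleg P') (rleg X' \<cdot> rleg P')\<rparr> | X X' P'.
       X \<in> sos_class C S T \<lparr>lleg = x, rleg = y\<rparr> \<and> X' \<in> sos_class C S' T' \<lparr>lleg = x', rleg = y'\<rparr> \<and>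
       is_pullback C (rleg S \<cdot> lleg X) (lleg S' \<cdot> lleg X') P'} =
     sos_class C (S \<odot> S') (T \<odot> T') \<lparr>lleg = hcomp_map M M' S S' x x', rleg = hcomp_map M M' T T' y y'\<rparr>"
    (is "?L = ?R")
  proof (intro subset_antisym subsetI)
    fix Z assume "Z \<in> ?L"
    then obtain X X' P' where Z: "Z = \<lparr>lleg = into S S' (lleg X \<cdot> lleg P') (lleg X' \<cdot> rleg P'),
          rleg = into T T' (rleg X \<cdot> lleg P') (rleg X' \<cdot> rleg P')\<rparr>"
      and X: "X \<in> sos_class C S T \<lparr>lleg = x, rleg = y\<rparr>"
      and X': "X' \<in> sos_class C S' T' \<lparr>lleg = x', rleg = y'\<rparr>"
      and P': "is_pullback C (rleg S \<cdot> lleg X) (lleg S' \<cdot> lleg X') P'" by blast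
    obtain a where a [simp]: "a \<in> Ar C" "is_iso C a" "Cod C a = apex C M"
      and Xa: "X = \<lparr>lleg = x \<cdot> a, rleg = y \<cdot> a\<rparr>"
      using X unfolding mem_sos_class[OF x y] by blast
    obtain b where b [simp]: "b \<in> Ar C" "is_iso C b" "Cod C b = apex C M'"
      and Xb: "X' = \<lparr>lleg = x' \<cdot> b, rleg = y' \<cdot> b\<rparr>"
      using X' unfolding mem_sos_class[OF x' y'] by blast
    \<comment> \<open>Since \<open>x\<close> and \<open>x'\<close> commute with the legs, the cospan
      is one over \<open>M\<close> and \<open>M'\<close>, twisted by \<open>a\<close> and
      \<open>b\<close>.\<close>
    have P'ab: "is_pullback C (rleg M \<cdot> a) (lleg M' \<cdot> b) P'"
      using P' span_map_reassoc(2)[OF x, of a] span_map_reassoc(1)[OF x', of b] by (simp add: Xa Xb)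
    note [simp] = pullbackD(1-6)[OF P'ab]
    obtain v where v: "v \<in> Ar C" "is_iso C v" "Cod C v = apex C ?P" "Dom C v = apex C P'"
      "lleg ?P \<cdot> v = a \<cdot> lleg P'" "rleg ?P \<cdot> v = b \<cdot> rleg P'"
      by (rule pullback_twist[OF P P'ab]) simp_all
    then show "Z \<in> ?R"
      unfolding mem_sos_class[OF hx hy]
      using into_hcomp_map[OF x x', of v] into_hcomp_map[OF y y', of v]
      by (intro exI[of _ v]) (simp add: Z Xa Xb)
  next
    fix Z assume "Z \<in> ?R"
    then obtain v where [simp]: "v \<in> Ar C" "is_iso C v" "Cod C v = apex C (M \<odot> M')"
      and Z: "Z = \<lparr>lleg = hcomp_map M M' S S' x x' \<cdot> v, rleg = hcomp_map M M' T T' y y' \<cdot> v\<rparr>"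
      unfolding mem_sos_class[OF hx hy] by blast
    have "\<lparr>lleg = x, rleg = y\<rparr> \<in> sos_class C S T \<lparr>lleg = x, rleg = y\<rparr>"
      unfolding mem_sos_class[OF x y] by (intro exI[of _ "Id C (apex C M)"]) (simp add: Id_iso)
    moreover have "\<lparr>lleg = x', rleg = y'\<rparr> \<in> sos_class C S' T' \<lparr>lleg = x', rleg = y'\<rparr>"
      unfolding mem_sos_class[OF x' y'] by (intro exI[of _ "Id C (apex C M')"]) (simp add: Id_iso)
    moreover have "is_pullback C (rleg S \<cdot> x) (lleg S' \<cdot> x') \<lparr>lleg = lleg ?P \<cdot> v, rleg = rleg ?P \<cdot> v\<rparr>"
      unfolding span_mapD(9)[OF x] span_mapD(8)[OF x'] by (rule pullback_shift[OF P]) simp_all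
    ultimately show "Z \<in> ?L"
      using into_hcomp_map[OF x x', of v] into_hcomp_map[OF y y', of v]
      by (intro CollectI exI[of _ "\<lparr>lleg = x, rleg = y\<rparr>"] exI[of _ "\<lparr>lleg = x', rleg = y'\<rparr>"]
        exI[of _ "\<lparr>lleg = lleg ?P \<cdot> v, rleg = rleg ?P \<cdot> v\<rparr>"]) (simp add: Z)
  qed
  then show ?thesis
    by (simp add: hcomp_def)
qed

section \<open>Graphs of maps\<close>

abbreviation graph :: "'m span \<Rightarrow> 'm span \<Rightarrow> 'm \<Rightarrow> 'm cell" where
  "graph S T f \<equiv> cell S T (Id C (apex C S)) f"

lemma id_cell_graph: "id_cell C S = graph S S (Id C (apex C S))"
  by (simp add: id_cell_def id_span_def)

text \<open>The left leg of a graph is an identity, so the pullback in the composite can be taken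
  along an identity.\<close>

lemma graph_comp:
  assumes f: "span_map S T f" and g: "span_map T U g"
  shows "vcomp C (graph T U g) (graph S T f) = graph S U (g \<cdot> f)"
proof -
  note [simp] = span_mapD(1-5)[OF f] span_mapD(1-5)[OF g]
  show ?thesis
    using vcomp_cell[OF span_map_Id f span_map_Id g pullback_Id_right] by simp
qed

lemma hcomp_graph:
  assumes f: "span_map S T f" and f': "span_map S' T' f'" and TT': "Cod C (rleg T) = Cod C (lleg T')"
  shows "hcomp C pb (graph S T f) (graph S' T' f') = graph (S \<odot> S') (T \<odot> T') (hcomp_map S S' T T' f f')"
  using hcomp_cell[OF span_map_Id f span_map_Id f' TT'] TT' span_mapD(1-7)[OF f] span_mapD(1-7)[OF f'] hcomp_map_Id[of S S']
  by simp

text \<open>The pullback of \<open>\<phi>\<close> along \<open>x'\<close> is given by the parallel isomorphism \<open>u\<close>; this reduces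
  naturality of cells to that of ordinary maps of spans.\<close>

lemma vcomp_graph_square:
  assumes x: "span_map M S x" and y: "span_map M T y" and x': "span_map N S' x'" and y': "span_map N T' y'"
    and \<phi>: "span_map S S' \<phi>" "is_iso C \<phi>" and \<psi>: "span_map T T' \<psi>"
    and u: "span_map M N u" "is_iso C u" "x' \<cdot> u = \<phi> \<cdot> x" "y' \<cdot> u = \<psi> \<cdot> y"
  shows "vcomp C (cell S' T' x' y') (graph S S' \<phi>) = vcomp C (graph T T' \<psi>) (cell S T x y)"
proof -
  note [simp] = span_mapD(1-5)[OF x] span_mapD(1-5)[OF y] span_mapD(1-5)[OF x'] span_mapD(1-5)[OF y']
    span_mapD(1-5)[OF \<phi>(1)] span_mapD(1-5)[OF \<psi>] span_mapD(1-5)[OF u(1)]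
  have "is_pullback C \<phi> x' \<lparr>lleg = x, rleg = u\<rparr>"
    using \<phi> u by (intro pullback_of_isos) simp_all
  from vcomp_cell[OF span_map_Id \<phi>(1) x' y' this] vcomp_cell[OF x y span_map_Id \<psi> pullback_Id_right]
  show ?thesis
    by (simp add: u)
qed

section \<open>Associator and unitors\<close>

lemma is_zigzag_cone_iff:
  assumes "wf_span S" "wf_span S'" "wf_span S''"
  shows "is_zigzag_cone C (rleg S) (lleg S') (rleg S') (lleg S'') (p, p', p'') \<longleftrightarrow>
    p \<in> Ar C \<and> p' \<in> Ar C \<and> p'' \<in> Ar C \<and> Dom C p' = Dom C p \<and> Dom C p'' = Dom C p \<and>
    Cod C p = apex C S \<and> Cod C p' = apex C S' \<and> Cod C p'' = apex C S'' \<and>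
    rleg S \<cdot> p = lleg S' \<cdot> p' \<and> rleg S' \<cdot> p' = lleg S'' \<cdot> p''"
  using assms by (auto simp: is_zigzag_cone_def in_Hom)

context
  fixes S S' S'' :: "'m span"
  assumes wf: "wf_span S" "wf_span S'" "wf_span S''"
    "Cod C (rleg S) = Cod C (lleg S')" "Cod C (rleg S') = Cod C (lleg S'')"
begin

abbreviation "cone p p' p'' \<equiv> is_zigzag_cone C (rleg S) (lleg S') (rleg S') (lleg S'') (p, p', p'')"

text \<open>The comparison arrow from the vertex of a cone into the iterated pullback. For a limit
  cone it is the left leg of the associator.\<close>

lemma cone_into:
  assumes "cone p p' p''"
  defines "u \<equiv> into S (S' \<odot> S'') p (into S' S'' p' p'')"
  shows "u \<in> Ar C" "Dom C u = Dom C p" "Cod C u = apex C (S \<odot> S' \<odot> S'')"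
    "pr1 S (S' \<odot> S'') \<cdot> u = p" "pr1 S' S'' \<cdot> (pr2 S (S' \<odot> S'') \<cdot> u) = p'"
    "pr2 S' S'' \<cdot> (pr2 S (S' \<odot> S'') \<cdot> u) = p''"
  using assms(1) wf unfolding is_zigzag_cone_iff[OF wf(1-3)] u_def by simp_all

text \<open>Both legs of the associator come from one cone. Comparing components shows that the
  right leg is the left leg followed by \<open>assoc_map\<close>, which is the shape of the members
  of the class of a graph.\<close>

lemma cone_assoc_map:
  assumes "cone p p' p''"
  shows "into (S \<odot> S') S'' (into S S' p p') p'' =
    assoc_map S S' S'' \<cdot> into S (S' \<odot> S'') p (into S' S'' p' p'')"
proof (rule hspan3_eqI_left[OF wf])
  note [simp] = wf
  have c: "p \<in> Ar C" "p' \<in> Ar C" "p'' \<in> Ar C" "Dom C p' = Dom C p" "Dom C p'' = Dom C p"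
    "Cod C p = apex C S" "Cod C p' = apex C S'" "Cod C p'' = apex C S''"
    "rleg S \<cdot> p = lleg S' \<cdot> p'" "rleg S' \<cdot> p' = lleg S'' \<cdot> p''"
    using assms unfolding is_zigzag_cone_iff[OF wf(1-3)] by blast+
  note [simp] = c assoc_map_simps[OF wf] assoc_map_reassoc[OF wf]
  show "into (S \<odot> S') S'' (into S S' p p') p'' \<in> Ar C"
    "assoc_map S S' S'' \<cdot> into S (S' \<odot> S'') p (into S' S'' p' p'') \<in> Ar C"
    "Dom C (into (S \<odot> S') S'' (into S S' p p') p'') =
      Dom C (assoc_map S S' S'' \<cdot> into S (S' \<odot> S'') p (into S' S'' p' p''))"
    "Cod C (into (S \<odot> S') S'' (into S S' p p') p'') = apex C ((S \<odot> S') \<odot> S'')"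
    "Cod C (assoc_map S S' S'' \<cdot> into S (S' \<odot> S'') p (into S' S'' p' p'')) = apex C ((S \<odot> S') \<odot> S'')"
    "pr1 S S' \<cdot> pr1 (S \<odot> S') S'' \<cdot> into (S \<odot> S') S'' (into S S' p p') p'' =
     pr1 S S' \<cdot> pr1 (S \<odot> S') S'' \<cdot> assoc_map S S' S'' \<cdot> into S (S' \<odot> S'') p (into S' S'' p' p'')"
    "pr2 S S' \<cdot> pr1 (S \<odot> S') S'' \<cdot> into (S \<odot> S') S'' (into S S' p p') p'' =
     pr2 S S' \<cdot> pr1 (S \<odot> S') S'' \<cdot> assoc_map S S' S'' \<cdot> into S (S' \<odot> S'') p (into S' S'' p' p'')"
    "pr2 (S \<odot> S') S'' \<cdot> into (S \<odot> S') S'' (into S S' p p') p'' =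
     pr2 (S \<odot> S') S'' \<cdot> assoc_map S S' S'' \<cdot> into S (S' \<odot> S'') p (into S' S'' p' p'')"
    by simp_all
qed

text \<open>The projections of the iterated pullback form a cone too, so the limit gives an arrow
  \<open>w\<close> back. One composite is an identity by joint monicity of these projections, the
  other by uniqueness for the limit.\<close>

lemma zigzag_limit_into_iso:
  assumes "is_zigzag_limit C (rleg S) (lleg S') (rleg S') (lleg S'') (p, p', p'')"
  shows "is_iso C (into S (S' \<odot> S'') p (into S' S'' p' p''))"
proof -
  note [simp] = wf
  have cone: "cone p p' p''"
    and lim: "\<And>q q' q''. cone q q' q'' \<Longrightarrow> \<exists>!u. u \<in> Hom C (Dom C q) (Dom C p) \<and>
        p \<cdot> u = q \<and> p' \<cdot> u = q' \<and> p'' \<cdot> u = q''"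
    using assms unfolding is_zigzag_limit_def by auto
  have c [simp]: "p \<in> Ar C" "p' \<in> Ar C" "p'' \<in> Ar C" "Dom C p' = Dom C p" "Dom C p'' = Dom C p"
    "Cod C p = apex C S" "Cod C p' = apex C S'" "Cod C p'' = apex C S''"
    using cone unfolding is_zigzag_cone_iff[OF wf(1-3)] by blast+
  define u where "u = into S (S' \<odot> S'') p (into S' S'' p' p'')"
  note u [simp] = cone_into[OF cone, folded u_def]
  let ?E = "S \<odot> S' \<odot> S''"
  have "cone (pr1 S (S' \<odot> S'')) (pr1 S' S'' \<cdot> pr2 S (S' \<odot> S'')) (pr2 S' S'' \<cdot> pr2 S (S' \<odot> S''))"
    unfolding is_zigzag_cone_iff[OF wf(1-3)] using pr_eqs(1)[OF wf] by simp
  from lim[OF this] obtain w where w [simp]: "w \<in> Ar C" "Dom C w = apex C ?E" "Cod C w = Dom C p"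
    "p \<cdot> w = pr1 S (S' \<odot> S'')" "p' \<cdot> w = pr1 S' S'' \<cdot> pr2 S (S' \<odot> S'')"
    "p'' \<cdot> w = pr2 S' S'' \<cdot> pr2 S (S' \<odot> S'')"
    by (auto simp: in_Hom)
  have [simp]: "pr1 S (S' \<odot> S'') \<cdot> (u \<cdot> w) = p \<cdot> w" "pr1 S' S'' \<cdot> (pr2 S (S' \<odot> S'') \<cdot> (u \<cdot> w)) = p' \<cdot> w"
    "pr2 S' S'' \<cdot> (pr2 S (S' \<odot> S'') \<cdot> (u \<cdot> w)) = p'' \<cdot> w"
    using comp_reassoc[OF u(4), of w] comp_reassoc[OF u(5), of w] comp_reassoc[OF u(6), of w] by simp_all
  have "u \<cdot> w = Id C (apex C ?E)"
    by (rule hspan3_eqI_right[OF wf]) simp_all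
  moreover have "w \<cdot> u = Id C (Dom C p)"
  proof -
    have "w \<cdot> u \<in> Hom C (Dom C p) (Dom C p) \<and> p \<cdot> (w \<cdot> u) = p \<and> p' \<cdot> (w \<cdot> u) = p' \<and> p'' \<cdot> (w \<cdot> u) = p''"
      using comp_reassoc[OF w(4), of u] comp_reassoc[OF w(5), of u] comp_reassoc[OF w(6), of u]
      by (simp add: in_Hom)
    moreover have "Id C (Dom C p) \<in> Hom C (Dom C p) (Dom C p) \<and> p \<cdot> Id C (Dom C p) = p \<and>
        p' \<cdot> Id C (Dom C p) = p' \<and> p'' \<cdot> Id C (Dom C p) = p''"
      by (simp add: in_Hom)
    ultimately show ?thesis
      using lim[OF cone] by blast
  qed
  ultimately have "is_iso C u"
    by (intro is_isoI[of u w]) simp_all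
  then show ?thesis
    by (simp only: u_def)
qed

text \<open>The converse, needed because the set in \<open>span_assoc\<close> must be a full
  isomorphism class and not merely lie inside one. Lifts are those into the iterated pullback,
  carried along the inverse of \<open>v\<close>.\<close>

lemma iso_zigzag_limit:
  assumes v: "is_iso C v" "Cod C v = apex C (S \<odot> S' \<odot> S'')"
  shows "is_zigzag_limit C (rleg S) (lleg S') (rleg S') (lleg S'')
    (pr1 S (S' \<odot> S'') \<cdot> v, pr1 S' S'' \<cdot> (pr2 S (S' \<odot> S'') \<cdot> v), pr2 S' S'' \<cdot> (pr2 S (S' \<odot> S'') \<cdot> v))"
    (is "is_zigzag_limit _ _ _ _ _ (?p, ?p', ?p'')")
proof -
  note [simp] = wf v(2)
  obtain v' where v' [simp]: "v \<in> Ar C" "v' \<in> Ar C" "Dom C v' = Cod C v" "Cod C v' = Dom C v"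
    "v' \<cdot> v = Id C (Dom C v)" "v \<cdot> v' = Id C (Cod C v)" "is_iso C v'"
    using v(1) by (rule is_isoE)
  have "cone ?p ?p' ?p''"
    unfolding is_zigzag_cone_iff[OF wf(1-3)]
    using pr_reassoc[of S "S' \<odot> S''" v] by simp
  moreover have "\<exists>!u. u \<in> Hom C (Dom C q) (Dom C ?p) \<and> ?p \<cdot> u = q \<and> ?p' \<cdot> u = q' \<and> ?p'' \<cdot> u = q''"
    if q: "cone q q' q''" for q q' q''
  proof
    define u where "u = into S (S' \<odot> S'') q (into S' S'' q' q'')"
    note u [simp] = cone_into[OF q, folded u_def]
    have "v \<cdot> (v' \<cdot> u) = u"
      using comp_reassoc[OF v'(6), of u] by simp
    then show "v' \<cdot> u \<in> Hom C (Dom C q) (Dom C ?p) \<and> ?p \<cdot> (v' \<cdot> u) = q \<and>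
        ?p' \<cdot> (v' \<cdot> u) = q' \<and> ?p'' \<cdot> (v' \<cdot> u) = q''"
      by (simp add: in_Hom)
    fix w assume w: "w \<in> Hom C (Dom C q) (Dom C ?p) \<and> ?p \<cdot> w = q \<and> ?p' \<cdot> w = q' \<and> ?p'' \<cdot> w = q''"
    then have [simp]: "w \<in> Ar C" "Dom C w = Dom C q" "Cod C w = Dom C v"
      by (simp_all add: in_Hom)
    have "v \<cdot> w = u"
      by (rule hspan3_eqI_right[OF wf]) (use w in simp_all)
    then show "w = v' \<cdot> u"
      using comp_reassoc[OF v'(5), of w] by simp
  qed
  ultimately show ?thesis
    by (simp add: is_zigzag_limit_def)
qed

lemma span_assoc_graph:
  "span_assoc C pb S S' S'' = graph (S \<odot> S' \<odot> S'') ((S \<odot> S') \<odot> S'') (assoc_map S S' S'')"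
proof -
  note [simp] = wf
  let ?E = "S \<odot> S' \<odot> S''"
  note mem = mem_sos_class[OF span_map_Id assoc_map_span_map[OF wf]]
  have "{\<lparr>lleg = into S (S' \<odot> S'') p (into S' S'' p' p''),
          rleg = into (S \<odot> S') S'' (into S S' p p') p''\<rparr> | p p' p''.
       is_zigzag_limit C (rleg S) (lleg S') (rleg S') (lleg S'') (p, p', p'')} =
    sos_class C ?E ((S \<odot> S') \<odot> S'') \<lparr>lleg = Id C (apex C ?E), rleg = assoc_map S S' S''\<rparr>" (is "?L = ?R")
  proof (intro subset_antisym subsetI)
    fix Z assume "Z \<in> ?L"
    then obtain p p' p'' where Z: "Z = \<lparr>lleg = into S (S' \<odot> S'') p (into S' S'' p' p''),
          rleg = into (S \<odot> S') S'' (into S S' p p') p''\<rparr>"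
      and lim: "is_zigzag_limit C (rleg S) (lleg S') (rleg S') (lleg S'') (p, p', p'')" by blast
    have cone: "cone p p' p''"
      using lim by (simp add: is_zigzag_limit_def)
    show "Z \<in> ?R"
      using cone_into[OF cone] zigzag_limit_into_iso[OF lim] cone_assoc_map[OF cone]
      by (subst mem, simp) (intro exI[of _ "into S (S' \<odot> S'') p (into S' S'' p' p'')"], simp add: Z)
  next
    fix Z assume "Z \<in> ?R"
    then have "\<exists>v. v \<in> Ar C \<and> is_iso C v \<and> Cod C v = apex C ?E \<and>
        Z = \<lparr>lleg = Id C (apex C ?E) \<cdot> v, rleg = assoc_map S S' S'' \<cdot> v\<rparr>"
      by (subst (asm) mem) simp_all
    then obtain v where v [simp]: "v \<in> Ar C" "is_iso C v" "Cod C v = apex C ?E"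
      and Z: "Z = \<lparr>lleg = v, rleg = assoc_map S S' S'' \<cdot> v\<rparr>"
      by auto
    let ?p = "pr1 S (S' \<odot> S'') \<cdot> v" and ?p' = "pr1 S' S'' \<cdot> (pr2 S (S' \<odot> S'') \<cdot> v)"
      and ?p'' = "pr2 S' S'' \<cdot> (pr2 S (S' \<odot> S'') \<cdot> v)"
    have lim: "is_zigzag_limit C (rleg S) (lleg S') (rleg S') (lleg S'') (?p, ?p', ?p'')"
      by (rule iso_zigzag_limit) simp_all
    then have cone: "cone ?p ?p' ?p''"
      by (simp add: is_zigzag_limit_def)
    \<comment> \<open>The cone consists of the projections composed with \<open>v\<close>, so its
      comparison arrow is \<open>v\<close> again.\<close>
    have "into S (S' \<odot> S'') ?p (into S' S'' ?p' ?p'') = v"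
      by (rule hspan3_eqI_right[OF wf]) (use cone_into[OF cone] in simp_all)
    with lim cone_assoc_map[OF cone] show "Z \<in> ?L"
      by (intro CollectI exI[of _ ?p] exI[of _ ?p'] exI[of _ ?p'']) (simp add: Z)
  qed
  then show ?thesis
    by (simp add: span_assoc_def cell_of_def)
qed

end

section \<open>Unitors\<close>

lemma id_span_simps [simp]:
  assumes "A \<in> Ob C"
  shows "lleg (id_span C A) = Id C A" "rleg (id_span C A) = Id C A" "apex C (id_span C A) = A"
    "wf_span (id_span C A)"
  using assms by (simp_all add: id_span_def)

text \<open>The projection \<open>pr2\<close> is inverse to the canonical arrow \<open>?u\<close>.
  The unitor is represented by \<open>?u\<close> and an identity, the graph by an identity and
  \<open>pr2\<close>; precomposing the latter pair with \<open>?u\<close> gives the former.\<close>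

lemma id_span_left:
  assumes S [simp]: "wf_span S" and A [simp]: "Cod C (lleg S) = A"
  shows "is_iso C (pr2 (id_span C A) S)" "span_map (id_span C A \<odot> S) S (pr2 (id_span C A) S)"
    "span_runit C pb A S = graph (id_span C A \<odot> S) S (pr2 (id_span C A) S)"
proof -
  let ?I = "id_span C A" and ?p = "pr2 (id_span C A) S"
  have [simp]: "A \<in> Ob C"
    using Cod_in_Ob[of "lleg S"] by simp
  let ?u = "into ?I S (lleg S) (Id C (apex C S))"
  have p: "?p \<in> Ar C" "Dom C ?p = apex C (?I \<odot> S)" "Cod C ?p = apex C S" "pr1 ?I S = lleg S \<cdot> ?p"
    using pr_simps[of ?I S] by simp_all
  have u: "?u \<in> Ar C" "Dom C ?u = apex C S" "Cod C ?u = apex C (?I \<odot> S)"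
    "pr1 ?I S \<cdot> ?u = lleg S" "?p \<cdot> ?u = Id C (apex C S)"
    by simp_all
  have pr1: "pr1 ?I S \<in> Ar C" "Dom C (pr1 ?I S) = apex C (?I \<odot> S)" "Cod C (pr1 ?I S) = A"
    using pr_simps[of ?I S] by simp_all
  \<comment> \<open>On the first projection this uses that \<open>pr1 ?I S\<close> is
    \<open>lleg S \<cdot> ?p\<close>, which is commutativity of a pullback square over an
    identity.\<close>
  have up: "?u \<cdot> ?p = Id C (apex C (?I \<odot> S))"
    by (rule hspan_eqI[of ?I S]) (use p pr1 in simp_all)
  show "is_iso C ?p"
    using p u up by (intro is_isoI[of ?p ?u]) simp_all
  have u_iso: "is_iso C ?u"
    using p u up by (intro is_isoI[of ?u ?p]) simp_all
  show sp: "span_map (?I \<odot> S) S ?p"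
    using p pr1 by (simp add: span_map_def)
  show "span_runit C pb A S = graph (?I \<odot> S) S ?p"
    unfolding span_runit_def
    by (rule cell_eqI[OF span_map_Id sp u_iso]) (use u in simp_all)
qed

lemma id_span_right:
  assumes S [simp]: "wf_span S" and B [simp]: "Cod C (rleg S) = B"
  shows "is_iso C (pr1 S (id_span C B))" "span_map (S \<odot> id_span C B) S (pr1 S (id_span C B))"
    "span_lunit C pb B S = graph (S \<odot> id_span C B) S (pr1 S (id_span C B))"
proof -
  let ?I = "id_span C B" and ?p = "pr1 S (id_span C B)"
  have [simp]: "B \<in> Ob C"
    using Cod_in_Ob[of "rleg S"] by simp
  let ?u = "into S ?I (Id C (apex C S)) (rleg S)"
  have p: "?p \<in> Ar C" "Dom C ?p = apex C (S \<odot> ?I)" "Cod C ?p = apex C S" "pr2 S ?I = rleg S \<cdot> ?p"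
    using pr_simps[of S ?I] by simp_all
  have u: "?u \<in> Ar C" "Dom C ?u = apex C S" "Cod C ?u = apex C (S \<odot> ?I)"
    "pr2 S ?I \<cdot> ?u = rleg S" "?p \<cdot> ?u = Id C (apex C S)"
    by simp_all
  have pr2: "pr2 S ?I \<in> Ar C" "Dom C (pr2 S ?I) = apex C (S \<odot> ?I)" "Cod C (pr2 S ?I) = B"
    using pr_simps[of S ?I] by simp_all
  have up: "?u \<cdot> ?p = Id C (apex C (S \<odot> ?I))"
    by (rule hspan_eqI[of S ?I]) (use p pr2 in simp_all)
  show "is_iso C ?p"
    using p u up by (intro is_isoI[of ?p ?u]) simp_all
  have u_iso: "is_iso C ?u"
    using p u up by (intro is_isoI[of ?u ?p]) simp_all
  show sp: "span_map (S \<odot> ?I) S ?p"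
    using p pr2 by (simp add: span_map_def)
  show "span_lunit C pb B S = graph (S \<odot> ?I) S ?p"
    unfolding span_lunit_def
    by (rule cell_eqI[OF span_map_Id sp u_iso]) (use u in simp_all)
qed

text \<open>Dropping the middle factor, before or after rebracketing, leaves the components in
  \<open>S\<close> and \<open>S'\<close>, and these determine the arrow.\<close>

lemma hcomp_map_triangle:
  assumes wf: "wf_span S" "wf_span S'" "Cod C (rleg S) = B" "Cod C (lleg S') = B"
  shows "hcomp_map (S \<odot> id_span C B) S' S S' (pr1 S (id_span C B)) (Id C (apex C S')) \<cdot>
      assoc_map S (id_span C B) S' =
    hcomp_map S (id_span C B \<odot> S') S S' (Id C (apex C S)) (pr2 (id_span C B) S')"
proof -
  note [simp] = wf
  have [simp]: "B \<in> Ob C"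
    using Cod_in_Ob[of "rleg S"] by simp
  note [simp] = id_span_left(2)[of S' B] id_span_right(2)[of S B] span_map_Id
  show ?thesis
    by (rule hspan_eqI[of S S']) simp_all
qed

section \<open>The bicategory of spans\<close>

lemma Span_simps [simp]:
  "Dom (Span C A B) = src" "Cod (Span C A B) = tgt" "Id (Span C A B) = id_cell C"
  "Comp (Span C A B) = vcomp C" "S \<in> Ob (Span C A B) \<longleftrightarrow> is_span C A B S"
  by (simp_all add: Span_def)

text \<open>The target inherits its feet from the source by way of \<open>M\<close>, because span
  maps preserve the codomains of the legs.\<close>

lemma Hom_Span_iff:
  "\<xi> \<in> Hom (Span C A B) S T \<longleftrightarrow> is_span C A B S \<and>
    (\<exists>M x y. span_map M S x \<and> span_map M T y \<and> \<xi> = cell S T x y)"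
proof
  assume "\<xi> \<in> Hom (Span C A B) S T"
  then obtain X where ST: "is_span C A B S" "is_span C A B T" and X: "span_of_spans C S T X"
    and \<xi>: "\<xi> = cell_of C S T X"
    by (auto simp: Hom_def Span_def cell_of_def)
  obtain M where "span_map M S (lleg X)" "span_map M T (rleg X)"
    using span_of_spansE[OF X] ST by (auto simp: is_span_iff)
  moreover have "X = \<lparr>lleg = lleg X, rleg = rleg X\<rparr>"
    by simp
  ultimately show "is_span C A B S \<and> (\<exists>M x y. span_map M S x \<and> span_map M T y \<and> \<xi> = cell S T x y)"
    using ST \<xi> by metis
next
  assume "is_span C A B S \<and> (\<exists>M x y. span_map M S x \<and> span_map M T y \<and> \<xi> = cell S T x y)"
  then obtain M x y where S: "is_span C A B S" and xy: "span_map M S x" "span_map M T y"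
    and \<xi>: "\<xi> = cell S T x y" by blast
  have "is_span C A B T"
    using S span_mapD[OF xy(1)] span_mapD[OF xy(2)] by (simp add: is_span_iff)
  with S xy show "\<xi> \<in> Hom (Span C A B) S T"
    using span_map_span_of_spans[OF xy] by (auto simp: Hom_def Span_def \<xi>)
qed

lemma Hom_SpanE:
  assumes "\<xi> \<in> Hom (Span C A B) S T"
  obtains M x y where "span_map M S x" "span_map M T y" "\<xi> = cell S T x y"
    "wf_span S" "wf_span T" "Cod C (lleg S) = A" "Cod C (rleg S) = B"
    "Cod C (lleg T) = A" "Cod C (rleg T) = B" "Cod C (lleg M) = A" "Cod C (rleg M) = B"
proof -
  obtain M x y where *: "is_span C A B S" "span_map M S x" "span_map M T y" "\<xi> = cell S T x y"
    using assms unfolding Hom_Span_iff by blast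
  show thesis
    using that[OF *(2-4)] *(1) span_mapD[OF *(2)] span_mapD[OF *(3)] by (simp add: is_span_iff)
qed

lemma pullback_of_span_maps:
  assumes f: "span_map S T f" and g: "span_map S' T g"
  obtains P Q where "is_pullback C f g P" "span_map Q S (lleg P)" "span_map Q S' (rleg P)" "apex C Q = apex C P"
proof -
  have "is_pullback C f g (pb f g)"
    using pullback_choice span_mapD[OF f] span_mapD[OF g] by (simp add: pullback_choice_def)
  from that[OF this pullback_apex_span_map[OF f g this]] show thesis .
qed

lemma Span_category: "category (Span C A B)"
proof
  fix \<xi> assume "\<xi> \<in> Ar (Span C A B)"
  then show "Dom (Span C A B) \<xi> \<in> Ob (Span C A B)" "Cod (Span C A B) \<xi> \<in> Ob (Span C A B)"
    by (auto simp: Span_def cell_of_def)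
next
  fix S assume "S \<in> Ob (Span C A B)"
  then show "Id (Span C A B) S \<in> Hom (Span C A B) S S"
    unfolding Hom_Span_iff using span_map_Id[of S] by (auto simp: id_cell_graph is_span_iff)
next
  fix S T U \<xi> \<eta> assume \<xi>: "\<xi> \<in> Hom (Span C A B) S T" and \<eta>: "\<eta> \<in> Hom (Span C A B) T U"
  obtain M x y where xy: "span_map M S x" "span_map M T y" "\<xi> = cell S T x y"
    using \<xi> by (rule Hom_SpanE)
  obtain N z w where zw: "span_map N T z" "span_map N U w" "\<eta> = cell T U z w"
    using \<eta> by (rule Hom_SpanE)
  obtain P Q where P: "is_pullback C y z P" "span_map Q M (lleg P)" "span_map Q N (rleg P)"
    using xy(2) zw(1) by (rule pullback_of_span_maps)
  show "Comp (Span C A B) \<eta> \<xi> \<in> Hom (Span C A B) S U"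
    unfolding Hom_Span_iff
    using \<xi> span_map_comp[OF P(2) xy(1)] span_map_comp[OF P(3) zw(2)] vcomp_cell[OF xy(1,2) zw(1,2) P(1)]
    by (auto simp: xy(3) zw(3) Hom_Span_iff)
next
  fix S T \<xi> assume "\<xi> \<in> Hom (Span C A B) S T"
  then obtain M x y where xy: "span_map M S x" "span_map M T y" "\<xi> = cell S T x y"
    by (rule Hom_SpanE)
  note [simp] = span_mapD(1-5)[OF xy(1)] span_mapD(1-5)[OF xy(2)]
  show "Comp (Span C A B) \<xi> (Id (Span C A B) S) = \<xi>"
    using vcomp_cell[OF span_map_Id span_map_Id xy(1,2) pullback_Id_left] by (simp add: id_cell_graph xy(3))
  show "Comp (Span C A B) (Id (Span C A B) T) \<xi> = \<xi>"
    using vcomp_cell[OF xy(1,2) span_map_Id span_map_Id pullback_Id_right] by (simp add: id_cell_graph xy(3))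
next
  fix S T U V \<xi> \<eta> \<zeta> assume "\<xi> \<in> Hom (Span C A B) S T" "\<eta> \<in> Hom (Span C A B) T U"
    "\<zeta> \<in> Hom (Span C A B) U V"
  obtain M x y where xy: "span_map M S x" "span_map M T y" "\<xi> = cell S T x y"
    using \<open>\<xi> \<in> _\<close> by (rule Hom_SpanE)
  obtain N z w where zw: "span_map N T z" "span_map N U w" "\<eta> = cell T U z w"
    using \<open>\<eta> \<in> _\<close> by (rule Hom_SpanE)
  obtain K s t where st: "span_map K U s" "span_map K V t" "\<zeta> = cell U V s t"
    using \<open>\<zeta> \<in> _\<close> by (rule Hom_SpanE)
  obtain P Q where P: "is_pullback C y z P" "span_map Q M (lleg P)" "span_map Q N (rleg P)"
    using xy(2) zw(1) by (rule pullback_of_span_maps)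
  obtain P' Q' where P': "is_pullback C w s P'" "span_map Q' N (lleg P')" "span_map Q' K (rleg P')"
    using zw(2) st(1) by (rule pullback_of_span_maps)
  \<comment> \<open>\<open>R\<close> is the pullback over \<open>N\<close> of the pullbacks for the
    two adjacent pairs. Pasted with \<open>P'\<close> or with \<open>P\<close> it gives the pullback
    for either bracketing, so both triple composites get the same apex and legs.\<close>
  obtain R L where R: "is_pullback C (rleg P) (lleg P') R" "span_map L Q (lleg R)" "span_map L Q' (rleg R)"
    using P(3) P'(2) by (rule pullback_of_span_maps)
  note [simp] = span_mapD(1-5)[OF xy(1)] span_mapD(1-5)[OF xy(2)] span_mapD(1-5)[OF zw(1)] span_mapD(1-5)[OF zw(2)]
    span_mapD(1-5)[OF st(1)] span_mapD(1-5)[OF st(2)]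
    pullbackD(1-6)[OF P(1)] pullbackD(1-6)[OF P'(1)] pullbackD(1-6)[OF R(1)]
  show "Comp (Span C A B) \<zeta> (Comp (Span C A B) \<eta> \<xi>) = Comp (Span C A B) (Comp (Span C A B) \<zeta> \<eta>) \<xi>"
    using vcomp_cell[OF xy(1,2) zw(1,2) P(1)] vcomp_cell[OF zw(1,2) st(1,2) P'(1)]
      vcomp_cell[OF span_map_comp[OF P(2) xy(1)] span_map_comp[OF P(3) zw(2)] st(1,2) pullback_paste[OF P'(1) R(1)]]
      vcomp_cell[OF xy(1,2) span_map_comp[OF P'(2) zw(1)] span_map_comp[OF P'(3) st(2)] pullback_paste'[OF P(1) R(1)]]
    by (simp add: xy(3) zw(3) st(3))
qed

lemma graph_Hom: "span_map S T f \<Longrightarrow> is_span C A B S \<Longrightarrow> graph S T f \<in> Hom (Span C A B) S T"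
  unfolding Hom_Span_iff using span_map_Id[of S] by (auto simp: is_span_iff)

lemma span_map_inverse:
  assumes f: "span_map S T f" and g: "g \<in> Ar C" "Dom C g = Cod C f" "Cod C g = Dom C f"
    "f \<cdot> g = Id C (Cod C f)"
  shows "span_map T S g"
  using span_mapD(1-5)[OF f] span_map_reassoc[OF f, of g] g by (simp add: span_map_def)

text \<open>Graphs compose like their maps, so the graph of the inverse arrow is the inverse
  cell.\<close>

lemma graph_is_iso:
  assumes f: "span_map S T f" "is_iso C f" and S: "is_span C A B S"
  shows "is_iso (Span C A B) (graph S T f)"
proof -
  obtain g where g: "g \<in> Ar C" "Dom C g = Cod C f" "Cod C g = Dom C f"
    "g \<cdot> f = Id C (Dom C f)" "f \<cdot> g = Id C (Cod C f)"
    using f(2) by (rule is_isoE)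
  have sg: "span_map T S g"
    using span_map_inverse[OF f(1) g(1-3,5)] .
  have "is_span C A B T"
    using S span_mapD[OF f(1)] by (simp add: is_span_iff)
  then show ?thesis
    using graph_Hom[OF f(1) S] graph_Hom[OF sg] graph_comp[OF f(1) sg] graph_comp[OF sg f(1)]
      span_mapD(1-5)[OF f(1)]
    unfolding is_iso_def Span_simps cell_sel
    by (intro conjI bexI[of _ "graph T S g"]) (auto simp: g id_cell_graph Hom_def)
qed

section \<open>Functoriality of horizontal composition and of the identities\<close>

lemma hcomp_functor:
  "is_functor (prod_cat (Span C A B) (Span C B D)) (Span C A D)
    \<lparr>FOb = (\<lambda>(S, S'). S \<odot> S'), FAr = (\<lambda>(\<xi>, \<xi>'). hcomp C pb \<xi> \<xi>')\<rparr>"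
proof (rule is_functor.intro[OF prod_category[OF Span_category Span_category] Span_category],
    unfold_locales, goal_cases)
  case (1 a)
  then show ?case
    by (cases a) (auto simp: prod_cat_def is_span_iff)
next
  case (2 \<Phi> a b)
  obtain S S' T T' \<xi> \<xi>' where eq: "a = (S, S')" "b = (T, T')" "\<Phi> = (\<xi>, \<xi>')"
    by (cases a, cases b, cases \<Phi>)
  with 2 have \<xi>: "\<xi> \<in> Hom (Span C A B) S T" and \<xi>': "\<xi>' \<in> Hom (Span C B D) S' T'"
    by (simp_all add: Hom_prod_iff)
  obtain M x y where xy [simp]: "span_map M S x" "span_map M T y" "\<xi> = cell S T x y"
    "wf_span S" "wf_span T" "Cod C (lleg S) = A" "Cod C (rleg S) = B"
    "Cod C (lleg T) = A" "Cod C (rleg T) = B"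
    using \<xi> by (rule Hom_SpanE)
  obtain M' x' y' where xy' [simp]: "span_map M' S' x'" "span_map M' T' y'" "\<xi>' = cell S' T' x' y'"
    "wf_span S'" "wf_span T'" "Cod C (lleg S') = B" "Cod C (rleg S') = D"
    "Cod C (lleg T') = B" "Cod C (rleg T') = D"
    using \<xi>' by (rule Hom_SpanE)
  have "hcomp C pb \<xi> \<xi>' = cell (S \<odot> S') (T \<odot> T') (hcomp_map M M' S S' x x') (hcomp_map M M' T T' y y')"
    unfolding xy(3) xy'(3) by (rule hcomp_cell) simp_all
  moreover have "span_map (M \<odot> M') (S \<odot> S') (hcomp_map M M' S S' x x')" "span_map (M \<odot> M') (T \<odot> T') (hcomp_map M M' T T' y y')"
    by (rule hcomp_map_span_map; simp)+
  moreover have "is_span C A D (S \<odot> S')"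
    by (simp add: is_span_iff)
  ultimately show ?case
    unfolding eq Hom_Span_iff by auto
next
  case (3 a)
  then obtain S S' where a: "a = (S, S')" "is_span C A B S" "is_span C B D S'"
    by (cases a) (auto simp: prod_cat_def)
  then show ?case
    using hcomp_graph[OF span_map_Id span_map_Id, of S S'] hcomp_map_Id[of S S']
    by (simp add: prod_cat_def id_cell_graph is_span_iff)
next
  case (4 \<Phi> a b \<Psi> c)
  obtain S S' T T' U U' \<xi> \<xi>' \<eta> \<eta>' where eq: "a = (S, S')" "b = (T, T')" "c = (U, U')"
    "\<Phi> = (\<xi>, \<xi>')" "\<Psi> = (\<eta>, \<eta>')"
    by (cases a, cases b, cases c, cases \<Phi>, cases \<Psi>)
  with 4 have \<xi>: "\<xi> \<in> Hom (Span C A B) S T" and \<xi>': "\<xi>' \<in> Hom (Span C B D) S' T'"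
    and \<eta>: "\<eta> \<in> Hom (Span C A B) T U" and \<eta>': "\<eta>' \<in> Hom (Span C B D) T' U'"
    by (simp_all add: Hom_prod_iff)
  obtain M x y where xy: "span_map M S x" "span_map M T y" "\<xi> = cell S T x y"
    and S: "wf_span S" "Cod C (rleg S) = B" "wf_span T" "Cod C (rleg T) = B"
    using \<xi> by (rule Hom_SpanE)
  obtain M' x' y' where xy': "span_map M' S' x'" "span_map M' T' y'" "\<xi>' = cell S' T' x' y'"
    and S': "wf_span S'" "Cod C (lleg S') = B" "wf_span T'" "Cod C (lleg T') = B"
    using \<xi>' by (rule Hom_SpanE)
  obtain N z w where zw: "span_map N T z" "span_map N U w" "\<eta> = cell T U z w"
    and U: "wf_span U" "Cod C (rleg U) = B"
    using \<eta> by (rule Hom_SpanE)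
  obtain N' z' w' where zw': "span_map N' T' z'" "span_map N' U' w'" "\<eta>' = cell T' U' z' w'"
    and U': "wf_span U'" "Cod C (lleg U') = B"
    using \<eta>' by (rule Hom_SpanE)
  obtain P Q where P: "is_pullback C y z P" "span_map Q M (lleg P)" "span_map Q N (rleg P)"
    using xy(2) zw(1) by (rule pullback_of_span_maps)
  obtain P' Q' where P': "is_pullback C y' z' P'" "span_map Q' M' (lleg P')" "span_map Q' N' (rleg P')"
    using xy'(2) zw'(1) by (rule pullback_of_span_maps)
  have c: "Cod C (rleg S) = Cod C (lleg S')" "Cod C (rleg T) = Cod C (lleg T')"
    "Cod C (rleg U) = Cod C (lleg U')"
    using S S' U U' by simp_all
  have cM: "Cod C (rleg M) = Cod C (lleg M')" "Cod C (rleg N) = Cod C (lleg N')"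
    using c span_mapD(6,7)[OF xy(1)] span_mapD(6,7)[OF xy'(1)] span_mapD(6,7)[OF zw(1)] span_mapD(6,7)[OF zw'(1)] by simp_all
  have "hcomp C pb (vcomp C \<eta> \<xi>) (vcomp C \<eta>' \<xi>') =
    cell (S \<odot> S') (U \<odot> U') (hcomp_map Q Q' S S' (x \<cdot> lleg P) (x' \<cdot> lleg P')) (hcomp_map Q Q' U U' (w \<cdot> rleg P) (w' \<cdot> rleg P'))"
    unfolding xy(3) xy'(3) zw(3) zw'(3) vcomp_cell[OF xy(1,2) zw(1,2) P(1)]
      vcomp_cell[OF xy'(1,2) zw'(1,2) P'(1)]
    by (rule hcomp_cell[OF span_map_comp[OF P(2) xy(1)] span_map_comp[OF P(3) zw(2)]
      span_map_comp[OF P'(2) xy'(1)] span_map_comp[OF P'(3) zw'(2)] c(3)])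
  \<comment> \<open>For the other order of composition \<open>vcomp_cell\<close> is applied to the
    pullback supplied by \<open>hcomp_map_pullback\<close>, whose apex is that of
    \<open>Q \<odot> Q'\<close>; functoriality of \<open>hcomp_map\<close> then makes the legs
    agree.\<close>
  also have "\<dots> = vcomp C (hcomp C pb \<eta> \<eta>') (hcomp C pb \<xi> \<xi>')"
    unfolding xy(3) xy'(3) zw(3) zw'(3) hcomp_cell[OF xy(1,2) xy'(1,2) c(2)]
      hcomp_cell[OF zw(1,2) zw'(1,2) c(3)]
      vcomp_cell[OF hcomp_map_span_map[OF xy(1) xy'(1) c(1)] hcomp_map_span_map[OF xy(2) xy'(2) c(2)]
        hcomp_map_span_map[OF zw(1) zw'(1) c(2)] hcomp_map_span_map[OF zw(2) zw'(2) c(3)]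
        hcomp_map_pullback[OF xy(2) zw(1) P(1) xy'(2) zw'(1) P'(1) P(2,3) P'(2,3) c(2)]]
    by (simp add: hcomp_map_comp[OF P(2) xy(1) P'(2) xy'(1) c(1)] hcomp_map_comp[OF P(3) zw(2) P'(3) zw'(2) c(3)])
  finally show ?case
    by (simp add: eq prod_cat_def)
qed

lemma IdF_functor:
  assumes "A \<in> Ob C"
  shows "is_functor one_cat (Span C A A)
    \<lparr>FOb = (\<lambda>_. id_span C A), FAr = (\<lambda>_. id_cell C (id_span C A))\<rparr>"
proof (rule is_functor.intro[OF one_category Span_category], unfold_locales, goal_cases)
  case 1
  then show ?case using assms by (simp add: is_span_iff)
next
  case 2
  then show ?case
    using assms category.Id_in_Hom[OF Span_category, of "id_span C A" A A] by (simp add: is_span_iff)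
next
  case 4
  then show ?case
    using assms category.Id_in_Hom[OF Span_category, of "id_span C A" A A]
      category.Comp_Id_left[OF Span_category, of "id_cell C (id_span C A)" A A] by (simp add: is_span_iff)
qed simp

lemma Span2_simps [simp]:
  "Obj (Span2 C pb) = Ob C" "HomCat (Span2 C pb) = Span C"
  "IdF (Span2 C pb) = (\<lambda>A. \<lparr>FOb = (\<lambda>_. id_span C A), FAr = (\<lambda>_. id_cell C (id_span C A))\<rparr>)"
  "HComp (Span2 C pb) = (\<lambda>_ _ _. \<lparr>FOb = (\<lambda>(S, S'). S \<odot> S'), FAr = (\<lambda>(\<xi>, \<xi>'). hcomp C pb \<xi> \<xi>')\<rparr>)"
  "Assoc (Span2 C pb) = (\<lambda>_ _ _ _ (S, S', S''). span_assoc C pb S S' S'')"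
  "RUnit (Span2 C pb) = (\<lambda>A _. span_runit C pb A)"
  "LUnit (Span2 C pb) = (\<lambda>_ B. span_lunit C pb B)"
  by (simp_all add: Span2_def)

section \<open>Naturality of the associator and the unitors\<close>

lemma Assoc_natural:
  "natural_iso (prod_cat (Span C A B) (prod_cat (Span C B D) (Span C D E))) (Span C A E)
    (comp_right_nested (Span2 C pb) A B D E) (comp_left_nested (Span2 C pb) A B D E)
    (Assoc (Span2 C pb) A B D E)"
proof (rule natural_iso.intro)
  show "is_functor (prod_cat (Span C A B) (prod_cat (Span C B D) (Span C D E))) (Span C A E)
    (comp_right_nested (Span2 C pb) A B D E)"
    using functor_right_nested[OF Span_category Span_category Span_category hcomp_functor[of A B E] hcomp_functor[of B D E]]
    by (simp add: comp_right_nested_def)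
  show "is_functor (prod_cat (Span C A B) (prod_cat (Span C B D) (Span C D E))) (Span C A E)
    (comp_left_nested (Span2 C pb) A B D E)"
    using functor_left_nested[OF Span_category Span_category Span_category hcomp_functor[of A D E] hcomp_functor[of A B D]]
    by (simp add: comp_left_nested_def)
  show "natural_iso_axioms (prod_cat (Span C A B) (prod_cat (Span C B D) (Span C D E))) (Span C A E)
    (comp_right_nested (Span2 C pb) A B D E) (comp_left_nested (Span2 C pb) A B D E)
    (Assoc (Span2 C pb) A B D E)"
  proof
    fix a assume "a \<in> Ob (prod_cat (Span C A B) (prod_cat (Span C B D) (Span C D E)))"
    then obtain S S' S'' where a: "a = (S, S', S'')"
      and [simp]: "wf_span S" "wf_span S'" "wf_span S''" "Cod C (lleg S) = A"
      "Cod C (rleg S) = B" "Cod C (lleg S') = B" "Cod C (rleg S') = D" "Cod C (lleg S'') = D"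
      "Cod C (rleg S'') = E"
      by (cases a) (auto simp: prod_cat_def is_span_iff)
    have *: "span_map (S \<odot> S' \<odot> S'') ((S \<odot> S') \<odot> S'') (assoc_map S S' S'')" "is_span C A E (S \<odot> S' \<odot> S'')"
      "is_iso C (assoc_map S S' S'')"
      by (simp_all add: assoc_map_span_map is_span_iff assoc_map_iso)
    show "Assoc (Span2 C pb) A B D E a \<in> Hom (Span C A E)
        (FOb (comp_right_nested (Span2 C pb) A B D E) a) (FOb (comp_left_nested (Span2 C pb) A B D E) a)"
      using graph_Hom[OF *(1,2)]
      by (simp add: a span_assoc_graph comp_right_nested_def comp_left_nested_def)
    show "is_iso (Span C A E) (Assoc (Span2 C pb) A B D E a)"
      using graph_is_iso[OF *(1,3,2)] by (simp add: a span_assoc_graph)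
  next
    fix \<Phi> a b assume \<Phi>: "\<Phi> \<in> Hom (prod_cat (Span C A B) (prod_cat (Span C B D) (Span C D E))) a b"
    obtain S S' S'' T T' T'' \<xi> \<xi>' \<xi>'' where eq: "a = (S, S', S'')" "b = (T, T', T'')" "\<Phi> = (\<xi>, \<xi>', \<xi>'')"
      by (metis prod_cases3)
    with \<Phi> have \<xi>: "\<xi> \<in> Hom (Span C A B) S T" and \<xi>': "\<xi>' \<in> Hom (Span C B D) S' T'"
      and \<xi>'': "\<xi>'' \<in> Hom (Span C D E) S'' T''"
      by (simp_all add: Hom_prod_iff)
    obtain M x y where x: "span_map M S x" and y: "span_map M T y" and "\<xi> = cell S T x y"
      and [simp]: "wf_span S" "wf_span T" "Cod C (rleg S) = B" "Cod C (rleg T) = B" "Cod C (rleg M) = B"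
      using \<xi> by (rule Hom_SpanE)
    obtain M' x' y' where x': "span_map M' S' x'" and y': "span_map M' T' y'" and "\<xi>' = cell S' T' x' y'"
      and [simp]: "wf_span S'" "wf_span T'" "Cod C (lleg S') = B" "Cod C (rleg S') = D"
      "Cod C (lleg T') = B" "Cod C (rleg T') = D" "Cod C (lleg M') = B" "Cod C (rleg M') = D"
      using \<xi>' by (rule Hom_SpanE)
    obtain M'' x'' y'' where x'': "span_map M'' S'' x''" and y'': "span_map M'' T'' y''" and "\<xi>'' = cell S'' T'' x'' y''"
      and [simp]: "wf_span S''" "wf_span T''" "Cod C (lleg S'') = D" "Cod C (lleg T'') = D" "Cod C (lleg M'') = D"
      using \<xi>'' by (rule Hom_SpanE)
    note cells = \<open>\<xi> = _\<close> \<open>\<xi>' = _\<close> \<open>\<xi>'' = _\<close>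
    note [simp] = x y x' y' x'' y'' span_mapD(1)[OF x] span_mapD(1)[OF x'] span_mapD(1)[OF x'']
    have h: "span_map (M \<odot> M') (S \<odot> S') (hcomp_map M M' S S' x x')" "span_map (M \<odot> M') (T \<odot> T') (hcomp_map M M' T T' y y')"
      "span_map (M' \<odot> M'') (S' \<odot> S'') (hcomp_map M' M'' S' S'' x' x'')"
      "span_map (M' \<odot> M'') (T' \<odot> T'') (hcomp_map M' M'' T' T'' y' y'')"
      by (rule hcomp_map_span_map; simp)+
    have right: "hcomp C pb \<xi> (hcomp C pb \<xi>' \<xi>'') = cell (S \<odot> S' \<odot> S'') (T \<odot> T' \<odot> T'')
        (hcomp_map M (M' \<odot> M'') S (S' \<odot> S'') x (hcomp_map M' M'' S' S'' x' x''))
        (hcomp_map M (M' \<odot> M'') T (T' \<odot> T'') y (hcomp_map M' M'' T' T'' y' y''))"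
      unfolding cells by (subst hcomp_cell[OF x' y' x'' y''], simp, rule hcomp_cell[OF x y h(3,4)], simp)
    have left: "hcomp C pb (hcomp C pb \<xi> \<xi>') \<xi>'' = cell ((S \<odot> S') \<odot> S'') ((T \<odot> T') \<odot> T'')
        (hcomp_map (M \<odot> M') M'' (S \<odot> S') S'' (hcomp_map M M' S S' x x') x'')
        (hcomp_map (M \<odot> M') M'' (T \<odot> T') T'' (hcomp_map M M' T T' y y') y'')"
      unfolding cells by (subst hcomp_cell[OF x y x' y'], simp, rule hcomp_cell[OF h(1,2) x'' y''], simp)
    have "vcomp C (hcomp C pb (hcomp C pb \<xi> \<xi>') \<xi>'') (span_assoc C pb S S' S'') =
      vcomp C (span_assoc C pb T T' T'') (hcomp C pb \<xi> (hcomp C pb \<xi>' \<xi>''))"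
    proof -
      \<comment> \<open>The parallel isomorphism is the rebracketing of the representing spans
        \<open>M\<close>, \<open>M'\<close>, \<open>M''\<close>. The two equations demanded of it
        are naturality of \<open>assoc_map\<close> along the left and along the right legs of the
        cells.\<close>
      note sq = vcomp_graph_square[where M = "M \<odot> M' \<odot> M''" and N = "(M \<odot> M') \<odot> M''" and u = "assoc_map M M' M''"]
      show ?thesis
        unfolding right left
        by (subst (1 2) span_assoc_graph; (rule sq)?)
          (simp_all add: hcomp_map_span_map h assoc_map_span_map assoc_map_iso assoc_map_natural[OF x x' x''] assoc_map_natural[OF y y' y''])
    qed
    then show "Comp (Span C A E) (Assoc (Span2 C pb) A B D E b) (FAr (comp_right_nested (Span2 C pb) A B D E) \<Phi>) =
      Comp (Span C A E) (FAr (comp_left_nested (Span2 C pb) A B D E) \<Phi>) (Assoc (Span2 C pb) A B D E a)"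
      by (simp add: eq comp_right_nested_def comp_left_nested_def)
  qed
qed

lemma RUnit_natural:
  assumes A: "A \<in> Ob C"
  shows "natural_iso (Span C A B) (Span C A B) (unit_before (Span2 C pb) A B) id_funct (RUnit (Span2 C pb) A B)"
proof (rule natural_iso.intro)
  show "is_functor (Span C A B) (Span C A B) (unit_before (Span2 C pb) A B)"
    using functor_unit_before[OF IdF_functor[OF A] Span_category hcomp_functor[of A A B]]
    by (simp add: unit_before_def)
  show "is_functor (Span C A B) (Span C A B) id_funct"
    by (rule functor_id[OF Span_category])
  let ?I = "id_span C A"
  show "natural_iso_axioms (Span C A B) (Span C A B) (unit_before (Span2 C pb) A B) id_funct (RUnit (Span2 C pb) A B)"
  proof
    fix S assume "S \<in> Ob (Span C A B)"
    then have S [simp]: "wf_span S" "Cod C (lleg S) = A" "Cod C (rleg S) = B"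
      by (simp_all add: is_span_iff)
    note I = id_span_left[OF S(1,2)]
    have *: "is_span C A B (?I \<odot> S)"
      using span_mapD(1,6,7)[OF I(2)] by (simp add: is_span_iff del: legs_hspan)
    show "RUnit (Span2 C pb) A B S \<in> Hom (Span C A B) (FOb (unit_before (Span2 C pb) A B) S) (FOb id_funct S)"
      using graph_Hom[OF I(2) *] I(3) by (simp add: unit_before_def id_funct_def)
    show "is_iso (Span C A B) (RUnit (Span2 C pb) A B S)"
      using graph_is_iso[OF I(2,1) *] I(3) by simp
  next
    fix \<xi> S T assume "\<xi> \<in> Hom (Span C A B) S T"
    then obtain M x y where x: "span_map M S x" and y: "span_map M T y" and \<xi>: "\<xi> = cell S T x y"
      and [simp]: "wf_span S" "wf_span T" "Cod C (lleg S) = A" "Cod C (lleg T) = A" "Cod C (lleg M) = A"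
      by (rule Hom_SpanE)
    note [simp] = x y span_mapD(1)[OF x] A span_map_Id
    have I: "span_map ?I ?I (Id C A)"
      using span_map_Id[of ?I] by simp
    have "hcomp C pb (id_cell C ?I) \<xi> = cell (?I \<odot> S) (?I \<odot> T) (hcomp_map ?I M ?I S (Id C A) x) (hcomp_map ?I M ?I T (Id C A) y)"
      unfolding \<xi> id_cell_graph by simp (rule hcomp_cell[OF I I x y], simp)
    \<comment> \<open>Here the parallel isomorphism is the unit projection of the representing span,
      from \<open>?I \<odot> M\<close> to \<open>M\<close>.\<close>
    moreover have "vcomp C \<xi> (span_runit C pb A S) = vcomp C (span_runit C pb A T)
      (cell (?I \<odot> S) (?I \<odot> T) (hcomp_map ?I M ?I S (Id C A) x) (hcomp_map ?I M ?I T (Id C A) y))"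
      unfolding \<xi>
      by (subst (1 2) id_span_left(3); (rule vcomp_graph_square[where M = "?I \<odot> M" and N = M and u = "pr2 ?I M"])?)
        (simp_all add: hcomp_map_span_map I id_span_left)
    ultimately show "Comp (Span C A B) (RUnit (Span2 C pb) A B T) (FAr (unit_before (Span2 C pb) A B) \<xi>) =
      Comp (Span C A B) (FAr id_funct \<xi>) (RUnit (Span2 C pb) A B S)"
      by (simp add: unit_before_def id_funct_def)
  qed
qed

lemma LUnit_natural:
  assumes B: "B \<in> Ob C"
  shows "natural_iso (Span C A B) (Span C A B) (unit_after (Span2 C pb) A B) id_funct (LUnit (Span2 C pb) A B)"
proof (rule natural_iso.intro)
  show "is_functor (Span C A B) (Span C A B) (unit_after (Span2 C pb) A B)"
    using functor_unit_after[OF IdF_functor[OF B] Span_category hcomp_functor[of A B B]]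
    by (simp add: unit_after_def)
  show "is_functor (Span C A B) (Span C A B) id_funct"
    by (rule functor_id[OF Span_category])
  let ?I = "id_span C B"
  show "natural_iso_axioms (Span C A B) (Span C A B) (unit_after (Span2 C pb) A B) id_funct (LUnit (Span2 C pb) A B)"
  proof
    fix S assume "S \<in> Ob (Span C A B)"
    then have S [simp]: "wf_span S" "Cod C (lleg S) = A" "Cod C (rleg S) = B"
      by (simp_all add: is_span_iff)
    note I = id_span_right[OF S(1,3)]
    have *: "is_span C A B (S \<odot> ?I)"
      using span_mapD(1,6,7)[OF I(2)] by (simp add: is_span_iff del: legs_hspan)
    show "LUnit (Span2 C pb) A B S \<in> Hom (Span C A B) (FOb (unit_after (Span2 C pb) A B) S) (FOb id_funct S)"
      using graph_Hom[OF I(2) *] I(3) by (simp add: unit_after_def id_funct_def)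
    show "is_iso (Span C A B) (LUnit (Span2 C pb) A B S)"
      using graph_is_iso[OF I(2,1) *] I(3) by simp
  next
    fix \<xi> S T assume "\<xi> \<in> Hom (Span C A B) S T"
    then obtain M x y where x: "span_map M S x" and y: "span_map M T y" and \<xi>: "\<xi> = cell S T x y"
      and [simp]: "wf_span S" "wf_span T" "Cod C (rleg S) = B" "Cod C (rleg T) = B" "Cod C (rleg M) = B"
      by (rule Hom_SpanE)
    note [simp] = x y span_mapD(1)[OF x] B span_map_Id
    have I: "span_map ?I ?I (Id C B)"
      using span_map_Id[of ?I] by simp
    have "hcomp C pb \<xi> (id_cell C ?I) = cell (S \<odot> ?I) (T \<odot> ?I) (hcomp_map M ?I S ?I x (Id C B)) (hcomp_map M ?I T ?I y (Id C B))"
      unfolding \<xi> id_cell_graph by simp (rule hcomp_cell[OF x y I I], simp)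
    moreover have "vcomp C \<xi> (span_lunit C pb B S) = vcomp C (span_lunit C pb B T)
      (cell (S \<odot> ?I) (T \<odot> ?I) (hcomp_map M ?I S ?I x (Id C B)) (hcomp_map M ?I T ?I y (Id C B)))"
      unfolding \<xi>
      by (subst (1 2) id_span_right(3); (rule vcomp_graph_square[where M = "M \<odot> ?I" and N = M and u = "pr1 M ?I"])?)
        (simp_all add: hcomp_map_span_map I id_span_right)
    ultimately show "Comp (Span C A B) (LUnit (Span2 C pb) A B T) (FAr (unit_after (Span2 C pb) A B) \<xi>) =
      Comp (Span C A B) (FAr id_funct \<xi>) (LUnit (Span2 C pb) A B S)"
      by (simp add: unit_after_def id_funct_def)
  qed
qed

section \<open>Pentagon and triangle\<close>

lemma span_pentagon:
  assumes "is_span C A B S" "is_span C B D S'" "is_span C D E S''" "is_span C E F R"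
  shows "vcomp C (span_assoc C pb (S \<odot> S') S'' R) (span_assoc C pb S S' (S'' \<odot> R)) =
    vcomp C (hcomp C pb (span_assoc C pb S S' S'') (id_cell C R))
      (vcomp C (span_assoc C pb S (S' \<odot> S'') R) (hcomp C pb (id_cell C S) (span_assoc C pb S' S'' R)))"
proof -
  have wf [simp]: "wf_span S" "wf_span S'" "wf_span S''" "wf_span R"
    "Cod C (rleg S) = Cod C (lleg S')" "Cod C (rleg S') = Cod C (lleg S'')"
    "Cod C (rleg S'') = Cod C (lleg R)"
    using assms by (simp_all add: is_span_iff)
  have 1: "span_map (S \<odot> S' \<odot> S'' \<odot> R) ((S \<odot> S') \<odot> S'' \<odot> R) (assoc_map S S' (S'' \<odot> R))"
    "span_map ((S \<odot> S') \<odot> S'' \<odot> R) (((S \<odot> S') \<odot> S'') \<odot> R) (assoc_map (S \<odot> S') S'' R)"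
    "span_map (S \<odot> (S' \<odot> S'') \<odot> R) ((S \<odot> S' \<odot> S'') \<odot> R) (assoc_map S (S' \<odot> S'') R)"
    "span_map (S \<odot> S' \<odot> S'') ((S \<odot> S') \<odot> S'') (assoc_map S S' S'')"
    "span_map (S' \<odot> S'' \<odot> R) ((S' \<odot> S'') \<odot> R) (assoc_map S' S'' R)"
    by (rule assoc_map_span_map; simp)+
  have 2: "span_map (S \<odot> S' \<odot> S'' \<odot> R) (S \<odot> (S' \<odot> S'') \<odot> R)
      (hcomp_map S (S' \<odot> S'' \<odot> R) S ((S' \<odot> S'') \<odot> R) (Id C (apex C S)) (assoc_map S' S'' R))"
    by (rule hcomp_map_span_map[OF span_map_Id 1(5)]) simp_all
  have 3: "span_map ((S \<odot> S' \<odot> S'') \<odot> R) (((S \<odot> S') \<odot> S'') \<odot> R)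
      (hcomp_map (S \<odot> S' \<odot> S'') R ((S \<odot> S') \<odot> S'') R (assoc_map S S' S'') (Id C (apex C R)))"
    by (rule hcomp_map_span_map[OF 1(4) span_map_Id]) simp_all
  have 4: "hcomp C pb (graph S S (Id C (apex C S))) (graph (S' \<odot> S'' \<odot> R) ((S' \<odot> S'') \<odot> R) (assoc_map S' S'' R)) =
      graph (S \<odot> S' \<odot> S'' \<odot> R) (S \<odot> (S' \<odot> S'') \<odot> R)
      (hcomp_map S (S' \<odot> S'' \<odot> R) S ((S' \<odot> S'') \<odot> R) (Id C (apex C S)) (assoc_map S' S'' R))"
    by (rule hcomp_graph[OF span_map_Id 1(5)]) simp_all
  have 5: "hcomp C pb (graph (S \<odot> S' \<odot> S'') ((S \<odot> S') \<odot> S'') (assoc_map S S' S'')) (graph R R (Id C (apex C R))) =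
      graph ((S \<odot> S' \<odot> S'') \<odot> R) (((S \<odot> S') \<odot> S'') \<odot> R)
      (hcomp_map (S \<odot> S' \<odot> S'') R ((S \<odot> S') \<odot> S'') R (assoc_map S S' S'') (Id C (apex C R)))"
    by (rule hcomp_graph[OF 1(4) span_map_Id]) simp_all
  have 6: "span_assoc C pb (S \<odot> S') S'' R = graph ((S \<odot> S') \<odot> S'' \<odot> R) (((S \<odot> S') \<odot> S'') \<odot> R) (assoc_map (S \<odot> S') S'' R)"
    "span_assoc C pb S S' (S'' \<odot> R) = graph (S \<odot> S' \<odot> S'' \<odot> R) ((S \<odot> S') \<odot> S'' \<odot> R) (assoc_map S S' (S'' \<odot> R))"
    "span_assoc C pb S S' S'' = graph (S \<odot> S' \<odot> S'') ((S \<odot> S') \<odot> S'') (assoc_map S S' S'')"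
    "span_assoc C pb S (S' \<odot> S'') R = graph (S \<odot> (S' \<odot> S'') \<odot> R) ((S \<odot> S' \<odot> S'') \<odot> R) (assoc_map S (S' \<odot> S'') R)"
    "span_assoc C pb S' S'' R = graph (S' \<odot> S'' \<odot> R) ((S' \<odot> S'') \<odot> R) (assoc_map S' S'' R)"
    by (rule span_assoc_graph; simp)+
  \<comment> \<open>Every cell in the equation is now the graph of a map, so both sides become
    graphs of composites, which \<open>assoc_map_pentagon\<close> identifies.\<close>
  show ?thesis
    unfolding 6 id_cell_graph 4 5 graph_comp[OF 1(1,2)] graph_comp[OF 2 1(3)]
      graph_comp[OF span_map_comp[OF 2 1(3)] 3] assoc_map_pentagon[OF wf] ..
qed

lemma span_triangle:
  assumes "is_span C A B S" "is_span C B D S'"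
  shows "vcomp C (hcomp C pb (span_lunit C pb B S) (id_cell C S')) (span_assoc C pb S (id_span C B) S') =
    hcomp C pb (id_cell C S) (span_runit C pb B S')"
proof -
  let ?I = "id_span C B"
  have wf [simp]: "wf_span S" "wf_span S'" "Cod C (rleg S) = B" "Cod C (lleg S') = B"
    using assms by (simp_all add: is_span_iff)
  have [simp]: "B \<in> Ob C"
    using Cod_in_Ob[of "rleg S"] by simp
  note l = id_span_right[OF wf(1,3)] and r = id_span_left[OF wf(2,4)]
  have a: "span_map (S \<odot> ?I \<odot> S') ((S \<odot> ?I) \<odot> S') (assoc_map S ?I S')"
    by (rule assoc_map_span_map) simp_all
  have h: "span_map ((S \<odot> ?I) \<odot> S') (S \<odot> S') (hcomp_map (S \<odot> ?I) S' S S' (pr1 S ?I) (Id C (apex C S')))"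
    by (rule hcomp_map_span_map[OF l(2) span_map_Id]) simp_all
  have 1: "hcomp C pb (graph (S \<odot> ?I) S (pr1 S ?I)) (graph S' S' (Id C (apex C S'))) =
      graph ((S \<odot> ?I) \<odot> S') (S \<odot> S') (hcomp_map (S \<odot> ?I) S' S S' (pr1 S ?I) (Id C (apex C S')))"
    by (rule hcomp_graph[OF l(2) span_map_Id]) simp_all
  have 2: "hcomp C pb (graph S S (Id C (apex C S))) (graph (?I \<odot> S') S' (pr2 ?I S')) =
      graph (S \<odot> ?I \<odot> S') (S \<odot> S') (hcomp_map S (?I \<odot> S') S S' (Id C (apex C S)) (pr2 ?I S'))"
    by (rule hcomp_graph[OF span_map_Id r(2)]) simp_all
  have 3: "span_assoc C pb S ?I S' = graph (S \<odot> ?I \<odot> S') ((S \<odot> ?I) \<odot> S') (assoc_map S ?I S')"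
    by (rule span_assoc_graph) simp_all
  \<comment> \<open>The unitors are graphs of projections as well, so the equation is that of
    \<open>hcomp_map_triangle\<close> between the underlying maps.\<close>
  show ?thesis
    unfolding 3 l(3) r(3) id_cell_graph 1 2 graph_comp[OF a h] hcomp_map_triangle[OF wf] ..
qed

lemma Span2_bicategory: "bicategory (Span2 C pb)"
proof (rule bicategory.intro, goal_cases)
  case 1 show ?case by (simp add: Span_category)
next
  case 2 then show ?case by (simp add: IdF_functor)
next
  case 3 show ?case by (simp add: hcomp_functor)
next
  case (4 A B D E) show ?case
    using Assoc_natural[of A B D E] by simp
next
  case (5 A B) then show ?case using RUnit_natural[of A B] by simp
next
  case (6 A B) then show ?case using LUnit_natural[of B A] by simp
next
  case (7 A B D E F S S' S'' R) then show ?case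
    using span_pentagon[of A B S D S' E S'' F R] by (simp only: Span2_simps Span_simps funct.simps prod.case mem_Collect_eq)
next
  case (8 A B D S S') then show ?case
    using span_triangle[of A B S D S'] by (simp only: Span2_simps Span_simps funct.simps prod.case mem_Collect_eq)
qed

end

theorem theorem8:
  fixes C :: "('o, 'm) cat" and pb :: "'m \<Rightarrow> 'm \<Rightarrow> 'm span"
  assumes "category C"
    and "has_pullbacks C"
    and "has_terminal C"
    and "pullback_choice C pb"
  shows "bicategory (Span2 C pb)"
proof -
  interpret pullback_category C pb
    using assms(1,4) by (simp add: pullback_category_def pullback_category_axioms_def)
  show ?thesis
    by (rule Span2_bicategory)
qed

end
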